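(* Let $S \subset \mathbb{N}$ be a divisor stable and multiplicatively closed set. Let $B$ be a $\mathbb{Z}$-torsion free $\mathbb{Z}_S$-algebra with commuting Frobenius lifts $\psi^p_S$ for all primes $p \in S$, let $\psi^n_S = \prod_{p\in S}(\psi^p_S)^{\mathrm{ord}_p(n)}$ for $n \ge 1$ (product over the primes $p\in S$), and let $(\lambda^n_S)$ be the special $\lambda$-ring structure on $B$ with Adams operators $\psi^n_S$. Let $\pi : B \to R$ be a homomorphism of $\mathbb{Z}_S$-algebras, let $1 \le N \le \infty$, and let $\alpha_{S_N} : B \to W_{S_N}(R)$ be the composition $$\alpha_{S_N} : B \xrightarrow{\tilde\alpha_S} W_S(B) \xrightarrow{W_S(\pi)} W_S(R) \to W_{S_N}(R),$$ where the last map is the canonical projection and $\tilde\alpha_S$ is the unique ring homomorphism such that $\mathcal{G}_S\circ\tilde\alpha_S$ maps each $x\in B$ to $(\psi^n_S(x))_{n\in S}\in B^S$. Then $$\ker \alpha_{S_N} = \{ x \in B \mid \pi(\lambda^n_S (x)) = 0 \text{ for all integers } n \text{ with } 1 \le n < N \}.$$ Moreover, for every $x \in B$ the following formula holds in $\Lambda(B) = 1 + tB[[t]]$: $$\lambda_S (x) = \prod_{k \in S} (1 - t^k)^{\tau_k (x)},$$ where $\lambda_S(x) = \sum_{i=0}^\infty (-1)^i\lambda^i_S(x)t^i$. Equivalently, for all $x\in B$ and all $n \ge 1$, $$(-1)^n \lambda^n_S (x) = \sum_{\| \nu \| = n} (-1)^{|\nu|} \binom{\tau (x)}{\nu} \quad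 \text{in } B,$$ where the sum is over all $S$-tuples $\nu = (\nu_k)_{k\in S}$ of integers $\nu_k\ge 0$ with $\|\nu\| = n$.
   Context: All rings are associative, commutative and unital; ring homomorphisms are unital. $\mathbb{N}$ denotes the positive integers. A subset $T \subset \mathbb{N}$ is divisor stable if every positive divisor of an element of $T$ lies in $T$. The set $S$ is divisor stable and multiplicatively closed, i.e. $S$ consists of all natural numbers whose prime divisors lie in a given set of prime numbers (so $1\in S$). For $1 \le N \le \infty$ set $S_N = \{\nu \in S \mid \nu < N\}$. Set $\mathbb{Z}_S = \mathbb{Z}[p^{-1} \mid p \text{ prime}, p \notin S]$. A Frobenius lift for a prime $p$ on $B$ is a ring endomorphism $\psi^p$ of $B$ with $\psi^p(b)\equiv b^p \bmod pB$ for all $b\in B$. For a divisor stable set $T$ and a commutative ring $A$, $W_T(A)$ is the ring of $T$-Witt vectors: as a set $W_T(A) = A^T$, with the unique ring structure functorial in $A$ for which the ghost map $\mathcal{G}_T : W_T(A) \to A^T$, $(a_n)_{n\in T} \mapsto \big(\sum_{d \mid n} d\, a_d^{n/d}\big)_{n \in T}$, is a natural ring homomorphism (with $A^T$ carrying the product ring structure); $W_\emptyset(A) = 0$. For a ring homomorphism $\pi$, $W_T(\pi)$ is the induced (componentwise) map. The canonical projection $W_S(R)\to W_{S_N}(R)$ forgets the components outside $S_N$. The Adams operators $\psi^n$ of a $\lambda$-ring $(B,(\lambda^n))$ are given by $\sum_{n\ge 1} \psi^n(x) t^n = -t \frac{d}{dt} \log\big(\sum_{i \ge 0} (-1)^i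 \lambda^i(x) t^i\big)$. Existence and uniqueness of the special $\lambda$-ring structure on $B$ with Adams operators $\psi^n_S$ follow from Wilkerson's lemma: if $B$ is a commutative ring without $\mathbb{Z}$-torsion with ring endomorphisms $\psi^n$ ($n\ge1$) such that $\psi^1 = \mathrm{id}$, $\psi^n\circ\psi^m = \psi^{nm}$, and $\psi^p(b) \equiv b^p \bmod pB$ for all $b\in B$ and all primes $p$, then there is a unique special $\lambda$-ring structure on $B$ with Adams operators $\psi^n$. Let $\mu$ be the Möbius function. For $x \in B$ and $k \in S$ set $$\tau_k(x) = k^{-1} \sum_{d \mid k} \mu(d)\, \psi_S^{k/d}(x) \in B\otimes_{\mathbb{Z}}\mathbb{Q}.$$ For an $S$-tuple $\nu = (\nu_k)_{k \in S}$ of integers $\nu_k \ge 0$ put $|\nu| = \sum_{k\in S} \nu_k$, $\|\nu\| = \sum_{k \in S} k\nu_k$, and $\binom{\tau(x)}{\nu} = \prod_{k\in S} \binom{\tau_k(x)}{\nu_k} \in B\otimes\mathbb{Q}$, where $\binom{y}{j} = y(y-1)\cdots(y-j+1)/j!$. For $y \in B\otimes\mathbb{Q}$, $(1-t^k)^{y} = \sum_{j\ge 0}(-1)^j\binom{y}{j}t^{kj}$ in $1+t(B\otimes\mathbb{Q})[[t]]$; the product $\prod_{k\in S}(1-t^k)^{\tau_k(x)}$ is the $t$-adically convergent product of power series, a priori in $1+t(B\otimes\mathbb{Q})[[t]]$, which contains $\Lambda(B)$. *)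

theory Defs
  imports
    "HOL-Algebra.Algebraic_Closure_Type"
    "HOL-Algebra.Generated_Rings"
    "HOL-Algebra.Module"
    "HOL-Library.Poly_Mapping"
    "HOL-Library.Extended_Nat"
    "HOL-Computational_Algebra.Squarefree"
begin

hide_const (open) Divisibility.prime

text \<open>
  All rings are \<open>HOL-Algebra\<close> structures (not type classes), so that the zero ring is allowed.
  The positive integers are the nonzero elements of \<^typ>\<open>nat\<close>.
\<close>

section \<open>Index sets and base rings\<close>

definition divisor_stable :: "nat set \<Rightarrow> bool" where
  "divisor_stable T \<longleftrightarrow> 0 \<notin> T \<and> (\<forall>n\<in>T. \<forall>d. d dvd n \<longrightarrow> d \<in> T)"

definition mult_closed :: "nat set \<Rightarrow> bool" where
  "mult_closed S \<longleftrightarrow> 1 \<in> S \<and> (\<forall>m\<in>S. \<forall>n\<in>S. m * n \<in> S)"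

definition truncate_set :: "nat set \<Rightarrow> enat \<Rightarrow> nat set" where
  "truncate_set S N = {n \<in> S. enat n < N}"

definition Z_ring :: "nat set \<Rightarrow> rat ring" where
  "Z_ring S = (ring_of_type_algebra :: rat ring)
     \<lparr>carrier := generate_ring (ring_of_type_algebra :: rat ring)
        {1 / of_nat p | p :: nat. prime p \<and> p \<notin> S}\<rparr>"

definition torsion_free :: "('a, 'm) ring_scheme \<Rightarrow> bool" where
  "torsion_free A \<longleftrightarrow>
     (\<forall>n::nat. \<forall>x\<in>carrier A. n > 0 \<and> [n] \<cdot>\<^bsub>A\<^esub> x = \<zero>\<^bsub>A\<^esub> \<longrightarrow> x = \<zero>\<^bsub>A\<^esub>)"

definition frobenius_lift :: "('a, 'm) ring_scheme \<Rightarrow> nat \<Rightarrow> ('a \<Rightarrow> 'a) \<Rightarrow> bool" where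
  "frobenius_lift A p \<phi> \<longleftrightarrow> \<phi> \<in> ring_hom A A \<and>
     (\<forall>b\<in>carrier A. \<exists>c\<in>carrier A. \<phi> b \<ominus>\<^bsub>A\<^esub> b [^]\<^bsub>A\<^esub> p = [p] \<cdot>\<^bsub>A\<^esub> c)"

text \<open>
  The composite of the maps \<open>(\<psi> p)\<close> to the power \<open>ord\<^sub>p n\<close> over the primes \<open>p\<close> in \<open>S\<close>. Only the
  finitely many prime divisors of \<open>n\<close> contribute; they are taken in increasing order, which is
  immaterial for commuting maps.
\<close>
definition psi_S :: "nat set \<Rightarrow> (nat \<Rightarrow> 'a \<Rightarrow> 'a) \<Rightarrow> nat \<Rightarrow> 'a \<Rightarrow> 'a" where
  "psi_S S \<psi> n = foldr (\<lambda>p f. (\<psi> p ^^ multiplicity p n) \<circ> f)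
     (sorted_list_of_set {p \<in> S. prime p \<and> p dvd n}) id"

definition moebius :: "nat \<Rightarrow> int" where
  "moebius n = (if squarefree n then (- 1) ^ card (prime_factors n) else 0)"


section \<open>Integer polynomials and their values\<close>

text \<open>
  Polynomials over the integers in variables indexed by \<open>'v\<close>: finitely supported functions from
  exponent vectors to coefficients, with the convolution product of \<open>HOL-Library.Poly_Mapping\<close>.
\<close>
type_synonym 'v zpoly = "('v \<Rightarrow>\<^sub>0 nat) \<Rightarrow>\<^sub>0 int"

definition zvar :: "'v \<Rightarrow> 'v zpoly" where
  "zvar i = Poly_Mapping.single (Poly_Mapping.single i 1) 1"

definition zvars :: "'v zpoly \<Rightarrow> 'v set" where
  "zvars P = (\<Union>m\<in>Poly_Mapping.keys P. Poly_Mapping.keys m)"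

definition zeval :: "('a, 'm) ring_scheme \<Rightarrow> ('v \<Rightarrow> 'a) \<Rightarrow> 'v zpoly \<Rightarrow> 'a" where
  "zeval A v P = (\<Oplus>\<^bsub>A\<^esub>m\<in>Poly_Mapping.keys P. [(Poly_Mapping.lookup P m)] \<cdot>\<^bsub>A\<^esub>
     (\<Otimes>\<^bsub>A\<^esub>i\<in>Poly_Mapping.keys m. v i [^]\<^bsub>A\<^esub> Poly_Mapping.lookup m i))"


section \<open>Witt vectors\<close>

definition ghost_map :: "('a, 'm) ring_scheme \<Rightarrow> nat set \<Rightarrow> (nat \<Rightarrow> 'a) \<Rightarrow> nat \<Rightarrow> 'a" where
  "ghost_map A T a = (\<lambda>n\<in>T. \<Oplus>\<^bsub>A\<^esub>d\<in>{d. d dvd n}. [d] \<cdot>\<^bsub>A\<^esub> (a d [^]\<^bsub>A\<^esub> (n div d)))"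

text \<open>
  The functorial ring structure is given by the universal Witt polynomials: the sum and the product
  of the generic Witt vectors \<open>(X\<^sub>n)\<close>, \<open>(Y\<^sub>n)\<close> are the unique Witt vectors over the polynomial ring
  \<open>\<int>[X, Y]\<close> (where the ghost map is injective) whose ghost vectors are the componentwise sum and
  product of the generic ghost vectors. By functoriality every other sum and product is obtained
  by specialization. The variables \<open>X\<^sub>n\<close>, \<open>Y\<^sub>n\<close> are \<open>zvar (Inl n)\<close>, \<open>zvar (Inr n)\<close>.
\<close>
definition witt_add_poly :: "nat set \<Rightarrow> nat \<Rightarrow> (nat + nat) zpoly" where
  "witt_add_poly T = (THE s. s \<in> extensional T \<and>
     (\<forall>n\<in>T. ghost_map ring_of_type_algebra T s n =
        ghost_map ring_of_type_algebra T (\<lambda>i. zvar (Inl i)) n +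
        ghost_map ring_of_type_algebra T (\<lambda>i. zvar (Inr i)) n))"

definition witt_mult_poly :: "nat set \<Rightarrow> nat \<Rightarrow> (nat + nat) zpoly" where
  "witt_mult_poly T = (THE s. s \<in> extensional T \<and>
     (\<forall>n\<in>T. ghost_map ring_of_type_algebra T s n =
        ghost_map ring_of_type_algebra T (\<lambda>i. zvar (Inl i)) n *
        ghost_map ring_of_type_algebra T (\<lambda>i. zvar (Inr i)) n))"

definition witt_ring :: "nat set \<Rightarrow> ('a, 'm) ring_scheme \<Rightarrow> (nat \<Rightarrow> 'a) ring" where
  "witt_ring T A = \<lparr>
     carrier = T \<rightarrow>\<^sub>E carrier A,
     monoid.mult = (\<lambda>a b. \<lambda>n\<in>T. zeval A (case_sum a b) (witt_mult_poly T n)),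
     one = (\<lambda>n\<in>T. if n = 1 then \<one>\<^bsub>A\<^esub> else \<zero>\<^bsub>A\<^esub>),
     ring.zero = (\<lambda>n\<in>T. \<zero>\<^bsub>A\<^esub>),
     add = (\<lambda>a b. \<lambda>n\<in>T. zeval A (case_sum a b) (witt_add_poly T n))\<rparr>"

definition witt_map :: "nat set \<Rightarrow> ('a \<Rightarrow> 'b) \<Rightarrow> (nat \<Rightarrow> 'a) \<Rightarrow> nat \<Rightarrow> 'b" where
  "witt_map T \<phi> a = (\<lambda>n\<in>T. \<phi> (a n))"

definition witt_proj :: "nat set \<Rightarrow> (nat \<Rightarrow> 'a) \<Rightarrow> nat \<Rightarrow> 'a" where
  "witt_proj T a = restrict a T"


section \<open>Power series\<close>

definition power_series :: "('a, 'm) ring_scheme \<Rightarrow> (nat \<Rightarrow> 'a) ring" where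
  "power_series A = \<lparr>
     carrier = UNIV \<rightarrow> carrier A,
     monoid.mult = (\<lambda>f g n. \<Oplus>\<^bsub>A\<^esub>i\<in>{..n}. f i \<otimes>\<^bsub>A\<^esub> g (n - i)),
     one = (\<lambda>n. if n = 0 then \<one>\<^bsub>A\<^esub> else \<zero>\<^bsub>A\<^esub>),
     ring.zero = (\<lambda>n. \<zero>\<^bsub>A\<^esub>),
     add = (\<lambda>f g n. f n \<oplus>\<^bsub>A\<^esub> g n)\<rparr>"

definition ps_t :: "('a, 'm) ring_scheme \<Rightarrow> nat \<Rightarrow> 'a" where
  "ps_t A = (\<lambda>n. if n = 1 then \<one>\<^bsub>A\<^esub> else \<zero>\<^bsub>A\<^esub>)"

definition ps_deriv :: "('a, 'm) ring_scheme \<Rightarrow> (nat \<Rightarrow> 'a) \<Rightarrow> nat \<Rightarrow> 'a" where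
  "ps_deriv A f = (\<lambda>n. [(Suc n)] \<cdot>\<^bsub>A\<^esub> f (Suc n))"

text \<open>The set \<open>\<Lambda>(A) = 1 + t A[[t]]\<close>.\<close>
definition Lambda :: "('a, 'm) ring_scheme \<Rightarrow> (nat \<Rightarrow> 'a) set" where
  "Lambda A = {f \<in> carrier (power_series A). f 0 = \<one>\<^bsub>A\<^esub>}"

text \<open>
  The product of the family \<open>f\<close> over \<open>S\<close> converges \<open>t\<close>-adically to \<open>g\<close>: each coefficient is
  eventually constant along the net of finite partial products.
\<close>
definition has_tadic_prod ::
  "('a, 'm) ring_scheme \<Rightarrow> nat set \<Rightarrow> (nat \<Rightarrow> nat \<Rightarrow> 'a) \<Rightarrow> (nat \<Rightarrow> 'a) \<Rightarrow> bool" where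
  "has_tadic_prod A S f g \<longleftrightarrow>
     (\<forall>n. eventually (\<lambda>F. (\<Otimes>\<^bsub>power_series A\<^esub>k\<in>F. f k) n = g n) (finite_subsets_at_top S))"


section \<open>Special lambda-rings\<close>

definition esym :: "nat \<Rightarrow> 'i set \<Rightarrow> ('i \<Rightarrow> 'v zpoly) \<Rightarrow> 'v zpoly" where
  "esym k I f = (\<Sum>J | J \<subseteq> I \<and> card J = k. \<Prod>i\<in>J. f i)"

text \<open>
  The universal polynomial \<open>P\<^sub>n\<close>: it expresses the coefficient of \<open>t\<^sup>n\<close> in
  \<open>\<Prod>\<^sub>i\<^sub>j (1 + X\<^sub>i Y\<^sub>j t)\<close>, for \<open>i, j\<close> in \<open>{1..n}\<close>, through the elementary symmetric
  polynomials of the \<open>X\<^sub>i\<close> (in the variables \<open>Inl\<close>) and of the \<open>Y\<^sub>j\<close> (in the variables \<open>Inr\<close>).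
\<close>
definition lambda_mult_poly :: "nat \<Rightarrow> (nat + nat) zpoly" where
  "lambda_mult_poly n = (THE P. zvars P \<subseteq> Inl ` {1..n} \<union> Inr ` {1..n} \<and>
     zeval (ring_of_type_algebra :: (nat + nat) zpoly ring)
       (case_sum (\<lambda>i. esym i {1..n} (\<lambda>k. zvar (Inl k))) (\<lambda>j. esym j {1..n} (\<lambda>k. zvar (Inr k)))) P
     = esym n ({1..n} \<times> {1..n}) (\<lambda>(i, j). zvar (Inl i) * zvar (Inr j)))"

text \<open>
  The universal polynomial \<open>P\<^sub>m\<^sub>,\<^sub>n\<close>: it expresses the coefficient of \<open>t\<^sup>m\<close> in
  \<open>\<Prod>\<^sub>I (1 + X\<^sub>I t)\<close>, where \<open>I\<close> runs through the \<open>n\<close>-element subsets of \<open>{1..m * n}\<close> and \<open>X\<^sub>I\<close> is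
  the product of the \<open>X\<^sub>i\<close> with \<open>i\<close> in \<open>I\<close>, through the elementary symmetric polynomials of the \<open>X\<^sub>i\<close>.
\<close>
definition lambda_comp_poly :: "nat \<Rightarrow> nat \<Rightarrow> nat zpoly" where
  "lambda_comp_poly m n = (THE P. zvars P \<subseteq> {1..m * n} \<and>
     zeval (ring_of_type_algebra :: nat zpoly ring) (\<lambda>i. esym i {1..m * n} zvar) P
     = esym m {I. I \<subseteq> {1..m * n} \<and> card I = n} (\<lambda>I. \<Prod>i\<in>I. zvar i))"

definition special_lambda_ring :: "('a, 'm) ring_scheme \<Rightarrow> (nat \<Rightarrow> 'a \<Rightarrow> 'a) \<Rightarrow> bool" where
  "special_lambda_ring A lam \<longleftrightarrow> cring A \<and>
     (\<forall>n. \<forall>x\<in>carrier A. lam n x \<in> carrier A) \<and>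
     (\<forall>x\<in>carrier A. lam 0 x = \<one>\<^bsub>A\<^esub>) \<and>
     (\<forall>x\<in>carrier A. lam 1 x = x) \<and>
     (\<forall>n. \<forall>x\<in>carrier A. \<forall>y\<in>carrier A.
        lam n (x \<oplus>\<^bsub>A\<^esub> y) = (\<Oplus>\<^bsub>A\<^esub>i\<in>{..n}. lam i x \<otimes>\<^bsub>A\<^esub> lam (n - i) y)) \<and>
     (\<forall>n\<ge>2. lam n \<one>\<^bsub>A\<^esub> = \<zero>\<^bsub>A\<^esub>) \<and>
     (\<forall>n. \<forall>x\<in>carrier A. \<forall>y\<in>carrier A.
        lam n (x \<otimes>\<^bsub>A\<^esub> y) =
          zeval A (case_sum (\<lambda>i. lam i x) (\<lambda>j. lam j y)) (lambda_mult_poly n)) \<and>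
     (\<forall>m n. \<forall>x\<in>carrier A.
        lam m (lam n x) = zeval A (\<lambda>i. lam i x) (lambda_comp_poly m n))"

text \<open>The series with coefficients \<open>(-1)\<^sup>i \<lambda>\<^sup>i(x)\<close>.\<close>
definition lambda_series ::
  "('a, 'm) ring_scheme \<Rightarrow> (nat \<Rightarrow> 'a \<Rightarrow> 'a) \<Rightarrow> 'a \<Rightarrow> nat \<Rightarrow> 'a" where
  "lambda_series A lam x = (\<lambda>i. [((- 1 :: int) ^ i)] \<cdot>\<^bsub>A\<^esub> lam i x)"

text \<open>
  The coefficient of \<open>t\<^sup>n\<close> in \<open>- t d/dt log f\<close>, that is in \<open>- t f' f\<^sup>-\<^sup>1\<close>, where \<open>f\<close> is the
  series above.
\<close>
definition adams_op ::
  "('a, 'm) ring_scheme \<Rightarrow> (nat \<Rightarrow> 'a \<Rightarrow> 'a) \<Rightarrow> nat \<Rightarrow> 'a \<Rightarrow> 'a" where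
  "adams_op A lam n x =
     (let P = power_series A; f = lambda_series A lam x
      in (\<ominus>\<^bsub>P\<^esub> (ps_t A \<otimes>\<^bsub>P\<^esub> ps_deriv A f \<otimes>\<^bsub>P\<^esub> inv\<^bsub>P\<^esub> f)) n)"


section \<open>Rationalization\<close>

text \<open>
  The \<open>\<rat>\<close>-algebra \<open>A \<otimes> \<rat>\<close>, as the localization of \<open>A\<close> at the positive integers: \<open>rat_class A a m\<close>
  is the class of \<open>a \<otimes> 1/m\<close>, and \<open>a \<otimes> 1/m = b \<otimes> 1/n\<close> iff \<open>k n a = k m b\<close> for some \<open>k > 0\<close>.
\<close>
definition rat_class :: "('a, 'm) ring_scheme \<Rightarrow> 'a \<Rightarrow> nat \<Rightarrow> ('a \<times> nat) set" where
  "rat_class A a m = {(b, n). b \<in> carrier A \<and> n > 0 \<and>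
     (\<exists>k>0. [(k * n)] \<cdot>\<^bsub>A\<^esub> a = [(k * m)] \<cdot>\<^bsub>A\<^esub> b)}"

definition rationalization :: "('a, 'm) ring_scheme \<Rightarrow> (rat, ('a \<times> nat) set) module" where
  "rationalization A = \<lparr>
     carrier = {rat_class A a m | a m. a \<in> carrier A \<and> m > 0},
     monoid.mult = (\<lambda>U V. \<Union>(a, m)\<in>U. \<Union>(b, n)\<in>V. rat_class A (a \<otimes>\<^bsub>A\<^esub> b) (m * n)),
     one = rat_class A \<one>\<^bsub>A\<^esub> 1,
     ring.zero = rat_class A \<zero>\<^bsub>A\<^esub> 1,
     add = (\<lambda>U V. \<Union>(a, m)\<in>U. \<Union>(b, n)\<in>V.
       rat_class A ([n] \<cdot>\<^bsub>A\<^esub> a \<oplus>\<^bsub>A\<^esub> [m] \<cdot>\<^bsub>A\<^esub> b) (m * n)),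
     module.smult = (\<lambda>q U. \<Union>(a, m)\<in>U.
       rat_class A ([(fst (quotient_of q))] \<cdot>\<^bsub>A\<^esub> a) (nat (snd (quotient_of q)) * m))\<rparr>"

definition to_rat :: "('a, 'm) ring_scheme \<Rightarrow> 'a \<Rightarrow> ('a \<times> nat) set" where
  "to_rat A a = rat_class A a 1"

definition tau ::
  "('a, 'm) ring_scheme \<Rightarrow> (nat \<Rightarrow> 'a \<Rightarrow> 'a) \<Rightarrow> nat \<Rightarrow> 'a \<Rightarrow> ('a \<times> nat) set" where
  "tau A \<psi> k x = (1 / of_nat k) \<odot>\<^bsub>rationalization A\<^esub>
     to_rat A (\<Oplus>\<^bsub>A\<^esub>d\<in>{d. d dvd k}. [(moebius d)] \<cdot>\<^bsub>A\<^esub> \<psi> (k div d) x)"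

definition binom :: "(rat, 'k, 'm) module_scheme \<Rightarrow> 'k \<Rightarrow> nat \<Rightarrow> 'k" where
  "binom K y j = (1 / fact j) \<odot>\<^bsub>K\<^esub> (\<Otimes>\<^bsub>K\<^esub>i\<in>{..<j}. y \<ominus>\<^bsub>K\<^esub> [i] \<cdot>\<^bsub>K\<^esub> \<one>\<^bsub>K\<^esub>)"

text \<open>The power series \<open>(1 - t\<^sup>k)\<^sup>y\<close>, for \<open>k > 0\<close>.\<close>
definition one_minus_power :: "(rat, 'k, 'm) module_scheme \<Rightarrow> nat \<Rightarrow> 'k \<Rightarrow> nat \<Rightarrow> 'k" where
  "one_minus_power K k y = (\<lambda>n. if k dvd n
     then [((- 1 :: int) ^ (n div k))] \<cdot>\<^bsub>K\<^esub> binom K y (n div k) else \<zero>\<^bsub>K\<^esub>)"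

text \<open>
  Tuples \<open>\<nu>\<close> are finitely supported functions with support in \<open>S\<close>: this is no restriction, as the
  weighted size of a tuple with infinite support is infinite.
\<close>
definition tuple_size :: "(nat \<Rightarrow>\<^sub>0 nat) \<Rightarrow> nat" where
  "tuple_size \<nu> = (\<Sum>k\<in>Poly_Mapping.keys \<nu>. Poly_Mapping.lookup \<nu> k)"

definition tuple_weight :: "(nat \<Rightarrow>\<^sub>0 nat) \<Rightarrow> nat" where
  "tuple_weight \<nu> = (\<Sum>k\<in>Poly_Mapping.keys \<nu>. k * Poly_Mapping.lookup \<nu> k)"

definition binom_tuple ::
  "(rat, 'k, 'm) module_scheme \<Rightarrow> (nat \<Rightarrow> 'k) \<Rightarrow> (nat \<Rightarrow>\<^sub>0 nat) \<Rightarrow> 'k" where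
  "binom_tuple K y \<nu> = (\<Otimes>\<^bsub>K\<^esub>k\<in>Poly_Mapping.keys \<nu>. binom K (y k) (Poly_Mapping.lookup \<nu> k))"

end

theory Submission
  imports Defs
begin

text \<open>
  Fix \<open>x\<close> and let \<open>f = \<Sum>\<^sub>i (- 1) ^ i * \<lambda>\<^sup>i(x) * t ^ i\<close>. By definition of the Adams operators,
  \<open>- t d/dt log f = \<Sum>\<^sub>n \<psi>\<^sup>n(x) * t ^ n\<close>, and \<open>\<psi>\<^sup>n\<close> depends only on the \<open>S\<close>-part of \<open>n\<close>, the largest
  divisor of \<open>n\<close> that lies in \<open>S\<close>. Over a torsion-free ring a series with constant term \<open>1\<close> is determined
  by its logarithmic derivative, degree by degree (\<open>neg_log_deriv_unique\<close>). Both parts of the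
  theorem thus follow by writing down products of series \<open>(1 - e * t ^ l) ^ y\<close>, whose negative
  logarithmic derivative is \<open>l * y * \<Sum>\<^sub>j e ^ j * t ^ (l * j)\<close> with \<open>j \<ge> 1\<close>, and adding these up.

  For the product formula take the factors \<open>(1 - t ^ k) ^ \<tau>\<^sub>k(x)\<close> with \<open>k \<in> S\<close>, over the
  rationalization of \<open>B\<close>. In degree \<open>i\<close> their negative logarithmic derivatives sum to \<open>\<Sum>\<^sub>k k * \<tau>\<^sub>k(x)\<close> over the
  divisors \<open>k\<close> of \<open>i\<close> in \<open>S\<close>, and Moebius inversion turns this into the Adams operator of the \<open>S\<close>-part of
  \<open>i\<close> (\<open>sum_tau\<close>, \<open>product_formula\<close>). Multiplying out a finite partial product gives the formula for
  the coefficients (\<open>finite_product_expansion\<close>).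

  For the kernel let \<open>a\<close> be the Witt vector of \<open>x\<close>. The zero of a ring of Witt vectors is the zero
  vector, so \<open>x\<close> lies in the kernel if and only if \<open>\<pi>(a\<^sub>d) = 0\<close> for all \<open>d < N\<close> in \<open>S\<close>. The key is the
  factorization of \<open>f\<close>, over \<open>B\<close> itself, into the factors
  \<open>(1 - a\<^sub>d ^ m' * t ^ (d * m * m')) ^ (\<mu>(m') / (m * m'))\<close>, where \<open>d \<in> S\<close> and \<open>m\<close>, \<open>m'\<close> have no prime
  divisor in \<open>S\<close> (\<open>witt_product_formula\<close>). The exponents are in \<open>\<int>\<^sub>S\<close>, and so are their
  binomial coefficients (\<open>Z_ring_gbinomial\<close>); this is where it matters that \<open>B\<close> is a
  \<open>\<int>\<^sub>S\<close>-algebra. The sum over \<open>m'\<close> in the negative logarithmic derivative cancels all terms but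
  \<open>\<Sum>\<^sub>d d * a\<^sub>d ^ (s / d)\<close>, with \<open>d\<close> running through the divisors of the \<open>S\<close>-part \<open>s\<close> of the degree, and this
  is the ghost component \<open>\<psi>\<^sup>s(x)\<close>. If now \<open>\<pi>(a\<^sub>d) = 0\<close> for all \<open>d < n\<close>, then \<open>\<pi>\<close> maps all factors that matter
  up to degree \<open>n\<close> to \<open>1\<close>, except for \<open>1 - a\<^sub>n * t ^ n\<close> in case \<open>n \<in> S\<close>. So \<open>\<pi>\<close> maps the coefficient of \<open>t ^ n\<close>
  in \<open>f\<close> to \<open>- \<pi>(a\<^sub>n)\<close> or to \<open>0\<close>, according as \<open>n\<close> is in \<open>S\<close> or not (\<open>witt_coefficient_congruence\<close>), and
  induction on \<open>n\<close> gives the equality of the two sets.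
\<close>

section \<open>Moebius sums, S-parts and binomial coefficients\<close>

definition coprime_to :: "nat set \<Rightarrow> nat set" where
  "coprime_to S = {m. m > 0 \<and> (\<forall>p\<in>S. prime p \<longrightarrow> \<not> p dvd m)}"

text \<open>
  Only squarefree divisors contribute, and those with primes in \<open>Q\<close> are the products of the
  subsets of \<open>prime_factors n \<inter> Q\<close>. The sum is therefore \<open>\<Sum>\<^sub>T (- 1) ^ card T\<close>, which is the
  expansion of the product of \<open>- 1 + 1\<close> over that set. Taking for \<open>Q\<close> the primes in \<open>S\<close> or those
  outside \<open>S\<close> gives the two cancellations needed below.
\<close>
lemma moebius_divisor_sum:
  assumes "n > 0"
  shows "(\<Sum>d | d dvd n \<and> prime_factors d \<subseteq> Q. moebius d)
    = (if prime_factors n \<inter> Q = {} then 1 else 0)"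
proof -
  let ?P = "prime_factors n \<inter> Q"
  let ?D = "{d. d dvd n \<and> prime_factors d \<subseteq> Q}"
  have fin: "finite ?D" using assms by simp
  have pf: "prime_factors (\<Prod>x\<in>T. x) = T" if "T \<subseteq> ?P" for T
  proof -
    have fX: "finite T" using that finite_subset by fastforce
    have "\<And>x. x \<in> T \<Longrightarrow> prime x" using that by auto
    then show ?thesis using fX prime_factors_prod[OF fX, of "\<lambda>x. x"]
      by (auto simp: prime_prime_factors dest: prime_gt_0_nat)
  qed
  have "(\<Sum>d\<in>?D. moebius d) = (\<Sum>d\<in>{d\<in>?D. squarefree d}. (- 1) ^ card (prime_factors d))"
    using fin by (auto simp: moebius_def sum.If_cases intro!: sum.mono_neutral_cong_right)
  also have "\<dots> = (\<Sum>T\<in>Pow ?P. (- 1) ^ card T)"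
  proof (rule sum.reindex_bij_witness[of _ "\<lambda>T. (\<Prod>x\<in>T. x)" "prime_factors"])
    fix d assume d: "d \<in> {d\<in>?D. squarefree d}"
    then have "d > 0" using assms dvd_pos_nat by blast
    moreover have "multiplicity p d = 1" if "p \<in> prime_factors d" for p
      using d that \<open>d > 0\<close> squarefree_factorial_semiring'[of d] by auto
    ultimately show "(\<Prod>x\<in>prime_factors d. x) = d"
      using prime_factorization_nat[of d] by (metis (no_types, lifting) power_one_right prod.cong)
    show "prime_factors d \<in> Pow ?P"
      using d assms by (auto simp: in_prime_factors_iff intro: dvd_trans)
  next
    fix T assume T: "T \<in> Pow ?P"
    then show pX: "prime_factors (\<Prod>x\<in>T. x) = T" using pf by auto
    have fX: "finite T" using T finite_subset by fastforce
    have pr: "\<And>x. x \<in> T \<Longrightarrow> prime x" using T by auto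
    have "squarefree (\<Prod>x\<in>T. x)"
    proof (rule squarefree_prod_coprime)
      show "\<And>a b. a \<in> T \<Longrightarrow> b \<in> T \<Longrightarrow> a \<noteq> b \<Longrightarrow> coprime a b"
        by (intro primes_coprime pr) auto
      show "\<And>a. a \<in> T \<Longrightarrow> squarefree a" using pr squarefree_prime by auto
    qed
    moreover have "(\<Prod>x\<in>T. x) dvd n"
    proof -
      have "(\<Prod>x\<in>T. x) dvd (\<Prod>p\<in>prime_factors n. p)" using T by (intro prod_dvd_prod_subset) auto
      also have "\<dots> dvd (\<Prod>p\<in>prime_factors n. p ^ multiplicity p n)"
        by (intro prod_dvd_prod dvd_power) (auto simp: prime_factors_multiplicity)
      also have "\<dots> = n" using assms prime_factorization_nat by simp
      finally show ?thesis .
    qed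
    ultimately show "(\<Prod>x\<in>T. x) \<in> {d\<in>?D. squarefree d}" using pX T by auto
  qed auto
  also have "\<dots> = (\<Prod>p\<in>?P. (- 1) + (1::int))"
    by (subst prod_add) auto
  also have "\<dots> = (if ?P = {} then 1 else 0)" by (auto simp: card_gt_0_iff)
  finally show ?thesis .
qed

lemma S_mem_iff:
  assumes "divisor_stable S" "mult_closed S" "n > 0"
  shows "n \<in> S \<longleftrightarrow> (\<forall>p. prime p \<longrightarrow> p dvd n \<longrightarrow> p \<in> S)"
proof
  show "n \<in> S \<Longrightarrow> \<forall>p. prime p \<longrightarrow> p dvd n \<longrightarrow> p \<in> S"
    using assms(1) by (auto simp: divisor_stable_def)
  show "\<forall>p. prime p \<longrightarrow> p dvd n \<longrightarrow> p \<in> S \<Longrightarrow> n \<in> S"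
    using assms(3)
  proof (induction n rule: prime_divisors_induct)
    case (unit x)
    then show ?case using assms(2) by (auto simp: mult_closed_def)
  next
    case (factor p x)
    then show ?case using assms(2) by (auto simp: mult_closed_def)
  qed auto
qed

text \<open>
  This is applied with two sets of primes: the primes in \<open>S\<close>, for the factorization of an index into
  its \<open>S\<close>-part and its prime-to-\<open>S\<close> part, and the prime divisors of a denominator, for the
  integrality of binomial coefficients.
\<close>
lemma split_by_primes:
  assumes "n > (0::nat)"
  obtains s m where "n = s * m" "s > 0" "m > 0" "\<And>p. prime p \<Longrightarrow> p dvd s \<Longrightarrow> p \<in> Q"
    "\<And>p. prime p \<Longrightarrow> p dvd m \<Longrightarrow> p \<notin> Q"
proof -
  have "\<exists>s m. n = s * m \<and> s > 0 \<and> m > 0 \<and> (\<forall>p. prime p \<longrightarrow> p dvd s \<longrightarrow> p \<in> Q)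
    \<and> (\<forall>p. prime p \<longrightarrow> p dvd m \<longrightarrow> p \<notin> Q)"
    using assms
  proof (induction n rule: prime_divisors_induct)
    case (unit x)
    then show ?case by (intro exI[of _ 1]) auto
  next
    case (factor p x)
    then obtain s m where IH: "x = s * m" "s > 0" "m > 0" "\<And>p. prime p \<Longrightarrow> p dvd s \<Longrightarrow> p \<in> Q"
      "\<And>p. prime p \<Longrightarrow> p dvd m \<Longrightarrow> p \<notin> Q" by auto
    have p: "p > 0" using factor prime_gt_0_nat by auto
    have dv: "q = p \<or> q dvd y" if "prime q" "q dvd p * y" for q y
      using that factor(1) prime_dvd_mult_iff[OF that(1)] primes_dvd_imp_eq[OF that(1) factor(1)] by auto
    show ?case
    proof (cases "p \<in> Q")
      case True
      have "q \<in> Q" if "prime q" "q dvd p * s" for q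
        using dv[OF that] IH(4)[OF that(1)] True by auto
      moreover have "p * x = (p * s) * m" using IH(1) by simp
      moreover have "p * s > 0" using p IH(2) by simp
      ultimately show ?thesis using IH(3,5) by blast
    next
      case False
      have "q \<notin> Q" if "prime q" "q dvd p * m" for q
        using dv[OF that] IH(5)[OF that(1)] False by auto
      moreover have "p * x = s * (p * m)" using IH(1) by simp
      moreover have "p * m > 0" using p IH(3) by simp
      ultimately show ?thesis using IH(2,4) by blast
    qed
  qed auto
  then show thesis using that by blast
qed

lemma coprime_to_part:
  assumes "divisor_stable S" "mult_closed S" "n > 0"
  obtains s m where "n = s * m" "s \<in> S" "m \<in> coprime_to S"
proof -
  obtain s m where sm: "n = s * m" "s > 0" "m > 0" "\<And>p. prime p \<Longrightarrow> p dvd s \<Longrightarrow> p \<in> S"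
    "\<And>p. prime p \<Longrightarrow> p dvd m \<Longrightarrow> p \<notin> S" using split_by_primes[OF assms(3)] by metis
  have "s \<in> S" using S_mem_iff[OF assms(1,2) sm(2)] sm(4) by simp
  moreover have "m \<in> coprime_to S" unfolding coprime_to_def using sm(3,5) by auto
  ultimately show thesis by (rule that[OF sm(1)])
qed

lemma coprime_S_coprime_to:
  assumes "divisor_stable S" "s \<in> S" "m \<in> coprime_to S"
  shows "coprime s m"
proof (rule ccontr)
  assume "\<not> coprime s m"
  then obtain p where "prime p" "p dvd s" "p dvd m"
    by (metis coprime_iff_gcd_eq_1 gcd_dvd1 gcd_dvd2 prime_factor_nat dvd_trans)
  then show False using assms by (auto simp: coprime_to_def divisor_stable_def)
qed

lemma coprime_to_part_unique:
  assumes "divisor_stable S" "s \<in> S" "m \<in> coprime_to S" "s' \<in> S" "m' \<in> coprime_to S" "s * m = s' * m'"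
  shows "s = s'" "m = m'"
proof -
  have "s dvd s'" using assms coprime_S_coprime_to[of S s m']
    by (metis coprime_dvd_mult_left_iff dvd_triv_left)
  moreover have "s' dvd s" using assms coprime_S_coprime_to[of S s' m]
    by (metis coprime_dvd_mult_left_iff dvd_triv_left)
  ultimately show "s = s'" by (rule dvd_antisym)
  moreover have "s > 0" using assms(1,2) by (metis divisor_stable_def gr0I)
  ultimately show "m = m'" using assms(6) by simp
qed

text \<open>
  The definition of \<open>psi_S S \<psi> n\<close> sees only the multiplicities in \<open>n\<close> of the primes in \<open>S\<close>, so the
  Adams operator of \<open>n\<close> is that of the \<open>S\<close>-part of \<open>n\<close>.
\<close>
lemma psi_S_cong_part:
  assumes "s > 0" "m \<in> coprime_to S"
  shows "psi_S S \<psi> (s * m) = psi_S S \<psi> s"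
proof -
  have m: "\<not> p dvd m" if "p \<in> S" "prime p" for p
    using assms that by (auto simp: coprime_to_def)
  have 1: "{p \<in> S. prime p \<and> p dvd s * m} = {p \<in> S. prime p \<and> p dvd s}"
    using m by (auto simp: prime_dvd_mult_iff)
  have fin: "finite {p \<in> S. prime p \<and> p dvd s}" using assms by simp
  have "multiplicity p (s * m) = multiplicity p s" if "p \<in> S" "prime p" for p
    using m[OF that] that multiplicity_prime_elem_times_other[of p m s] by (simp add: mult.commute)
  then show ?thesis unfolding psi_S_def 1
    by (intro foldr_cong) (use fin in auto)
qed

lemma moebius_sum_coprime_to:
  assumes "divisor_stable S" "mult_closed S" "n > 0"
  shows "(\<Sum>d | d dvd n \<and> d \<in> coprime_to S. moebius d) = (if n \<in> S then 1 else 0)"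
proof -
  have "{d. d dvd n \<and> d \<in> coprime_to S} = {d. d dvd n \<and> prime_factors d \<subseteq> - S}"
    using assms(3) by (auto simp: coprime_to_def in_prime_factors_iff dvd_pos_nat)
  moreover have "n \<in> S \<longleftrightarrow> prime_factors n \<inter> - S = {}"
    using S_mem_iff[OF assms] assms(3) by (auto simp: in_prime_factors_iff)
  ultimately show ?thesis using moebius_divisor_sum[OF assms(3)] by auto
qed

lemma Z_ring_simps [simp]:
  "monoid.mult (Z_ring S) = (*)" "add (Z_ring S) = (+)" "\<one>\<^bsub>Z_ring S\<^esub> = 1" "\<zero>\<^bsub>Z_ring S\<^esub> = 0"
  by (auto simp: Z_ring_def ring_of_type_algebra_def)

lemma Z_ring_closed:
  shows Z_ring_one: "1 \<in> carrier (Z_ring S)"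
    and Z_ring_zero: "0 \<in> carrier (Z_ring S)"
    and Z_ring_add: "x \<in> carrier (Z_ring S) \<Longrightarrow> y \<in> carrier (Z_ring S) \<Longrightarrow> x + y \<in> carrier (Z_ring S)"
    and Z_ring_mult: "x \<in> carrier (Z_ring S) \<Longrightarrow> y \<in> carrier (Z_ring S) \<Longrightarrow> x * y \<in> carrier (Z_ring S)"
    and Z_ring_uminus: "x \<in> carrier (Z_ring S) \<Longrightarrow> - x \<in> carrier (Z_ring S)"
proof -
  let ?Q = "ring_of_type_algebra :: rat ring"
  interpret Q: cring ?Q by (rule cring_from_type_algebra)
  have [simp]: "monoid.mult ?Q = (*)" "add ?Q = (+)" "\<one>\<^bsub>?Q\<^esub> = 1" "\<zero>\<^bsub>?Q\<^esub> = 0" "carrier ?Q = UNIV"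
    by (auto simp: ring_of_type_algebra_def)
  have [simp]: "\<ominus>\<^bsub>?Q\<^esub> x = - x" for x
    using Q.minus_equality[of "- x" x] by simp
  have c: "carrier (Z_ring S) = generate_ring ?Q {1 / of_nat p | p :: nat. prime p \<and> p \<notin> S}"
    by (simp add: Z_ring_def)
  show 1: "1 \<in> carrier (Z_ring S)"
    using generate_ring.one[of ?Q] c by simp
  show a: "x + y \<in> carrier (Z_ring S)" if "x \<in> carrier (Z_ring S)" "y \<in> carrier (Z_ring S)" for x y
    using generate_ring.eng_add[of _ ?Q] c that by fastforce
  show "x * y \<in> carrier (Z_ring S)" if "x \<in> carrier (Z_ring S)" "y \<in> carrier (Z_ring S)" for x y
    using generate_ring.eng_mult[of _ ?Q] c that by fastforce
  show u: "- x \<in> carrier (Z_ring S)" if "x \<in> carrier (Z_ring S)" for x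
    using generate_ring.a_inv[of _ ?Q] c that by fastforce
  show "0 \<in> carrier (Z_ring S)" using a[OF 1 u[OF 1]] by simp
qed

lemma Z_ring_of_int: "of_int z \<in> carrier (Z_ring S)"
proof -
  have "of_nat n \<in> carrier (Z_ring S)" for n
    by (induction n) (auto intro: Z_ring_closed)
  then show ?thesis by (cases z) (auto simp del: of_nat_Suc intro: Z_ring_uminus)
qed

lemma Z_ring_inverse:
  assumes "m \<in> coprime_to S"
  shows "1 / of_nat m \<in> carrier (Z_ring S)"
  using assms
proof (induction m rule: prime_divisors_induct)
  case (unit x)
  then show ?case by (simp add: Z_ring_one)
next
  case (factor p x)
  then have "x \<in> coprime_to S" "p \<notin> S" by (auto simp: coprime_to_def)
  moreover from this factor(1) have "1 / of_nat p \<in> carrier (Z_ring S)"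
    by (auto simp: Z_ring_def intro!: generate_ring.incl)
  ultimately show ?case using factor Z_ring_mult[of "1 / of_nat p" S "1 / of_nat x"] by simp
qed (auto simp: coprime_to_def)

lemma coprime_to_mult: "a \<in> coprime_to S \<Longrightarrow> b \<in> coprime_to S \<Longrightarrow> a * b \<in> coprime_to S"
  by (auto simp: coprime_to_def prime_dvd_mult_iff)

lemma coprime_to_power: "a \<in> coprime_to S \<Longrightarrow> a ^ j \<in> coprime_to S"
  by (auto simp: coprime_to_def prime_dvd_power_iff dest: prime_dvd_power)

text \<open>
  The generalized binomial coefficient of \<open>q = a / m\<close> is \<open>(\<Prod>i<j. a - i m) / (m ^ j * fact j)\<close>.
  Split \<open>fact j = v * u\<close>, where the primes of \<open>v\<close> divide \<open>m\<close> and \<open>u\<close> is coprime to \<open>m\<close>. The factor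
  \<open>v\<close> is invertible in \<open>\<int>\<^sub>S\<close>. Modulo \<open>u\<close> one can write \<open>a = m * x\<close> with a natural number \<open>x\<close>, so the
  numerator is congruent to \<open>m ^ j * (\<Prod>i<j. x - i) = m ^ j * fact j * (x choose j)\<close>, which \<open>u\<close>
  divides.
\<close>
lemma Z_ring_gbinomial:
  assumes "m \<in> coprime_to S"
  shows "((of_int a / of_nat m :: rat) gchoose j) \<in> carrier (Z_ring S)"
proof -
  have m0: "m > 0" using assms by (auto simp: coprime_to_def)
  obtain v u :: nat where vu: "fact j = v * u" "v > 0" "u > 0" "\<And>p. prime p \<Longrightarrow> p dvd v \<Longrightarrow> p dvd m"
    "\<And>p. prime p \<Longrightarrow> p dvd u \<Longrightarrow> \<not> p dvd m"
    using split_by_primes[of "fact j" "{p. p dvd m}"] by (metis fact_gt_zero mem_Collect_eq)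
  have v: "v \<in> coprime_to S" using vu assms by (auto simp: coprime_to_def)
  have "coprime u m" using vu(5)
    by (metis coprime_iff_gcd_eq_1 gcd_dvd1 gcd_dvd2 prime_factor_nat dvd_trans)
  then have "coprime (int m) (int u)" by (simp add: coprime_commute)
  then obtain w k where wk: "w * int m + k * int u = 1"
    using bezout_int[of "int m" "int u"] by auto
  define x where "x = nat ((a * w) mod int u)"
  have x: "int x = (a * w) mod int u" using vu(3) by (simp add: x_def)
  have "(int m * int x) mod int u = (a * (w * int m)) mod int u"
    unfolding x by (simp add: mod_mult_right_eq mult.commute mult.left_commute)
  also have "w * int m = 1 - k * int u" using wk by simp
  also have "(a * (1 - k * int u)) mod int u = a mod int u"
    using mod_mult_self1[of a "- (a * k)" "int u"] by (simp add: algebra_simps)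
  finally have mx: "(int m * int x) mod int u = a mod int u" .
  let ?P = "\<Prod>i = 0..<j. a - int i * int m"
  have "?P mod int u = (\<Prod>i = 0..<j. int m * int x - int i * int m) mod int u"
    by (subst (1 2) mod_prod_eq[symmetric]) (metis (no_types, lifting) mod_diff_left_eq mx)
  also have "(\<Prod>i = 0..<j. int m * int x - int i * int m) = (\<Prod>i = 0..<j. int m * (int x - int i))"
    by (simp add: algebra_simps)
  also have "\<dots> = int m ^ j * (\<Prod>i = 0..<j. int x - int i)"
    by (simp add: prod.distrib)
  also have "(\<Prod>i = 0..<j. int x - int i) = fact j * int (x choose j)"
  proof -
    have "rat_of_int (\<Prod>i = 0..<j. int x - int i) = rat_of_int (fact j * int (x choose j))"
      by (simp add: binomial_gbinomial gbinomial_mult_fact)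
    then show ?thesis by (simp only: of_int_eq_iff)
  qed
  also have "(fact j :: int) = int v * int u" using vu(1) by (metis of_nat_fact of_nat_mult)
  finally have "?P mod int u = 0" by simp
  then obtain z where z: "?P = int u * z" by (metis dvd_def mod_0_imp_dvd)
  have "(of_int a / of_nat m :: rat) gchoose j = (\<Prod>i = 0..<j. (of_int a - of_nat i * of_nat m) / of_nat m) / fact j"
    unfolding gbinomial_prod_rev using m0 by (intro arg_cong2[where f = "(/)"] prod.cong) (auto simp: field_simps)
  also have "\<dots> = of_int ?P / of_nat m ^ j / of_nat (v * u)"
    by (simp add: prod_dividef flip: vu(1))
  also have "\<dots> = of_int z * (1 / of_nat (m ^ j * v))"
    unfolding z using vu(2,3) m0 by (simp add: field_simps)
  finally show ?thesis
    by (simp only:) (intro Z_ring_mult Z_ring_of_int Z_ring_inverse coprime_to_mult coprime_to_power v assms)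
qed

section \<open>Power series and logarithmic derivatives\<close>

lemma ps_carrier_iff: "f \<in> carrier (power_series R) \<longleftrightarrow> (\<forall>n. f n \<in> carrier R)"
  by (simp add: power_series_def Pi_iff)

lemma power_series_simps [simp]:
  "(f \<otimes>\<^bsub>power_series R\<^esub> g) n = (\<Oplus>\<^bsub>R\<^esub>i\<in>{..n}. f i \<otimes>\<^bsub>R\<^esub> g (n - i))"
  "\<one>\<^bsub>power_series R\<^esub> n = (if n = 0 then \<one>\<^bsub>R\<^esub> else \<zero>\<^bsub>R\<^esub>)"
  "\<zero>\<^bsub>power_series R\<^esub> n = \<zero>\<^bsub>R\<^esub>"
  "(f \<oplus>\<^bsub>power_series R\<^esub> g) n = f n \<oplus>\<^bsub>R\<^esub> g n"
  by (simp_all add: power_series_def)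

text \<open>
  The coefficient of \<open>t ^ n\<close> in a sum or product depends only on the coefficients of \<open>t ^ i\<close> with
  \<open>i \<le> n\<close>. So the multiplicative laws are read off from those of the polynomial ring, by
  truncating all series at degree \<open>n\<close>.
\<close>
lemma (in cring) power_series_cring: "cring (power_series R)"
proof -
  let ?P = "power_series R" and ?U = "UP R"
  have U_car: "carrier ?U = up R" by (simp add: UP_def)
  have U_mult: "(p \<otimes>\<^bsub>?U\<^esub> q) n = (\<Oplus>i\<in>{..n}. p i \<otimes> q (n - i))"
    if "p \<in> carrier ?U" "q \<in> carrier ?U" for p q n
    using that by (simp add: UP_def)
  have U_one: "\<one>\<^bsub>?U\<^esub> n = (if n = 0 then \<one> else \<zero>)" for n by (simp add: UP_def)
  interpret U: UP_cring R ?U by unfold_locales simp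
  define tr where "tr = (\<lambda>n (f :: nat \<Rightarrow> 'a) i. if i \<le> n then f i else \<zero>)"
  have cl: "f i \<in> carrier R" if "f \<in> carrier ?P" for f i
    using that by (simp add: ps_carrier_iff)
  have tr_U: "tr n f \<in> carrier ?U" if "f \<in> carrier ?P" for n f
    unfolding U_car using cl[OF that]
    by (intro mem_upI exI[of _ n] bound.intro) (simp_all add: tr_def)
  have mult_tr: "(f \<otimes>\<^bsub>?P\<^esub> g) n = (p \<otimes>\<^bsub>?U\<^esub> q) n"
    if f: "f \<in> carrier ?P" and g: "g \<in> carrier ?P" and p: "p \<in> carrier ?U" and q: "q \<in> carrier ?U"
      and eq: "\<And>i. i \<le> n \<Longrightarrow> f i = p i" "\<And>i. i \<le> n \<Longrightarrow> g i = q i" for f g p q n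
  proof -
    have "(f \<otimes>\<^bsub>?P\<^esub> g) n = (\<Oplus>i\<in>{..n}. f i \<otimes> g (n - i))" by simp
    also have "\<dots> = (\<Oplus>i\<in>{..n}. p i \<otimes> q (n - i))"
      by (rule finsum_cong') (simp_all add: Pi_iff eq flip: eq add: cl[OF f] cl[OF g])
    also have "\<dots> = (p \<otimes>\<^bsub>?U\<^esub> q) n" by (rule U_mult[OF p q, symmetric])
    finally show ?thesis .
  qed
  have trI: "tr n f i = f i" if "i \<le> n" for i n f using that by (simp add: tr_def)
  have mult_closed: "f \<otimes>\<^bsub>?P\<^esub> g \<in> carrier ?P" if "f \<in> carrier ?P" "g \<in> carrier ?P" for f g
    using cl[OF that(1)] cl[OF that(2)] by (simp add: ps_carrier_iff Pi_iff)
  have mult2: "(f \<otimes>\<^bsub>?P\<^esub> g) i = (tr n f \<otimes>\<^bsub>?U\<^esub> tr n g) i"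
    if "f \<in> carrier ?P" "g \<in> carrier ?P" "i \<le> n" for f g i n
  proof (rule mult_tr)
    show "f \<in> carrier ?P" "g \<in> carrier ?P" by (fact that)+
    show "tr n f \<in> carrier ?U" by (rule tr_U[OF that(1)])
    show "tr n g \<in> carrier ?U" by (rule tr_U[OF that(2)])
    fix j assume "j \<le> i"
    then have "j \<le> n" using that(3) by (rule le_trans)
    then show "f j = tr n f j" "g j = tr n g j" by (simp_all only: tr_def if_True)
  qed
  have ab: "abelian_group ?P"
  proof (rule abelian_groupI, goal_cases)
    case (1 x y) show ?case using cl[OF 1(1)] cl[OF 1(2)] by (simp add: ps_carrier_iff Pi_iff)
  next
    case 2 show ?case by (simp add: ps_carrier_iff)
  next
    case (3 x y z) show ?case using cl[OF 3(1)] cl[OF 3(2)] cl[OF 3(3)]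
      by (intro ext) (simp add: a_assoc)
  next
    case (4 x y) show ?case using cl[OF 4(1)] cl[OF 4(2)] by (intro ext) (simp add: a_comm)
  next
    case (5 x) show ?case using cl[OF 5] by (intro ext) simp
  next
    case (6 x)
    show ?case using cl[OF 6] by (intro bexI[of _ "\<lambda>n. \<ominus> x n"] ext) (simp_all add: ps_carrier_iff l_neg)
  qed
  have mo: "comm_monoid ?P"
  proof (rule comm_monoidI, goal_cases)
    case (1 x y) then show ?case by (rule mult_closed)
  next
    case 2 show ?case by (simp add: ps_carrier_iff)
  next
    case (3 x y z)
    show ?case
    proof
      fix n
      let ?x = "tr n x" and ?y = "tr n y" and ?z = "tr n z"
      note U = tr_U[OF 3(1), of n] tr_U[OF 3(2), of n] tr_U[OF 3(3), of n]
      have "(x \<otimes>\<^bsub>?P\<^esub> y \<otimes>\<^bsub>?P\<^esub> z) n = (?x \<otimes>\<^bsub>?U\<^esub> ?y \<otimes>\<^bsub>?U\<^esub> ?z) n"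
        by (rule mult_tr[OF mult_closed[OF 3(1,2)] 3(3) U.P.m_closed[OF U(1,2)] U(3)])
          (rule mult2[OF 3(1,2)], assumption, rule trI[symmetric])
      also have "\<dots> = (?x \<otimes>\<^bsub>?U\<^esub> (?y \<otimes>\<^bsub>?U\<^esub> ?z)) n"
        by (simp only: U.P.m_assoc[OF U])
      also have "\<dots> = (x \<otimes>\<^bsub>?P\<^esub> (y \<otimes>\<^bsub>?P\<^esub> z)) n"
        by (rule mult_tr[symmetric, OF 3(1) mult_closed[OF 3(2,3)] U(1) U.P.m_closed[OF U(2,3)]])
          (rule trI[symmetric], assumption, rule mult2[OF 3(2,3)])
      finally show "(x \<otimes>\<^bsub>?P\<^esub> y \<otimes>\<^bsub>?P\<^esub> z) n = (x \<otimes>\<^bsub>?P\<^esub> (y \<otimes>\<^bsub>?P\<^esub> z)) n" .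
    qed
  next
    case (4 x)
    show ?case
    proof
      fix n
      have "\<one>\<^bsub>?P\<^esub> \<in> carrier ?P" by (simp add: ps_carrier_iff)
      then have "(\<one>\<^bsub>?P\<^esub> \<otimes>\<^bsub>?P\<^esub> x) n = (\<one>\<^bsub>?U\<^esub> \<otimes>\<^bsub>?U\<^esub> tr n x) n"
        using 4 by (intro mult_tr) (simp_all add: trI tr_U U_one del: power_series_simps(1))
      also have "\<dots> = x n" using 4 by (simp add: tr_U del: power_series_simps) (simp add: tr_def)
      finally show "(\<one>\<^bsub>?P\<^esub> \<otimes>\<^bsub>?P\<^esub> x) n = x n" .
    qed
  next
    case (5 x y)
    show ?case
    proof
      fix n
      show "(x \<otimes>\<^bsub>?P\<^esub> y) n = (y \<otimes>\<^bsub>?P\<^esub> x) n"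
        using mult2[OF 5, of n n] mult2[OF 5(2,1), of n n] U.P.m_comm[OF tr_U tr_U] 5 by simp
    qed
  qed
  have ldist: "(x \<oplus>\<^bsub>?P\<^esub> y) \<otimes>\<^bsub>?P\<^esub> z = x \<otimes>\<^bsub>?P\<^esub> z \<oplus>\<^bsub>?P\<^esub> y \<otimes>\<^bsub>?P\<^esub> z"
    if xyz: "x \<in> carrier ?P" "y \<in> carrier ?P" "z \<in> carrier ?P" for x y z
    proof
      fix n
      have "((x \<oplus>\<^bsub>?P\<^esub> y) \<otimes>\<^bsub>?P\<^esub> z) n = (\<Oplus>i\<in>{..n}. x i \<otimes> z (n - i) \<oplus> y i \<otimes> z (n - i))"
        using cl[OF xyz(1)] cl[OF xyz(2)] cl[OF xyz(3)] by (auto simp: Pi_iff l_distr intro!: finsum_cong')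
      also have "\<dots> = (x \<otimes>\<^bsub>?P\<^esub> z \<oplus>\<^bsub>?P\<^esub> y \<otimes>\<^bsub>?P\<^esub> z) n"
        using cl[OF xyz(1)] cl[OF xyz(2)] cl[OF xyz(3)] by (auto simp: Pi_iff finsum_addf)
      finally show "((x \<oplus>\<^bsub>?P\<^esub> y) \<otimes>\<^bsub>?P\<^esub> z) n = (x \<otimes>\<^bsub>?P\<^esub> z \<oplus>\<^bsub>?P\<^esub> y \<otimes>\<^bsub>?P\<^esub> z) n" .
    qed
  show ?thesis by (rule cringI[OF ab mo ldist])
qed

text \<open>
  The Euler derivation \<open>t d/dt\<close>.
\<close>
definition ps_euler :: "('a, 'm) ring_scheme \<Rightarrow> (nat \<Rightarrow> 'a) \<Rightarrow> nat \<Rightarrow> 'a" where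
  "ps_euler R f = (\<lambda>n. [n] \<cdot>\<^bsub>R\<^esub> f n)"

lemma (in cring) torsion_free_cancel:
  assumes "torsion_free R" "a \<in> carrier R" "b \<in> carrier R" "n > (0::nat)" "[n] \<cdot> a = [n] \<cdot> b"
  shows "a = b"
proof -
  have "[n] \<cdot> (a \<ominus> b) = \<zero>"
    using assms by (simp add: a_minus_def add.nat_pow_distrib add.nat_pow_inv r_neg)
  then have "a \<ominus> b = \<zero>" using assms unfolding torsion_free_def by auto
  then show ?thesis using assms by simp
qed

text \<open>
  The equation \<open>- t f' = p f\<close>, that is \<open>p = - t d/dt log f\<close>, written without a quotient so that it
  makes sense for every series \<open>f\<close>.
\<close>
definition neg_log_deriv :: "('a, 'm) ring_scheme \<Rightarrow> (nat \<Rightarrow> 'a) \<Rightarrow> (nat \<Rightarrow> 'a) \<Rightarrow> bool" where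
  "neg_log_deriv R f p \<longleftrightarrow> f \<in> carrier (power_series R) \<and> p \<in> carrier (power_series R) \<and>
     ps_euler R f = \<ominus>\<^bsub>power_series R\<^esub> (p \<otimes>\<^bsub>power_series R\<^esub> f)"

lemma (in cring) ps_uminus:
  assumes "f \<in> carrier (power_series R)"
  shows "(\<ominus>\<^bsub>power_series R\<^esub> f) n = \<ominus> f n"
proof -
  interpret P: cring "power_series R" by (rule power_series_cring)
  have "\<ominus>\<^bsub>power_series R\<^esub> f = (\<lambda>n. \<ominus> f n)"
    by (rule P.minus_equality)
      (use assms in \<open>auto simp: ps_carrier_iff l_neg fun_eq_iff\<close>)
  then show ?thesis by simp
qed

lemma (in cring) add_pow_finsum:
  assumes "f \<in> A \<rightarrow> carrier R"
  shows "[(n::nat)] \<cdot> (\<Oplus>i\<in>A. f i) = (\<Oplus>i\<in>A. [n] \<cdot> f i)"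
proof (induction n)
  case (Suc n)
  have "(\<Oplus>i\<in>A. [n] \<cdot> f i \<oplus> f i) = (\<Oplus>i\<in>A. [n] \<cdot> f i) \<oplus> (\<Oplus>i\<in>A. f i)"
    using assms by (intro finsum_addf) auto
  then show ?case using Suc by simp
qed simp

lemma (in cring) ps_euler_closed:
  "f \<in> carrier (power_series R) \<Longrightarrow> ps_euler R f \<in> carrier (power_series R)"
  by (auto simp: ps_carrier_iff ps_euler_def)

lemma (in cring) ps_euler_mult:
  assumes f: "f \<in> carrier (power_series R)" and g: "g \<in> carrier (power_series R)"
  shows "ps_euler R (f \<otimes>\<^bsub>power_series R\<^esub> g) =
    ps_euler R f \<otimes>\<^bsub>power_series R\<^esub> g \<oplus>\<^bsub>power_series R\<^esub> f \<otimes>\<^bsub>power_series R\<^esub> ps_euler R g"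
proof
  fix n
  have c: "f i \<in> carrier R" "g i \<in> carrier R" for i using f g by (auto simp: ps_carrier_iff)
  have split: "[n] \<cdot> (f i \<otimes> g (n - i)) = ([i] \<cdot> f i) \<otimes> g (n - i) \<oplus> f i \<otimes> ([(n - i)] \<cdot> g (n - i))"
    if "i \<le> n" for i
    using that add.nat_pow_mult[of "f i \<otimes> g (n - i)" i "n - i"] c
    by (simp add: add_pow_ldistr add_pow_rdistr)
  have "ps_euler R (f \<otimes>\<^bsub>power_series R\<^esub> g) n = (\<Oplus>i\<in>{..n}. [n] \<cdot> (f i \<otimes> g (n - i)))"
    using c by (simp add: ps_euler_def add_pow_finsum Pi_iff)
  also have "\<dots> = (\<Oplus>i\<in>{..n}. ([i] \<cdot> f i) \<otimes> g (n - i) \<oplus> f i \<otimes> ([(n - i)] \<cdot> g (n - i)))"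
    using c by (intro finsum_cong') (auto simp: split)
  also have "\<dots> = (\<Oplus>i\<in>{..n}. ([i] \<cdot> f i) \<otimes> g (n - i)) \<oplus> (\<Oplus>i\<in>{..n}. f i \<otimes> ([(n - i)] \<cdot> g (n - i)))"
    using c by (intro finsum_addf) auto
  finally show "ps_euler R (f \<otimes>\<^bsub>power_series R\<^esub> g) n = (ps_euler R f \<otimes>\<^bsub>power_series R\<^esub> g \<oplus>\<^bsub>power_series R\<^esub> f \<otimes>\<^bsub>power_series R\<^esub> ps_euler R g) n"
    by (simp add: ps_euler_def)
qed

lemma (in cring) neg_log_deriv_one: "neg_log_deriv R \<one>\<^bsub>power_series R\<^esub> \<zero>\<^bsub>power_series R\<^esub>"
proof -
  interpret P: cring "power_series R" by (rule power_series_cring)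
  have "ps_euler R \<one>\<^bsub>power_series R\<^esub> = \<zero>\<^bsub>power_series R\<^esub>"
    by (auto simp: ps_euler_def fun_eq_iff)
  then show ?thesis unfolding neg_log_deriv_def by simp
qed

lemma (in cring) neg_log_deriv_mult:
  assumes "neg_log_deriv R f p" "neg_log_deriv R g q"
  shows "neg_log_deriv R (f \<otimes>\<^bsub>power_series R\<^esub> g) (p \<oplus>\<^bsub>power_series R\<^esub> q)"
proof -
  let ?P = "power_series R"
  interpret P: cring ?P by (rule power_series_cring)
  have c: "f \<in> carrier ?P" "g \<in> carrier ?P" "p \<in> carrier ?P" "q \<in> carrier ?P"
    using assms by (auto simp: neg_log_deriv_def)
  have "\<ominus>\<^bsub>?P\<^esub> (p \<otimes>\<^bsub>?P\<^esub> f) \<otimes>\<^bsub>?P\<^esub> g \<oplus>\<^bsub>?P\<^esub> f \<otimes>\<^bsub>?P\<^esub> (\<ominus>\<^bsub>?P\<^esub> (q \<otimes>\<^bsub>?P\<^esub> g))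
    = \<ominus>\<^bsub>?P\<^esub> ((p \<oplus>\<^bsub>?P\<^esub> q) \<otimes>\<^bsub>?P\<^esub> (f \<otimes>\<^bsub>?P\<^esub> g))"
    using c by algebra
  then show ?thesis using assms c by (simp add: neg_log_deriv_def ps_euler_mult)
qed

lemma (in cring) neg_log_deriv_finprod:
  assumes "finite F" "\<And>k. k \<in> F \<Longrightarrow> neg_log_deriv R (f k) (p k)"
  shows "neg_log_deriv R (\<Otimes>\<^bsub>power_series R\<^esub>k\<in>F. f k) (\<Oplus>\<^bsub>power_series R\<^esub>k\<in>F. p k)"
proof -
  interpret P: cring "power_series R" by (rule power_series_cring)
  show ?thesis using assms
  proof (induction F rule: finite_induct)
    case empty show ?case by (simp only: P.finprod_empty P.finsum_empty neg_log_deriv_one)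
  next
    case (insert k F)
    then have "f \<in> F \<rightarrow> carrier (power_series R)" "p \<in> F \<rightarrow> carrier (power_series R)"
      "f k \<in> carrier (power_series R)" "p k \<in> carrier (power_series R)"
      by (auto simp: neg_log_deriv_def)
    then show ?case using insert by (simp add: neg_log_deriv_mult del: power_series_simps)
  qed
qed

lemma (in cring) ps_finsum_coeff:
  assumes "finite F" "\<And>k. k \<in> F \<Longrightarrow> p k \<in> carrier (power_series R)"
  shows "(\<Oplus>\<^bsub>power_series R\<^esub>k\<in>F. p k) n = (\<Oplus>k\<in>F. p k n)"
proof -
  interpret P: cring "power_series R" by (rule power_series_cring)
  show ?thesis using assms
  proof (induction F rule: finite_induct)
    case (insert k F)
    then have "p \<in> F \<rightarrow> carrier (power_series R)" "p k \<in> carrier (power_series R)"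
      "(\<lambda>k. p k n) \<in> F \<rightarrow> carrier R" "p k n \<in> carrier R"
      by (auto simp: ps_carrier_iff)
    then show ?case using insert by simp
  qed simp
qed

lemma (in cring) ps_finprod_const_coeff:
  assumes "finite F" "\<And>k. k \<in> F \<Longrightarrow> f k \<in> carrier (power_series R)" "\<And>k. k \<in> F \<Longrightarrow> f k 0 = \<one>"
  shows "(\<Otimes>\<^bsub>power_series R\<^esub>k\<in>F. f k) 0 = \<one>"
proof -
  interpret P: cring "power_series R" by (rule power_series_cring)
  show ?thesis using assms
  proof (induction F rule: finite_induct)
    case (insert k F)
    then have "f \<in> F \<rightarrow> carrier (power_series R)" "f k \<in> carrier (power_series R)" by auto
    then show ?case using insert by simp
  qed simp
qed

text \<open>
  The coefficient of \<open>t ^ i\<close> in \<open>- t f' = p f\<close> expresses \<open>[i] \<cdot> f i\<close> through \<open>p 1, \<dots>, p i\<close> and the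
  lower coefficients of \<open>f\<close>, and torsion-freeness allows one to divide by \<open>i\<close>. The bound \<open>n\<close> is what
  makes it possible to compare an infinite product with a finite one.
\<close>
lemma (in cring) neg_log_deriv_unique:
  assumes tf: "torsion_free R"
    and f: "neg_log_deriv R f p" and g: "neg_log_deriv R g q"
    and "f 0 = g 0" "p 0 = \<zero>" "\<And>i. i \<le> n \<Longrightarrow> p i = q i" "i \<le> n"
  shows "f i = g i"
  using \<open>i \<le> n\<close>
proof (induction i rule: less_induct)
  case (less i)
  interpret P: cring "power_series R" by (rule power_series_cring)
  have c: "f j \<in> carrier R" "g j \<in> carrier R" "p j \<in> carrier R" "q j \<in> carrier R" for j
    using f g by (auto simp: neg_log_deriv_def ps_carrier_iff)
  show ?case
  proof (cases "i = 0")
    case False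
    have coeff: "[i] \<cdot> h i = \<ominus> (\<Oplus>j\<in>{..i}. r j \<otimes> h (i - j))" if "neg_log_deriv R h r" for h r
    proof -
      have "[i] \<cdot> h i = (\<ominus>\<^bsub>power_series R\<^esub> (r \<otimes>\<^bsub>power_series R\<^esub> h)) i"
        using that by (metis neg_log_deriv_def ps_euler_def)
      also have "\<dots> = \<ominus> ((r \<otimes>\<^bsub>power_series R\<^esub> h) i)"
        using that by (intro ps_uminus P.m_closed) (auto simp: neg_log_deriv_def)
      finally show ?thesis by simp
    qed
    have "(\<Oplus>j\<in>{..i}. p j \<otimes> f (i - j)) = (\<Oplus>j\<in>{..i}. q j \<otimes> g (i - j))"
    proof (rule finsum_cong')
      fix j assume j: "j \<in> {..i}"
      show "p j \<otimes> f (i - j) = q j \<otimes> g (i - j)"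
      proof (cases "j = 0")
        case True
        then show ?thesis using assms(5) assms(6)[of 0] c by simp
      next
        case False
        then have "f (i - j) = g (i - j)" using less j by simp
        moreover have "p j = q j" using assms(6) less j by simp
        ultimately show ?thesis by simp
      qed
    qed (use c in auto)
    then have "[i] \<cdot> f i = [i] \<cdot> g i" using coeff[OF f] coeff[OF g] by simp
    then show ?thesis using torsion_free_cancel[OF tf c(1,2)] False by simp
  qed (use assms in simp)
qed

text \<open>
  The substitution \<open>f(t ^ l)\<close>.
\<close>
definition ps_stretch :: "('a, 'm) ring_scheme \<Rightarrow> nat \<Rightarrow> (nat \<Rightarrow> 'a) \<Rightarrow> nat \<Rightarrow> 'a" where
  "ps_stretch R l f = (\<lambda>n. if l dvd n then f (n div l) else \<zero>\<^bsub>R\<^esub>)"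

lemma (in cring) ps_stretch_closed:
  "f \<in> carrier (power_series R) \<Longrightarrow> ps_stretch R l f \<in> carrier (power_series R)"
  by (auto simp: ps_carrier_iff ps_stretch_def)

lemma (in cring) ps_stretch_mult:
  assumes f: "f \<in> carrier (power_series R)" and g: "g \<in> carrier (power_series R)" and "l > 0"
  shows "ps_stretch R l f \<otimes>\<^bsub>power_series R\<^esub> ps_stretch R l g = ps_stretch R l (f \<otimes>\<^bsub>power_series R\<^esub> g)"
proof
  fix n
  have c: "f i \<in> carrier R" "g i \<in> carrier R" for i using f g by (auto simp: ps_carrier_iff)
  let ?t = "\<lambda>i. ps_stretch R l f i \<otimes> ps_stretch R l g (n - i)"
  have tc: "?t \<in> A \<rightarrow> carrier R" for A using c by (auto simp: ps_stretch_def)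
  show "(ps_stretch R l f \<otimes>\<^bsub>power_series R\<^esub> ps_stretch R l g) n = ps_stretch R l (f \<otimes>\<^bsub>power_series R\<^esub> g) n"
  proof (cases "l dvd n")
    case False
    have "?t i = \<zero>" if "i \<in> {..n}" for i
      using that False c dvd_diffD[of l n i] by (auto simp: ps_stretch_def)
    then have "(\<Oplus>i\<in>{..n}. ?t i) = \<zero>" by (rule add.finprod_one_eqI)
    then show ?thesis using False by (simp add: ps_stretch_def)
  next
    case True
    then obtain m where n: "n = l * m" by auto
    have "(\<Oplus>i\<in>{..n}. ?t i) = (\<Oplus>i\<in>(*) l ` {..m}. ?t i)"
    proof (rule add.finprod_mono_neutral_cong_right)
      fix i assume i: "i \<in> {..n} - (*) l ` {..m}"
      have "\<not> l dvd i" using i n assms(3) by auto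
      then show "?t i = \<zero>" using c by (auto simp: ps_stretch_def)
    qed (use n tc in auto)
    also have "\<dots> = (\<Oplus>j\<in>{..m}. ?t (l * j))"
      by (rule finsum_reindex) (use tc assms(3) in \<open>auto simp: inj_on_def\<close>)
    also have "\<dots> = (\<Oplus>j\<in>{..m}. f j \<otimes> g (m - j))"
      by (rule finsum_cong') (use n assms(3) c in \<open>auto simp: ps_stretch_def simp flip: diff_mult_distrib2\<close>)
    finally show ?thesis using n assms(3) by (simp add: ps_stretch_def)
  qed
qed

lemma (in cring) neg_log_deriv_stretch:
  assumes "neg_log_deriv R f p" "l > 0"
  shows "neg_log_deriv R (ps_stretch R l f) (\<lambda>n. [l] \<cdot> ps_stretch R l p n)"
proof -
  let ?P = "power_series R"
  interpret P: cring ?P by (rule power_series_cring)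
  have c: "f \<in> carrier ?P" "p \<in> carrier ?P" using assms by (auto simp: neg_log_deriv_def)
  have c': "f i \<in> carrier R" "p i \<in> carrier R" for i using c by (auto simp: ps_carrier_iff)
  let ?q = "\<lambda>n. [l] \<cdot> ps_stretch R l p n"
  have q: "?q \<in> carrier ?P" using c' by (auto simp: ps_carrier_iff ps_stretch_def)
  have sc: "ps_stretch R l f i \<in> carrier R" "ps_stretch R l p i \<in> carrier R" for i
    using c' by (auto simp: ps_stretch_def)
  have "ps_euler R (ps_stretch R l f) n = (\<ominus>\<^bsub>?P\<^esub> (?q \<otimes>\<^bsub>?P\<^esub> ps_stretch R l f)) n" for n
  proof -
    have eul: "[m] \<cdot> f m = \<ominus> ((p \<otimes>\<^bsub>?P\<^esub> f) m)" for m
      using assms(1) c by (metis neg_log_deriv_def ps_euler_def ps_uminus P.m_closed)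
    have "(?q \<otimes>\<^bsub>?P\<^esub> ps_stretch R l f) n = [l] \<cdot> ((ps_stretch R l p \<otimes>\<^bsub>?P\<^esub> ps_stretch R l f) n)"
      using sc by (simp add: add_pow_finsum Pi_iff add_pow_ldistr cong: finsum_cong)
    also have "\<dots> = [l] \<cdot> (ps_stretch R l (p \<otimes>\<^bsub>?P\<^esub> f) n)"
      by (simp only: ps_stretch_mult[OF c(2,1) assms(2)])
    finally have 1: "(\<ominus>\<^bsub>?P\<^esub> (?q \<otimes>\<^bsub>?P\<^esub> ps_stretch R l f)) n = \<ominus> ([l] \<cdot> (ps_stretch R l (p \<otimes>\<^bsub>?P\<^esub> f) n))"
      using ps_uminus[OF P.m_closed[OF q ps_stretch_closed[OF c(1)]]] by simp
    have pf: "(p \<otimes>\<^bsub>?P\<^esub> f) i \<in> carrier R" for i using P.m_closed[OF c(2,1)] by (simp only: ps_carrier_iff)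
    show ?thesis
    proof (cases "l dvd n")
      case True
      then obtain m where n: "n = l * m" by auto
      have "[n] \<cdot> f m = [l] \<cdot> ([m] \<cdot> f m)" using c' by (simp add: n add.nat_pow_pow mult.commute)
      also have "\<dots> = \<ominus> ([l] \<cdot> ((p \<otimes>\<^bsub>?P\<^esub> f) m))" using pf by (simp only: eul add.nat_pow_inv)
      finally show ?thesis unfolding 1 using n assms(2) by (simp add: ps_euler_def ps_stretch_def)
    qed (unfold 1, simp add: ps_euler_def ps_stretch_def)
  qed
  then show ?thesis using c q by (auto simp: neg_log_deriv_def ps_stretch_closed)
qed

text \<open>
  The recursion characterizes the coefficients of \<open>(1 - e t) ^ y\<close>, whose negative logarithmic
  derivative is \<open>y * e * t / (1 - e t)\<close>. In the proof \<open>U m\<close> is the coefficient of \<open>t ^ (m + 1)\<close> in the product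
  of the two series; it satisfies \<open>U (m + 1) = e * U m + y * e * c (m + 1)\<close> because the geometric series
  is reproduced, up to its first term, by multiplication with \<open>e\<close>.
\<close>
lemma (in cring) neg_log_deriv_binomial:
  assumes c: "c \<in> carrier (power_series R)" and y: "y \<in> carrier R" and e: "e \<in> carrier R"
    and rec: "\<And>m. [Suc m] \<cdot> c (Suc m) = \<ominus> (e \<otimes> ((y \<ominus> [m] \<cdot> \<one>) \<otimes> c m))"
  shows "neg_log_deriv R c (\<lambda>j. if j = 0 then \<zero> else y \<otimes> e [^] j)"
proof -
  let ?P = "power_series R"
  interpret P: cring ?P by (rule power_series_cring)
  let ?p = "\<lambda>j. if j = 0 then \<zero> else y \<otimes> e [^] j"
  have p: "?p \<in> carrier ?P" using y e by (auto simp: ps_carrier_iff)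
  have c': "c i \<in> carrier R" for i using c by (auto simp: ps_carrier_iff)
  define U where "U m = (\<Oplus>j\<in>{..m}. (y \<otimes> e [^] Suc j) \<otimes> c (m - j))" for m
  have Uc: "U m \<in> carrier R" for m unfolding U_def using y e c' by (intro finsum_closed) auto
  have U_Suc: "U (Suc m) = e \<otimes> U m \<oplus> (y \<otimes> e) \<otimes> c (Suc m)" for m
  proof -
    have "U (Suc m) = (\<Oplus>j\<in>{..m}. (y \<otimes> e [^] Suc (Suc j)) \<otimes> c (m - j)) \<oplus> (y \<otimes> e) \<otimes> c (Suc m)"
      unfolding U_def using y e c' by (subst finsum_Suc2) auto
    also have "(\<Oplus>j\<in>{..m}. (y \<otimes> e [^] Suc (Suc j)) \<otimes> c (m - j)) = (\<Oplus>j\<in>{..m}. e \<otimes> ((y \<otimes> e [^] Suc j) \<otimes> c (m - j)))"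
      by (rule finsum_cong') (use y e c' in \<open>auto simp: m_ac\<close>)
    also have "\<dots> = e \<otimes> U m" unfolding U_def
      by (rule finsum_rdistr[symmetric]) (use y e c' in auto)
    finally show ?thesis .
  qed
  have main: "[Suc m] \<cdot> c (Suc m) = \<ominus> U m" for m
  proof (induction m)
    case 0
    show ?case using rec[of 0] y e c' by (simp add: U_def a_minus_def m_ac)
  next
    case (Suc m)
    have n1: "([Suc m] \<cdot> \<one>) \<in> carrier R" by simp
    have ln: "([Suc m] \<cdot> \<one>) \<otimes> c (Suc m) = \<ominus> U m"
      using Suc c' add_pow_ldistr[OF one_closed c', of "Suc m" "Suc m"] by (simp del: add.nat_pow_Suc)
    have "e \<otimes> ((y \<ominus> [Suc m] \<cdot> \<one>) \<otimes> c (Suc m)) = (y \<otimes> e) \<otimes> c (Suc m) \<ominus> e \<otimes> (([Suc m] \<cdot> \<one>) \<otimes> c (Suc m))"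
      using y e c'[of "Suc m"] n1 by algebra
    also have "\<dots> = U (Suc m)" unfolding ln U_Suc using y e c'[of "Suc m"] Uc[of m] by algebra
    finally show ?case using rec[of "Suc m"] by simp
  qed
  have "ps_euler R c n = (\<ominus>\<^bsub>?P\<^esub> (?p \<otimes>\<^bsub>?P\<^esub> c)) n" for n
  proof (cases n)
    case 0
    then show ?thesis using c' ps_uminus[OF P.m_closed[OF p c]] by (simp add: ps_euler_def)
  next
    case (Suc m)
    have "(?p \<otimes>\<^bsub>?P\<^esub> c) n = U m" unfolding U_def Suc power_series_simps using y e c' Uc[of m, unfolded U_def]
      by (subst finsum_Suc2) (auto simp: U_def)
    then show ?thesis using main[of m] ps_uminus[OF P.m_closed[OF p c], of n] Suc
      by (simp only: ps_euler_def)
  qed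
  then show ?thesis using c p by (auto simp: neg_log_deriv_def)
qed

text \<open>
  The coefficients of \<open>f\<^sup>-\<^sup>1\<close> if \<open>f 0\<close> is \<open>1\<close>. The test \<open>i < n\<close> repeats the range of the sum in order to
  make the recursion manifestly well-founded.
\<close>
fun ps_inverse :: "('a, 'm) ring_scheme \<Rightarrow> (nat \<Rightarrow> 'a) \<Rightarrow> nat \<Rightarrow> 'a" where
  "ps_inverse R f n = (if n = 0 then \<one>\<^bsub>R\<^esub> else
     \<ominus>\<^bsub>R\<^esub> (\<Oplus>\<^bsub>R\<^esub>i\<in>{..<n}. (if i < n then ps_inverse R f i else \<zero>\<^bsub>R\<^esub>) \<otimes>\<^bsub>R\<^esub> f (n - i)))"

declare ps_inverse.simps [simp del]

lemma (in cring) ps_Units: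
  assumes f: "f \<in> carrier (power_series R)" and f0: "f 0 = \<one>"
  shows "f \<in> Units (power_series R)"
proof -
  let ?P = "power_series R"
  interpret P: cring ?P by (rule power_series_cring)
  let ?g = "ps_inverse R f"
  have c: "f i \<in> carrier R" for i using f by (auto simp: ps_carrier_iff)
  have gc: "?g n \<in> carrier R" for n
  proof (induction n rule: less_induct)
    case (less n)
    then show ?case by (subst ps_inverse.simps) (auto intro!: finsum_closed a_inv_closed c)
  qed
  have g: "?g \<in> carrier ?P" using gc by (simp add: ps_carrier_iff)
  have "(?g \<otimes>\<^bsub>?P\<^esub> f) n = \<one>\<^bsub>?P\<^esub> n" for n
  proof (cases "n = 0")
    case True
    then show ?thesis using f0 by (simp add: ps_inverse.simps)
  next
    case False
    let ?s = "\<Oplus>i\<in>{..<n}. ?g i \<otimes> f (n - i)"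
    have sc: "?s \<in> carrier R" using gc c by (intro finsum_closed) auto
    have "{..n} = insert n {..<n}" by auto
    then have "(?g \<otimes>\<^bsub>?P\<^esub> f) n = ?g n \<otimes> f 0 \<oplus> ?s" using gc c by (simp add: Pi_iff)
    also have "?g n = \<ominus> ?s"
      using False gc c by (subst ps_inverse.simps) (auto intro!: arg_cong[where f = "a_inv R"] finsum_cong')
    finally show ?thesis using False sc f0 by (simp add: l_neg)
  qed
  then have "?g \<otimes>\<^bsub>?P\<^esub> f = \<one>\<^bsub>?P\<^esub>" by (rule ext)
  then show ?thesis using f g P.m_comm[OF f g] by (auto simp: Units_def)
qed

text \<open>
  The Adams operators are by definition the coefficients of \<open>- t f' f\<^sup>-\<^sup>1\<close>; here \<open>f\<close> is a unit because its
  constant term is \<open>1\<close>, and the index \<open>0\<close> gives \<open>0\<close> because of the factor \<open>t\<close>.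
\<close>
lemma (in cring) neg_log_deriv_adams:
  assumes lam: "\<And>n. lam n x \<in> carrier R" and "lam 0 x = \<one>"
  shows "neg_log_deriv R (lambda_series R lam x) (\<lambda>n. adams_op R lam n x)" "adams_op R lam 0 x = \<zero>"
proof -
  let ?P = "power_series R"
  interpret P: cring ?P by (rule power_series_cring)
  let ?f = "lambda_series R lam x"
  have f: "?f \<in> carrier ?P" using lam by (simp add: ps_carrier_iff lambda_series_def)
  have c: "?f i \<in> carrier R" for i using f by (auto simp: ps_carrier_iff)
  have f0: "?f 0 = \<one>" using assms by (simp add: lambda_series_def)
  have U: "?f \<in> Units ?P" by (rule ps_Units[OF f f0])
  have t: "ps_t R \<in> carrier ?P" and d: "ps_deriv R ?f \<in> carrier ?P"
    using c by (auto simp: ps_carrier_iff ps_t_def ps_deriv_def)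
  have d': "ps_deriv R ?f i \<in> carrier R" for i using d by (auto simp: ps_carrier_iff)
  have td: "ps_t R \<otimes>\<^bsub>?P\<^esub> ps_deriv R ?f = ps_euler R ?f"
  proof
    fix n
    show "(ps_t R \<otimes>\<^bsub>?P\<^esub> ps_deriv R ?f) n = ps_euler R ?f n"
    proof (cases n)
      case 0
      then show ?thesis using d' c by (simp add: ps_t_def ps_euler_def)
    next
      case (Suc m)
      have "(\<Oplus>i\<in>{..n}. ps_t R i \<otimes> ps_deriv R ?f (n - i)) = (\<Oplus>i\<in>{..n}. if 1 = i then ps_deriv R ?f (n - i) else \<zero>)"
        by (rule finsum_cong') (use d' in \<open>auto simp: ps_t_def\<close>)
      also have "\<dots> = ps_deriv R ?f (n - 1)" using d' Suc by (intro finsum_singleton) auto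
      finally show ?thesis using Suc by (simp add: ps_euler_def ps_deriv_def del: add.nat_pow_Suc)
    qed
  qed
  define h where "h = \<ominus>\<^bsub>?P\<^esub> (ps_t R \<otimes>\<^bsub>?P\<^esub> ps_deriv R ?f \<otimes>\<^bsub>?P\<^esub> inv\<^bsub>?P\<^esub> ?f)"
  have h: "h = (\<lambda>n. adams_op R lam n x)" by (simp add: h_def adams_op_def Let_def fun_eq_iff)
  have inv: "inv\<^bsub>?P\<^esub> ?f \<in> carrier ?P" "inv\<^bsub>?P\<^esub> ?f \<otimes>\<^bsub>?P\<^esub> ?f = \<one>\<^bsub>?P\<^esub>" using U by auto
  have hc: "h \<in> carrier ?P" unfolding h_def using t d inv by auto
  have e: "ps_euler R ?f \<in> carrier ?P" by (rule ps_euler_closed[OF f])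
  have "\<ominus>\<^bsub>?P\<^esub> (h \<otimes>\<^bsub>?P\<^esub> ?f) = ps_euler R ?f \<otimes>\<^bsub>?P\<^esub> (inv\<^bsub>?P\<^esub> ?f \<otimes>\<^bsub>?P\<^esub> ?f)"
    unfolding h_def td using e inv(1) f by algebra
  then show "neg_log_deriv R ?f (\<lambda>n. adams_op R lam n x)"
    using f hc inv e unfolding h[symmetric] by (simp add: neg_log_deriv_def)
  have ic: "(inv\<^bsub>?P\<^esub> ?f) 0 \<in> carrier R" using inv(1) by (auto simp: ps_carrier_iff)
  have "h 0 = \<ominus> ((ps_euler R ?f \<otimes>\<^bsub>?P\<^esub> inv\<^bsub>?P\<^esub> ?f) 0)"
    unfolding h_def td by (rule ps_uminus) (use e inv in simp)
  also have "\<dots> = \<zero>" using ic c by (simp add: ps_euler_def)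
  finally show "adams_op R lam 0 x = \<zero>" using h by (simp add: fun_eq_iff)
qed

text \<open>
  The comparisons of logarithmic derivatives below exchange two sums. This form moves the outer sum into
  the integer coefficients, so that the cancellation becomes a statement about integers.
\<close>
lemma (in cring) finsum_int_combination:
  assumes "finite A" "finite E" "\<And>e. e \<in> E \<Longrightarrow> g e \<in> carrier R"
  shows "(\<Oplus>k\<in>A. \<Oplus>e\<in>E. [(c k e :: int)] \<cdot> g e) = (\<Oplus>e\<in>E. [(\<Sum>k\<in>A. c k e)] \<cdot> g e)"
  using assms(1)
proof (induction A rule: finite_induct)
  case empty
  show ?case by (simp add: add_pow_int_ge)
next
  case (insert k A)
  have "(\<Oplus>k\<in>insert k A. \<Oplus>e\<in>E. [c k e] \<cdot> g e)
    = (\<Oplus>e\<in>E. [c k e] \<cdot> g e) \<oplus> (\<Oplus>e\<in>E. [(\<Sum>k\<in>A. c k e)] \<cdot> g e)"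
    using insert assms(3) by simp
  also have "\<dots> = (\<Oplus>e\<in>E. [c k e] \<cdot> g e \<oplus> [(\<Sum>k\<in>A. c k e)] \<cdot> g e)"
    by (rule finsum_addf[symmetric]) (use assms(3) in auto)
  also have "\<dots> = (\<Oplus>e\<in>E. [(\<Sum>k\<in>insert k A. c k e)] \<cdot> g e)"
    by (rule finsum_cong') (use assms(3) insert in \<open>auto simp: add.int_pow_mult\<close>)
  finally show ?case .
qed

lemma (in cring) sign_int_mult:
  assumes "x \<in> carrier R"
  shows "[((- 1) ^ m :: int)] \<cdot> x = (if even m then x else \<ominus> x)"
proof -
  have "[(- 1 :: int)] \<cdot> x = \<ominus> x" using add.int_pow_neg[of x 1] assms by (simp add: add.int_pow_1)
  then show ?thesis using assms by (auto simp: add.int_pow_1)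
qed

text \<open>
  With \<open>b j\<close> in the role of \<open>y choose j\<close>, this is the negative logarithmic derivative of \<open>(1 - e t) ^ y\<close>. It
  is used in two rings: over the rationalization with \<open>y = \<tau>\<^sub>k(x)\<close> and \<open>e = 1\<close>, and over \<open>B\<close> itself with
  an exponent \<open>y\<close> from \<open>\<int>\<^sub>S\<close>.
\<close>
lemma (in cring) neg_log_deriv_alternating:
  assumes b: "\<And>j. b j \<in> carrier R" and y: "y \<in> carrier R" and e: "e \<in> carrier R"
    and rec: "\<And>j. [Suc j] \<cdot> b (Suc j) = (y \<ominus> [j] \<cdot> \<one>) \<otimes> b j"
  shows "neg_log_deriv R (\<lambda>j. ([((- 1) ^ j :: int)] \<cdot> b j) \<otimes> e [^] j)
    (\<lambda>j. if j = 0 then \<zero> else y \<otimes> e [^] j)"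
proof (rule neg_log_deriv_binomial)
  show "(\<lambda>j. ([((- 1) ^ j :: int)] \<cdot> b j) \<otimes> e [^] j) \<in> carrier (power_series R)"
    using b e by (auto simp: ps_carrier_iff)
  fix m :: nat
  have ym: "y \<ominus> [m] \<cdot> \<one> \<in> carrier R" using y by simp
  have em: "e [^] m \<in> carrier R" using e by simp
  have s: "[Suc m] \<cdot> ([((- 1) ^ Suc m :: int)] \<cdot> b (Suc m)) = \<ominus> ([((- 1) ^ m :: int)] \<cdot> ((y \<ominus> [m] \<cdot> \<one>) \<otimes> b m))"
    using b[of "Suc m"] b[of m] ym rec[of m]
    by (simp only: sign_int_mult m_closed even_Suc) (auto simp: add.nat_pow_inv simp del: add.nat_pow_Suc)
  have t: "[((- 1) ^ m :: int)] \<cdot> ((y \<ominus> [m] \<cdot> \<one>) \<otimes> b m) = (y \<ominus> [m] \<cdot> \<one>) \<otimes> ([((- 1) ^ m :: int)] \<cdot> b m)"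
    using b[of m] ym by (rule add_pow_rdistr_int[symmetric, rotated])
  let ?z = "[((- 1) ^ m :: int)] \<cdot> b m"
  have z: "?z \<in> carrier R" using b by simp
  have "[Suc m] \<cdot> (([((- 1) ^ Suc m :: int)] \<cdot> b (Suc m)) \<otimes> e [^] Suc m)
    = ([Suc m] \<cdot> ([((- 1) ^ Suc m :: int)] \<cdot> b (Suc m))) \<otimes> e [^] Suc m"
    using b e by (intro add_pow_ldistr[symmetric]) auto
  also have "\<dots> = \<ominus> ((y \<ominus> [m] \<cdot> \<one>) \<otimes> ?z) \<otimes> (e [^] m \<otimes> e)" unfolding s t by simp
  also have "\<dots> = \<ominus> (e \<otimes> ((y \<ominus> [m] \<cdot> \<one>) \<otimes> (?z \<otimes> e [^] m)))"
    using ym z em e by algebra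
  finally show "[Suc m] \<cdot> (([((- 1) ^ Suc m :: int)] \<cdot> b (Suc m)) \<otimes> e [^] Suc m)
    = \<ominus> (e \<otimes> ((y \<ominus> [m] \<cdot> \<one>) \<otimes> (?z \<otimes> e [^] m)))" .
qed (use y e in auto)

lemma ring_hom_nat_mult:
  assumes "cring A" "cring C" "h \<in> ring_hom A C" "x \<in> carrier A"
  shows "h ([(n::nat)] \<cdot>\<^bsub>A\<^esub> x) = [n] \<cdot>\<^bsub>C\<^esub> h x"
proof -
  interpret ring_hom_cring A C h by (intro ring_hom_cringI assms)
  show ?thesis using assms(4) by (induction n) auto
qed

lemma power_series_map_hom:
  assumes A: "cring A" and C: "cring C" and h: "h \<in> ring_hom A C"
  shows "(\<lambda>f n. h (f n)) \<in> ring_hom (power_series A) (power_series C)"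
proof -
  interpret ring_hom_cring A C h by (intro ring_hom_cringI assms)
  show ?thesis
  proof (rule ring_hom_memI)
    fix f g assume "f \<in> carrier (power_series A)" "g \<in> carrier (power_series A)"
    then have c: "f i \<in> carrier A" "g i \<in> carrier A" for i by (auto simp: ps_carrier_iff)
    show "(\<lambda>n. h ((f \<otimes>\<^bsub>power_series A\<^esub> g) n)) = (\<lambda>n. h (f n)) \<otimes>\<^bsub>power_series C\<^esub> (\<lambda>n. h (g n))"
    proof
      fix n
      have "h (\<Oplus>\<^bsub>A\<^esub>i\<in>{..n}. f i \<otimes>\<^bsub>A\<^esub> g (n - i)) = (\<Oplus>\<^bsub>C\<^esub>i\<in>{..n}. (h \<circ> (\<lambda>i. f i \<otimes>\<^bsub>A\<^esub> g (n - i))) i)"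
        by (rule hom_finsum) (use c in auto)
      then show "h ((f \<otimes>\<^bsub>power_series A\<^esub> g) n) = ((\<lambda>n. h (f n)) \<otimes>\<^bsub>power_series C\<^esub> (\<lambda>n. h (g n))) n"
        using c by simp
    qed
    show "(\<lambda>n. h ((f \<oplus>\<^bsub>power_series A\<^esub> g) n)) = (\<lambda>n. h (f n)) \<oplus>\<^bsub>power_series C\<^esub> (\<lambda>n. h (g n))"
      using c by (intro ext) simp
  qed (auto simp: ps_carrier_iff fun_eq_iff)
qed

lemma neg_log_deriv_hom:
  assumes A: "cring A" and C: "cring C" and h: "h \<in> ring_hom A C"
    and f: "neg_log_deriv A f p"
  shows "neg_log_deriv C (\<lambda>n. h (f n)) (\<lambda>n. h (p n))"
proof -
  interpret cring A by (rule A)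
  interpret C: cring C by (rule C)
  interpret ring_hom_cring "power_series A" "power_series C" "\<lambda>f n. h (f n)"
    by (intro ring_hom_cringI power_series_map_hom assms power_series_cring C.power_series_cring)
  have c: "f \<in> carrier (power_series A)" "p \<in> carrier (power_series A)" using f by (auto simp: neg_log_deriv_def)
  have "ps_euler C (\<lambda>n. h (f n)) = (\<lambda>n. h (ps_euler A f n))"
    using c ring_hom_nat_mult[OF A C h] by (auto simp: ps_euler_def ps_carrier_iff)
  also have "\<dots> = (\<lambda>n. h ((\<ominus>\<^bsub>power_series A\<^esub> (p \<otimes>\<^bsub>power_series A\<^esub> f)) n))"
    using f by (simp only: neg_log_deriv_def)
  also have "\<dots> = \<ominus>\<^bsub>power_series C\<^esub> ((\<lambda>n. h (p n)) \<otimes>\<^bsub>power_series C\<^esub> (\<lambda>n. h (f n)))"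
    using c by (simp only: hom_a_inv hom_mult R.m_closed)
  finally show ?thesis unfolding neg_log_deriv_def using hom_closed[OF c(1)] hom_closed[OF c(2)] by simp
qed

section \<open>The rationalization of a torsion-free ring\<close>

lemma UN_const_on_classes:
  assumes "p \<in> U" "q \<in> V" "\<And>a m b n. (a, m) \<in> U \<Longrightarrow> (b, n) \<in> V \<Longrightarrow> F a m b n = C"
  shows "(\<Union>(a, m)\<in>U. \<Union>(b, n)\<in>V. F a m b n) = C"
proof -
  have "(\<Union>(b, n)\<in>V. F a m b n) = C" if "(a, m) \<in> U" for a m
    using assms(3)[OF that] by (intro UN_constant_eq[OF assms(2)]) auto
  then show ?thesis by (intro UN_constant_eq[OF assms(1)] ballI) (simp only: split_paired_all prod.case)
qed

locale torsion_free_cring = cring +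
  assumes torsion_free: "torsion_free R"
begin

lemmas nat_mult_cancel = torsion_free_cancel[OF torsion_free]

lemma rat_class_mem:
  assumes "a \<in> carrier R" "m > 0"
  shows "(b, n) \<in> rat_class R a m \<longleftrightarrow> b \<in> carrier R \<and> n > 0 \<and> [n] \<cdot> a = [m] \<cdot> b"
proof -
  have "[n] \<cdot> a = [m] \<cdot> b" if "b \<in> carrier R" "k > 0" "[(k * n)] \<cdot> a = [(k * m)] \<cdot> b" for k
    using that assms nat_mult_cancel[of "[n] \<cdot> a" "[m] \<cdot> b" k]
    by (simp add: add.nat_pow_pow mult.commute)
  moreover have "\<exists>k>0. [(k * n)] \<cdot> a = [(k * m)] \<cdot> b" if "[n] \<cdot> a = [m] \<cdot> b"
    using that by (intro exI[of _ 1]) simp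
  ultimately show ?thesis by (auto simp: rat_class_def)
qed

lemma rat_class_eq_iff:
  assumes a: "a \<in> carrier R" "m > 0" and b: "b \<in> carrier R" "n > 0"
  shows "rat_class R a m = rat_class R b n \<longleftrightarrow> [n] \<cdot> a = [m] \<cdot> b"
proof
  assume "rat_class R a m = rat_class R b n"
  then have "(b, n) \<in> rat_class R a m" using b by (simp add: rat_class_mem)
  then show "[n] \<cdot> a = [m] \<cdot> b" using a by (simp add: rat_class_mem)
next
  have sub: "rat_class R a m \<subseteq> rat_class R b n"
    if a: "a \<in> carrier R" "m > 0" and b: "b \<in> carrier R" "n > 0" and eq: "[n] \<cdot> a = [m] \<cdot> b" for a b m n
  proof (rule subrelI)
    fix c q assume "(c, q) \<in> rat_class R a m"
    then have c: "c \<in> carrier R" "q > 0" "[q] \<cdot> a = [m] \<cdot> c" using a by (auto simp: rat_class_mem)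
    have "[m] \<cdot> ([q] \<cdot> b) = [q] \<cdot> ([m] \<cdot> b)" using b by (simp add: add.nat_pow_pow mult.commute)
    also have "\<dots> = [n] \<cdot> ([q] \<cdot> a)" using a by (simp add: add.nat_pow_pow mult.commute flip: eq)
    also have "\<dots> = [m] \<cdot> ([n] \<cdot> c)" using c by (simp add: add.nat_pow_pow mult.commute)
    finally have "[q] \<cdot> b = [n] \<cdot> c" using nat_mult_cancel[of "[q] \<cdot> b" "[n] \<cdot> c" m] a b c by simp
    then show "(c, q) \<in> rat_class R b n" using b c by (simp add: rat_class_mem)
  qed
  show "rat_class R a m = rat_class R b n" if "[n] \<cdot> a = [m] \<cdot> b"
    using sub[OF a b that] sub[OF b a that[symmetric]] by blast
qed

lemma rat_class_self: "a \<in> carrier R \<Longrightarrow> m > 0 \<Longrightarrow> (a, m) \<in> rat_class R a m"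
  by (simp add: rat_class_mem)

lemma rat_class_mult:
  assumes a: "a \<in> carrier R" "m > 0" and b: "b \<in> carrier R" "n > 0"
  shows "rat_class R a m \<otimes>\<^bsub>rationalization R\<^esub> rat_class R b n = rat_class R (a \<otimes> b) (m * n)"
proof -
  have "rat_class R (a' \<otimes> b') (m' * n') = rat_class R (a \<otimes> b) (m * n)"
    if "(a', m') \<in> rat_class R a m" "(b', n') \<in> rat_class R b n" for a' m' b' n'
  proof -
    have c: "a' \<in> carrier R" "m' > 0" "[m'] \<cdot> a = [m] \<cdot> a'" "b' \<in> carrier R" "n' > 0" "[n'] \<cdot> b = [n] \<cdot> b'"
      using that a b by (auto simp: rat_class_mem)
    have "[(m * n)] \<cdot> (a' \<otimes> b') = ([m] \<cdot> a') \<otimes> ([n] \<cdot> b')"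
      using c by (simp add: add_pow_ldistr add_pow_rdistr add.nat_pow_pow mult.commute)
    also have "\<dots> = [(m' * n')] \<cdot> (a \<otimes> b)"
      unfolding c(3,6)[symmetric] using a b by (simp add: add_pow_ldistr add_pow_rdistr add.nat_pow_pow mult.commute)
    finally show ?thesis using a b c by (subst rat_class_eq_iff) auto
  qed
  from UN_const_on_classes[OF rat_class_self[OF a] rat_class_self[OF b] this]
  show ?thesis by (simp add: rationalization_def)
qed

lemma rat_class_add:
  assumes a: "a \<in> carrier R" "m > 0" and b: "b \<in> carrier R" "n > 0"
  shows "rat_class R a m \<oplus>\<^bsub>rationalization R\<^esub> rat_class R b n = rat_class R ([n] \<cdot> a \<oplus> [m] \<cdot> b) (m * n)"
proof -
  have "rat_class R ([n'] \<cdot> a' \<oplus> [m'] \<cdot> b') (m' * n') = rat_class R ([n] \<cdot> a \<oplus> [m] \<cdot> b) (m * n)"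
    if "(a', m') \<in> rat_class R a m" "(b', n') \<in> rat_class R b n" for a' m' b' n'
  proof -
    have c: "a' \<in> carrier R" "m' > 0" "[m'] \<cdot> a = [m] \<cdot> a'" "b' \<in> carrier R" "n' > 0" "[n'] \<cdot> b = [n] \<cdot> b'"
      using that a b by (auto simp: rat_class_mem)
    have "[(m * n)] \<cdot> ([n'] \<cdot> a' \<oplus> [m'] \<cdot> b') = [(n * n')] \<cdot> ([m] \<cdot> a') \<oplus> [(m * m')] \<cdot> ([n] \<cdot> b')"
      using c by (simp add: add.nat_pow_distrib add.nat_pow_pow mult_ac)
    also have "\<dots> = [(m' * n')] \<cdot> ([n] \<cdot> a \<oplus> [m] \<cdot> b)"
      unfolding c(3,6)[symmetric] using a b by (simp add: add.nat_pow_distrib add.nat_pow_pow mult_ac)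
    finally show ?thesis using a b c by (subst rat_class_eq_iff) auto
  qed
  from UN_const_on_classes[OF rat_class_self[OF a] rat_class_self[OF b] this]
  show ?thesis by (simp add: rationalization_def)
qed

lemma rationalization_carrier:
  "u \<in> carrier (rationalization R) \<longleftrightarrow> (\<exists>a m. u = rat_class R a m \<and> a \<in> carrier R \<and> m > 0)"
  by (auto simp: rationalization_def)

lemma rationalization_cases:
  assumes "u \<in> carrier (rationalization R)"
  obtains a m where "u = rat_class R a m" "a \<in> carrier R" "m > 0"
  using assms by (auto simp: rationalization_carrier)

lemma rat_class_closed: "a \<in> carrier R \<Longrightarrow> m > 0 \<Longrightarrow> rat_class R a m \<in> carrier (rationalization R)"
  by (auto simp: rationalization_carrier)

lemma rationalization_one_zero:
  "\<one>\<^bsub>rationalization R\<^esub> = rat_class R \<one> 1" "\<zero>\<^bsub>rationalization R\<^esub> = rat_class R \<zero> 1"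
  by (simp_all add: rationalization_def)

text \<open>
  For a torsion-free ring the fractions \<open>a / m\<close> and \<open>b / n\<close> agree exactly if \<open>[n] \<cdot> a = [m] \<cdot> b\<close>, so all ring
  laws reduce to identities between multiples of products in the ring itself.
\<close>
lemma rationalization_cring: "cring (rationalization R)"
proof -
  let ?K = "rationalization R"
  note [simp] = rat_class_add rat_class_mult rat_class_closed rationalization_one_zero
    rat_class_eq_iff add.nat_pow_distrib add.nat_pow_pow add_pow_ldistr add_pow_rdistr
  have ab: "abelian_group ?K"
  proof (rule abelian_groupI, goal_cases)
    case (1 x y) then show ?case by (elim rationalization_cases) simp
  next
    case 2 show ?case by simp
  next
    case (3 x y z) then show ?case by (elim rationalization_cases) (simp add: a_ac mult_ac)
  next
    case (4 x y) then show ?case by (elim rationalization_cases) (simp add: a_ac mult_ac)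
  next
    case (5 x) then show ?case by (elim rationalization_cases) simp
  next
    case (6 x)
    then obtain a m where x: "x = rat_class R a m" "a \<in> carrier R" "m > 0" by (rule rationalization_cases)
    show ?case
      by (rule bexI[of _ "rat_class R (\<ominus> a) m"]) (use x in \<open>simp_all add: add.nat_pow_inv l_neg\<close>)
  qed
  have mo: "comm_monoid ?K"
  proof (rule comm_monoidI, goal_cases)
    case (1 x y) then show ?case by (elim rationalization_cases) simp
  next
    case 2 show ?case by simp
  next
    case (3 x y z) then show ?case by (elim rationalization_cases) (simp add: m_ac mult_ac)
  next
    case (4 x) then show ?case by (elim rationalization_cases) simp
  next
    case (5 x y) then show ?case by (elim rationalization_cases) (simp add: m_ac mult_ac)
  qed
  show ?thesis
  proof (rule cringI[OF ab mo], goal_cases)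
    case (1 x y z) then show ?case by (elim rationalization_cases) (simp add: l_distr m_assoc mult_ac)
  qed
qed

lemma to_rat_hom: "to_rat R \<in> ring_hom R (rationalization R)"
  by (rule ring_hom_memI)
    (simp_all add: to_rat_def rat_class_closed rat_class_mult rat_class_add rationalization_one_zero)

lemma rat_class_nat_mult:
  assumes "a \<in> carrier R" "m > 0"
  shows "[(n::nat)] \<cdot>\<^bsub>rationalization R\<^esub> rat_class R a m = rat_class R ([n] \<cdot> a) m"
proof -
  interpret K: cring "rationalization R" by (rule rationalization_cring)
  show ?thesis
  proof (induction n)
    case 0
    then show ?case using assms by (simp add: rationalization_one_zero rat_class_eq_iff)
  next
    case (Suc n)
    then show ?case using assms
      by (simp add: rat_class_closed rat_class_add rat_class_eq_iff add.nat_pow_distrib add.nat_pow_pow mult_ac)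
  qed
qed

lemma rationalization_torsion_free: "torsion_free (rationalization R)"
  unfolding torsion_free_def
proof (intro allI ballI impI, elim conjE)
  fix n :: nat and x
  assume x: "x \<in> carrier (rationalization R)" and n: "n > 0"
    and 0: "[n] \<cdot>\<^bsub>rationalization R\<^esub> x = \<zero>\<^bsub>rationalization R\<^esub>"
  obtain a m where a: "x = rat_class R a m" "a \<in> carrier R" "m > 0" using x by (rule rationalization_cases)
  have "[n] \<cdot> a = \<zero>" using 0 a by (simp add: rat_class_nat_mult rationalization_one_zero rat_class_eq_iff)
  then have "a = \<zero>" using torsion_free n a unfolding torsion_free_def by auto
  then show "x = \<zero>\<^bsub>rationalization R\<^esub>" using a by (simp add: rationalization_one_zero rat_class_eq_iff)
qed

lemma rationalization_smult:
  assumes "a \<in> carrier R" "m > 0" "n > 0"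
  shows "(1 / of_nat n) \<odot>\<^bsub>rationalization R\<^esub> rat_class R a m = rat_class R a (n * m)"
proof -
  have "1 / of_nat n = Rat.Fract 1 (int n)" by (simp add: Fract_of_int_quotient)
  then have q: "quotient_of (1 / of_nat n) = (1, int n)"
    using assms(3) by (simp add: quotient_of_Fract Rat.normalize_def)
  have "rat_class R ([(1::int)] \<cdot> a') (n * m') = rat_class R a (n * m)" if "(a', m') \<in> rat_class R a m" for a' m'
  proof -
    have c: "a' \<in> carrier R" "m' > 0" "[m'] \<cdot> a = [m] \<cdot> a'" using that assms by (auto simp: rat_class_mem)
    have "[(n * m)] \<cdot> a' = [n] \<cdot> ([m] \<cdot> a')" using c by (simp add: add.nat_pow_pow mult.commute)
    also have "\<dots> = [(n * m')] \<cdot> a" unfolding c(3)[symmetric] using assms by (simp add: add.nat_pow_pow mult.commute)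
    finally show ?thesis using assms c by (simp add: rat_class_eq_iff add.int_pow_1)
  qed
  then have "(\<Union>(a', m')\<in>rat_class R a m. rat_class R ([(1::int)] \<cdot> a') (n * m')) = rat_class R a (n * m)"
    using rat_class_self[OF assms(1,2)] by (intro UN_constant_eq) auto
  then show ?thesis by (simp add: rationalization_def q)
qed

lemma rationalization_smult_closed:
  assumes "u \<in> carrier (rationalization R)" "n > 0"
  shows "(1 / of_nat n) \<odot>\<^bsub>rationalization R\<^esub> u \<in> carrier (rationalization R)"
  using assms by (elim rationalization_cases) (simp add: rationalization_smult rat_class_closed)

lemma rationalization_nat_mult_smult:
  assumes "u \<in> carrier (rationalization R)" "n > 0"
  shows "[n] \<cdot>\<^bsub>rationalization R\<^esub> ((1 / of_nat n) \<odot>\<^bsub>rationalization R\<^esub> u) = u"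
  using assms by (elim rationalization_cases)
    (simp add: rationalization_smult rat_class_nat_mult rat_class_eq_iff add.nat_pow_pow mult.commute)

end

context torsion_free_cring
begin

abbreviation K where "K \<equiv> rationalization R"

lemma binom_rationalization:
  assumes y: "y \<in> carrier K"
  shows binom_closed: "binom K y j \<in> carrier K"
    and binom_0: "binom K y 0 = \<one>\<^bsub>K\<^esub>"
    and binom_rec: "[Suc j] \<cdot>\<^bsub>K\<^esub> binom K y (Suc j) = (y \<ominus>\<^bsub>K\<^esub> [j] \<cdot>\<^bsub>K\<^esub> \<one>\<^bsub>K\<^esub>) \<otimes>\<^bsub>K\<^esub> binom K y j"
proof -
  interpret K: cring K by (rule rationalization_cring)
  interpret K: torsion_free_cring K by unfold_locales (rule rationalization_torsion_free)
  define P where "P = (\<lambda>j::nat. \<Otimes>\<^bsub>K\<^esub>i\<in>{..<j}. y \<ominus>\<^bsub>K\<^esub> [i] \<cdot>\<^bsub>K\<^esub> \<one>\<^bsub>K\<^esub>)"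
  have u': "y \<ominus>\<^bsub>K\<^esub> [i] \<cdot>\<^bsub>K\<^esub> \<one>\<^bsub>K\<^esub> \<in> carrier K" for i :: nat using y by simp
  have P: "P j \<in> carrier K" for j unfolding P_def using u' by (intro K.finprod_closed) auto
  have P_Suc: "P (Suc j) = (y \<ominus>\<^bsub>K\<^esub> [j] \<cdot>\<^bsub>K\<^esub> \<one>\<^bsub>K\<^esub>) \<otimes>\<^bsub>K\<^esub> P j"
    unfolding P_def lessThan_Suc using u' by (subst K.finprod_insert) auto
  have b: "binom K y j = (1 / of_nat (fact j)) \<odot>\<^bsub>K\<^esub> P j" for j
    by (simp add: binom_def P_def)
  show c: "binom K y j \<in> carrier K" for j unfolding b by (rule rationalization_smult_closed[OF P]) simp
  \<comment> \<open>Multiplied by \<open>fact j\<close>, the recursion becomes that of the falling factorials; torsion-freeness removes this factor.\<close>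
  have fb: "[(fact j :: nat)] \<cdot>\<^bsub>K\<^esub> binom K y j = P j" for j
    unfolding b by (rule rationalization_nat_mult_smult[OF P]) simp
  show "binom K y 0 = \<one>\<^bsub>K\<^esub>" using fb[of 0] c[of 0] by (simp add: P_def)
  let ?u = "y \<ominus>\<^bsub>K\<^esub> [j] \<cdot>\<^bsub>K\<^esub> \<one>\<^bsub>K\<^esub>"
  have u: "?u \<in> carrier K" by (rule u')
  have "[(fact j :: nat)] \<cdot>\<^bsub>K\<^esub> ([Suc j] \<cdot>\<^bsub>K\<^esub> binom K y (Suc j)) = [(fact (Suc j) :: nat)] \<cdot>\<^bsub>K\<^esub> binom K y (Suc j)"
    using c by (simp only: K.add.nat_pow_pow fact_Suc of_nat_id mult.commute)
  also have "\<dots> = ?u \<otimes>\<^bsub>K\<^esub> P j" unfolding fb P_Suc ..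
  also have "\<dots> = [(fact j :: nat)] \<cdot>\<^bsub>K\<^esub> (?u \<otimes>\<^bsub>K\<^esub> binom K y j)"
    unfolding fb[symmetric] by (rule K.add_pow_rdistr[OF u c])
  finally show "[Suc j] \<cdot>\<^bsub>K\<^esub> binom K y (Suc j) = ?u \<otimes>\<^bsub>K\<^esub> binom K y j"
    by (rule K.nat_mult_cancel[rotated 3]) (auto simp: c u simp del: K.add.nat_pow_Suc)
qed

lemma one_minus_power_0:
  assumes y: "y \<in> carrier K"
  shows "one_minus_power K k y 0 = \<one>\<^bsub>K\<^esub>"
proof -
  interpret K: cring K by (rule rationalization_cring)
  show ?thesis using y by (simp add: one_minus_power_def binom_0)
qed

lemma neg_log_deriv_one_minus_power:
  assumes y: "y \<in> carrier K" and "k > 0"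
  shows "neg_log_deriv K (one_minus_power K k y)
    (\<lambda>n. if n > 0 \<and> k dvd n then [k] \<cdot>\<^bsub>K\<^esub> y else \<zero>\<^bsub>K\<^esub>)"
proof -
  interpret K: cring K by (rule rationalization_cring)
  have "neg_log_deriv K (\<lambda>j. ([((- 1) ^ j :: int)] \<cdot>\<^bsub>K\<^esub> binom K y j) \<otimes>\<^bsub>K\<^esub> \<one>\<^bsub>K\<^esub> [^]\<^bsub>K\<^esub> j)
    (\<lambda>j. if j = 0 then \<zero>\<^bsub>K\<^esub> else y \<otimes>\<^bsub>K\<^esub> \<one>\<^bsub>K\<^esub> [^]\<^bsub>K\<^esub> j)"
    by (rule K.neg_log_deriv_alternating) (use y in \<open>auto simp: binom_closed binom_rec simp del: K.add.nat_pow_Suc\<close>)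
  then have "neg_log_deriv K (\<lambda>j. [((- 1) ^ j :: int)] \<cdot>\<^bsub>K\<^esub> binom K y j) (\<lambda>j. if j = 0 then \<zero>\<^bsub>K\<^esub> else y)"
    using y by (simp add: binom_closed cong: if_cong)
  note K.neg_log_deriv_stretch[OF this assms(2)]
  moreover have "ps_stretch K k (\<lambda>j. [((- 1) ^ j :: int)] \<cdot>\<^bsub>K\<^esub> binom K y j) = one_minus_power K k y"
    by (simp add: ps_stretch_def one_minus_power_def)
  moreover have "(\<lambda>n. [k] \<cdot>\<^bsub>K\<^esub> ps_stretch K k (\<lambda>j. if j = 0 then \<zero>\<^bsub>K\<^esub> else y) n)
    = (\<lambda>n. if n > 0 \<and> k dvd n then [k] \<cdot>\<^bsub>K\<^esub> y else \<zero>\<^bsub>K\<^esub>)"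
    using assms(2) by (auto simp: ps_stretch_def fun_eq_iff dvd_imp_le)
  ultimately show ?thesis by simp
qed

end

section \<open>The product formula\<close>

text \<open>
  The coefficient of \<open>\<psi>\<^sup>e\<close> in \<open>\<Sum>\<^sub>k k \<tau>\<^sub>k\<close>, where \<open>k\<close> runs through the divisors of \<open>i\<close> in \<open>S\<close>. Writing
  \<open>k = e * d\<close>, the sum runs over the divisors \<open>d\<close> of \<open>i div e\<close> with primes in \<open>S\<close>, so it vanishes unless
  \<open>i div e\<close> is prime to \<open>S\<close>, that is unless \<open>e\<close> is the \<open>S\<close>-part of \<open>i\<close>.
\<close>
lemma moebius_inversion_coeff:
  assumes S: "divisor_stable S" "mult_closed S" and i: "i > 0" "e dvd i"
    and F: "finite F" "F \<subseteq> S" "S \<inter> {..i} \<subseteq> F"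
  shows "(\<Sum>k\<in>F. if k dvd i \<and> e dvd k then moebius (k div e) else 0)
    = (if e \<in> S \<and> i div e \<in> coprime_to S then 1 else 0)"
proof (cases "e \<in> S")
  case False
  then have "\<not> e dvd k" if "k \<in> F" for k
    using that F S(1) by (auto simp: divisor_stable_def)
  then show ?thesis using False by (simp add: sum.neutral)
next
  case True
  have e: "e > 0" using i by (auto intro: gr0I)
  have q: "i div e > 0" using i e by (auto simp: div_greater_zero_iff dvd_imp_le)
  have "(\<Sum>k\<in>F. if k dvd i \<and> e dvd k then moebius (k div e) else 0)
    = (\<Sum>k\<in>{k\<in>F. k dvd i \<and> e dvd k}. moebius (k div e))"
    using F(1) by (simp add: sum.inter_filter)
  also have "\<dots> = (\<Sum>d | d dvd i div e \<and> prime_factors d \<subseteq> S. moebius d)"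
  proof (rule sum.reindex_bij_witness[of _ "\<lambda>d. e * d" "\<lambda>k. k div e"])
    fix k assume k: "k \<in> {k\<in>F. k dvd i \<and> e dvd k}"
    then show "e * (k div e) = k" by auto
    have "k \<in> S" using k F by auto
    then show "k div e \<in> {d. d dvd i div e \<and> prime_factors d \<subseteq> S}"
      using k e S(1) by (auto simp: divisor_stable_def in_prime_factors_iff dvd_mult_cancel2 elim!: dvdE)
  next
    fix d assume d: "d \<in> {d. d dvd i div e \<and> prime_factors d \<subseteq> S}"
    then have "d > 0" using q by (auto intro: gr0I)
    then have "d \<in> S" using d S_mem_iff[OF S, of d] by (auto simp: in_prime_factors_iff)
    then have "e * d \<in> S" using True S(2) by (auto simp: mult_closed_def)
    moreover have "e * d dvd i" using d i by (auto elim!: dvdE)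
    moreover have "e * d \<le> i" using calculation i by (auto dest: dvd_imp_le)
    ultimately show "e * d \<in> {k\<in>F. k dvd i \<and> e dvd k}" using F by auto
    show "e * d div e = d" using e by simp
  qed auto
  also have "\<dots> = (if prime_factors (i div e) \<inter> S = {} then 1 else 0)"
    by (rule moebius_divisor_sum[OF q])
  also have "prime_factors (i div e) \<inter> S = {} \<longleftrightarrow> i div e \<in> coprime_to S"
    using q by (auto simp: coprime_to_def in_prime_factors_iff)
  finally show ?thesis using True by simp
qed

context torsion_free_cring
begin

lemma to_rat_closed: "a \<in> carrier R \<Longrightarrow> to_rat R a \<in> carrier K"
  using ring_hom_closed[OF to_rat_hom] .

lemma tau_rationalization:
  assumes "k > 0" "\<And>n. n > 0 \<Longrightarrow> \<psi> n x \<in> carrier R"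
  shows tau_closed: "tau R \<psi> k x \<in> carrier K"
    and mult_tau: "[k] \<cdot>\<^bsub>K\<^esub> tau R \<psi> k x = to_rat R (\<Oplus>d\<in>{d. d dvd k}. [(moebius d)] \<cdot> \<psi> (k div d) x)"
proof -
  have "(\<Oplus>d\<in>{d. d dvd k}. [(moebius d)] \<cdot> \<psi> (k div d) x) \<in> carrier R"
    using assms by (intro finsum_closed) (auto simp: div_greater_zero_iff dvd_imp_le dvd_pos_nat)
  note c = to_rat_closed[OF this]
  show "tau R \<psi> k x \<in> carrier K" unfolding tau_def by (rule rationalization_smult_closed[OF c assms(1)])
  show "[k] \<cdot>\<^bsub>K\<^esub> tau R \<psi> k x = to_rat R (\<Oplus>d\<in>{d. d dvd k}. [(moebius d)] \<cdot> \<psi> (k div d) x)"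
    unfolding tau_def by (rule rationalization_nat_mult_smult[OF c assms(1)])
qed

text \<open>
  The terms are the coefficients of \<open>t ^ i\<close> in the negative logarithmic derivatives of the factors
  \<open>(1 - t ^ k) ^ \<tau>\<^sub>k(x)\<close>. Moebius inversion leaves only the Adams operator of the \<open>S\<close>-part of \<open>i\<close>, and
  this is the Adams operator of \<open>i\<close>.
\<close>
lemma sum_tau:
  assumes S: "divisor_stable S" "mult_closed S" and i: "i > 0"
    and F: "finite F" "F \<subseteq> S" "S \<inter> {..i} \<subseteq> F"
    and \<psi>: "\<And>n. n > 0 \<Longrightarrow> \<psi> n x \<in> carrier R"
    and \<psi>_part: "\<And>s m. s > 0 \<Longrightarrow> m \<in> coprime_to S \<Longrightarrow> \<psi> (s * m) x = \<psi> s x"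
  shows "(\<Oplus>\<^bsub>K\<^esub>k\<in>F. if i > 0 \<and> k dvd i then [k] \<cdot>\<^bsub>K\<^esub> tau R \<psi> k x else \<zero>\<^bsub>K\<^esub>) = to_rat R (\<psi> i x)"
proof -
  interpret K: cring K by (rule rationalization_cring)
  interpret h: ring_hom_cring R K "to_rat R" by (intro ring_hom_cringI to_rat_hom is_cring rationalization_cring)
  let ?E = "{e. e dvd i}"
  define c where "c k e = (if k dvd i \<and> e dvd k then moebius (k div e) else 0)" for k e
  have finE: "finite ?E" using i by simp
  have E: "\<psi> e x \<in> carrier R" if "e \<in> ?E" for e using that i by (intro \<psi>) (auto intro: gr0I)
  have "(if i > 0 \<and> k dvd i then [k] \<cdot>\<^bsub>K\<^esub> tau R \<psi> k x else \<zero>\<^bsub>K\<^esub>) = to_rat R (\<Oplus>e\<in>?E. [c k e] \<cdot> \<psi> e x)"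
    if "k \<in> F" for k
  proof (cases "k dvd i")
    case False
    then show ?thesis by (simp add: c_def add_pow_int_ge)
  next
    case True
    have k: "k > 0" using True i by (auto intro: gr0I)
    have k': "\<psi> e x \<in> carrier R" if "e dvd k" for e using that True by (intro E) (auto intro: dvd_trans)
    have "(\<Oplus>d\<in>{d. d dvd k}. [(moebius d)] \<cdot> \<psi> (k div d) x) = (\<Oplus>d\<in>(\<lambda>e. k div e) ` {e. e dvd k}. [(moebius d)] \<cdot> \<psi> (k div d) x)"
    proof (rule arg_cong[where f = "\<lambda>A. \<Oplus>d\<in>A. [(moebius d)] \<cdot> \<psi> (k div d) x"])
      show "{d. d dvd k} = (\<lambda>e. k div e) ` {e. e dvd k}"
      proof -
        have "d = k div (k div d) \<and> k div d dvd k" if "d dvd k" for d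
          using that k by (auto elim!: dvdE)
        then show ?thesis by blast
      qed
    qed
    also have "\<dots> = (\<Oplus>e\<in>{e. e dvd k}. [(moebius (k div e))] \<cdot> \<psi> (k div (k div e)) x)"
    proof (rule finsum_reindex)
      show "inj_on (\<lambda>e. k div e) {e. e dvd k}"
        by (rule inj_on_inverseI[of _ "\<lambda>d. k div d"]) (use k in \<open>auto elim!: dvdE\<close>)
      show "(\<lambda>d. [(moebius d)] \<cdot> \<psi> (k div d) x) \<in> (\<lambda>e. k div e) ` {e. e dvd k} \<rightarrow> carrier R"
        using k' k by (auto elim!: dvdE)
    qed
    also have "\<dots> = (\<Oplus>e\<in>?E. [c k e] \<cdot> \<psi> e x)"
    proof (rule add.finprod_mono_neutral_cong_left)
      fix e assume e: "e \<in> {e. e dvd k}"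
      then have "k div (k div e) = e" using k by (auto elim!: dvdE)
      then show "[(moebius (k div e))] \<cdot> \<psi> (k div (k div e)) x = [c k e] \<cdot> \<psi> e x"
        using e True by (simp add: c_def)
    qed (use finE E True in \<open>auto simp: c_def add_pow_int_ge intro: dvd_trans\<close>)
    finally show ?thesis using mult_tau[where \<psi> = \<psi> and x = x, OF k \<psi>] True i by simp
  qed
  then have "(\<Oplus>\<^bsub>K\<^esub>k\<in>F. if i > 0 \<and> k dvd i then [k] \<cdot>\<^bsub>K\<^esub> tau R \<psi> k x else \<zero>\<^bsub>K\<^esub>)
    = (\<Oplus>\<^bsub>K\<^esub>k\<in>F. (to_rat R \<circ> (\<lambda>k. \<Oplus>e\<in>?E. [c k e] \<cdot> \<psi> e x)) k)"
    using E by (intro K.finsum_cong') (auto intro!: to_rat_closed finsum_closed)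
  also have "\<dots> = to_rat R (\<Oplus>k\<in>F. \<Oplus>e\<in>?E. [c k e] \<cdot> \<psi> e x)"
    using E by (intro h.hom_finsum[symmetric]) auto
  also have "(\<Oplus>k\<in>F. \<Oplus>e\<in>?E. [c k e] \<cdot> \<psi> e x) = (\<Oplus>e\<in>?E. [(\<Sum>k\<in>F. c k e)] \<cdot> \<psi> e x)"
    by (rule finsum_int_combination[OF F(1) finE E])
  also have "\<dots> = (\<Oplus>e\<in>?E. [(if e \<in> S \<and> i div e \<in> coprime_to S then 1 else 0 :: int)] \<cdot> \<psi> e x)"
    using moebius_inversion_coeff[OF S i _ F] E by (intro finsum_cong') (auto simp: c_def)
  also have "\<dots> = \<psi> i x"
  proof -
    obtain s m where sm: "i = s * m" "s \<in> S" "m \<in> coprime_to S" using coprime_to_part[OF S i] .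
    have s: "s > 0" using sm i by auto
    have iff: "e \<in> S \<and> i div e \<in> coprime_to S \<longleftrightarrow> s = e" if "e \<in> ?E" for e
    proof
      assume "e \<in> S \<and> i div e \<in> coprime_to S"
      moreover have "s * m = e * (i div e)" using that sm(1) by simp
      ultimately show "s = e" using coprime_to_part_unique(1)[OF S(1) sm(2,3)] by blast
    next
      assume "s = e"
      then show "e \<in> S \<and> i div e \<in> coprime_to S" using sm s by simp
    qed
    have "(\<Oplus>e\<in>?E. [(if e \<in> S \<and> i div e \<in> coprime_to S then 1 else 0 :: int)] \<cdot> \<psi> e x)
      = (\<Oplus>e\<in>?E. if s = e then \<psi> e x else \<zero>)"
    proof (rule finsum_cong')
      fix e assume e: "e \<in> ?E"
      show "[(if e \<in> S \<and> i div e \<in> coprime_to S then 1 else 0 :: int)] \<cdot> \<psi> e x = (if s = e then \<psi> e x else \<zero>)"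
        unfolding iff[OF e] using E[OF e] by (simp add: add.int_pow_1 add_pow_int_ge)
    qed (use E in auto)
    also have "\<dots> = \<psi> s x" by (rule add.finprod_singleton) (use sm finE E in auto)
    finally show ?thesis using \<psi>_part[OF s sm(3)] sm(1) by simp
  qed
  finally show ?thesis .
qed

text \<open>
  A factor with \<open>k > n\<close> does not change the coefficients up to \<open>t ^ n\<close>, so it suffices that \<open>F\<close>
  contains the elements of \<open>S\<close> up to \<open>n\<close>. Up to that order the product and \<open>f\<close> have the same logarithmic
  derivative by \<open>sum_tau\<close>, hence the same coefficients.
\<close>
lemma product_formula:
  assumes S: "divisor_stable S" "mult_closed S"
    and F: "finite F" "F \<subseteq> S" "S \<inter> {..n} \<subseteq> F"
    and \<psi>: "\<And>n. n > 0 \<Longrightarrow> \<psi> n x \<in> carrier R"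
    and \<psi>_part: "\<And>s m. s > 0 \<Longrightarrow> m \<in> coprime_to S \<Longrightarrow> \<psi> (s * m) x = \<psi> s x"
    and f: "neg_log_deriv R f (\<lambda>n. if n = 0 then \<zero> else \<psi> n x)" "f 0 = \<one>"
  shows "(\<Otimes>\<^bsub>power_series K\<^esub>k\<in>F. one_minus_power K k (tau R \<psi> k x)) n = to_rat R (f n)"
proof -
  interpret K: cring K by (rule rationalization_cring)
  interpret P: cring "power_series K" by (rule K.power_series_cring)
  interpret h: ring_hom_cring R K "to_rat R" by (intro ring_hom_cringI to_rat_hom is_cring rationalization_cring)
  let ?g = "\<lambda>k. one_minus_power K k (tau R \<psi> k x)"
  define p where "p = (\<lambda>k n. if n > 0 \<and> k dvd n then [k] \<cdot>\<^bsub>K\<^esub> tau R \<psi> k x else \<zero>\<^bsub>K\<^esub>)"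
  let ?q = "\<lambda>n. to_rat R (if n = 0 then \<zero> else \<psi> n x)"
  have F0: "k > 0" if "k \<in> F" for k
    using subsetD[OF F(2) that] S(1) by (cases k) (auto simp: divisor_stable_def)
  have g: "neg_log_deriv K (?g k) (p k)" if "k \<in> F" for k
    unfolding p_def using neg_log_deriv_one_minus_power[OF tau_closed[where \<psi> = \<psi> and x = x, OF F0[OF that] \<psi>] F0[OF that]] .
  have sum_p: "(\<Oplus>\<^bsub>power_series K\<^esub>k\<in>F. p k) i = ?q i" if "i \<le> n" for i
  proof -
    have "(\<Oplus>\<^bsub>power_series K\<^esub>k\<in>F. p k) i = (\<Oplus>\<^bsub>K\<^esub>k\<in>F. p k i)"
      by (rule K.ps_finsum_coeff[OF F(1)]) (use g in \<open>auto simp: neg_log_deriv_def\<close>)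
    also have "\<dots> = ?q i"
    proof (cases "i = 0")
      case False
      have "S \<inter> {..i} \<subseteq> F" using F(3) that by auto
      from sum_tau[OF S _ F(1,2) this, where \<psi> = \<psi> and x = x, OF _ \<psi> \<psi>_part] show ?thesis
        using False by (simp add: p_def)
    qed (simp add: p_def)
    finally show ?thesis .
  qed
  have 1: "neg_log_deriv K (\<Otimes>\<^bsub>power_series K\<^esub>k\<in>F. ?g k) (\<Oplus>\<^bsub>power_series K\<^esub>k\<in>F. p k)"
    by (rule K.neg_log_deriv_finprod[OF F(1) g])
  have 2: "neg_log_deriv K (\<lambda>n. to_rat R (f n)) ?q"
    by (rule neg_log_deriv_hom[OF is_cring rationalization_cring to_rat_hom f(1)])
  have g0: "?g k 0 = \<one>\<^bsub>K\<^esub>" if "k \<in> F" for k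
    using one_minus_power_0[OF tau_closed[where \<psi> = \<psi> and x = x, OF F0[OF that] \<psi>]] .
  have "(\<Otimes>\<^bsub>power_series K\<^esub>k\<in>F. ?g k) 0 = \<one>\<^bsub>K\<^esub>"
    by (rule K.ps_finprod_const_coeff[OF F(1)]) (simp_all only: g0 g[unfolded neg_log_deriv_def])
  then have 3: "(\<Otimes>\<^bsub>power_series K\<^esub>k\<in>F. ?g k) 0 = to_rat R (f 0)" by (simp only: f(2) h.hom_one)
  have 4: "(\<Oplus>\<^bsub>power_series K\<^esub>k\<in>F. p k) 0 = \<zero>\<^bsub>K\<^esub>"
    using sum_p[OF le0] by (simp only: h.hom_zero if_True refl)
  show ?thesis
    by (rule K.neg_log_deriv_unique[OF rationalization_torsion_free 1 2 3 4 sum_p le_refl])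
qed

end

section \<open>Expansion into binomial coefficients\<close>

lemma tuple_weight_superset:
  assumes "finite F" "Poly_Mapping.keys \<nu> \<subseteq> F"
  shows "tuple_weight \<nu> = (\<Sum>k\<in>F. k * Poly_Mapping.lookup \<nu> k)"
  unfolding tuple_weight_def by (rule sum.mono_neutral_left) (use assms in \<open>auto simp: in_keys_iff\<close>)

lemma tuple_size_superset:
  assumes "finite F" "Poly_Mapping.keys \<nu> \<subseteq> F"
  shows "tuple_size \<nu> = (\<Sum>k\<in>F. Poly_Mapping.lookup \<nu> k)"
  unfolding tuple_size_def by (rule sum.mono_neutral_left) (use assms in \<open>auto simp: in_keys_iff\<close>)

definition weighted_tuples :: "nat set \<Rightarrow> nat \<Rightarrow> (nat \<Rightarrow>\<^sub>0 nat) set" where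
  "weighted_tuples F n = {\<nu>. Poly_Mapping.keys \<nu> \<subseteq> F \<and> tuple_weight \<nu> = n}"

text \<open>
  A tuple on \<open>insert k F\<close> is a tuple on \<open>F\<close> together with an entry \<open>j\<close> at \<open>k\<close>, which uses up \<open>k * j\<close> of
  the weight. This mirrors the multiplication by one further factor, whose terms have degrees \<open>k * j\<close>.
\<close>
lemma weighted_tuples_insert:
  assumes F: "finite F" "k \<notin> F"
  shows "weighted_tuples (insert k F) n = (\<Union>j\<in>{j. k * j \<le> n}.
    (\<lambda>\<nu>. \<nu> + Poly_Mapping.single k j) ` weighted_tuples F (n - k * j))"
proof (rule subset_antisym; rule subsetI)
  fix \<mu> assume \<mu>: "\<mu> \<in> weighted_tuples (insert k F) n"
  define j where "j = Poly_Mapping.lookup \<mu> k"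
  define \<nu> where "\<nu> = \<mu> - Poly_Mapping.single k j"
  have eq: "\<mu> = \<nu> + Poly_Mapping.single k j"
    by (rule poly_mapping_eqI) (auto simp: \<nu>_def j_def lookup_add lookup_minus lookup_single when_def)
  have l: "Poly_Mapping.lookup \<nu> i = (if i = k then 0 else Poly_Mapping.lookup \<mu> i)" for i
    by (auto simp: \<nu>_def j_def lookup_minus lookup_single when_def)
  have keys: "Poly_Mapping.keys \<nu> \<subseteq> F"
    using \<mu> by (auto simp: weighted_tuples_def in_keys_iff l subset_iff split: if_splits)
  have "n = k * j + (\<Sum>i\<in>F. i * Poly_Mapping.lookup \<mu> i)"
    using \<mu> F tuple_weight_superset[of "insert k F" \<mu>] by (simp add: weighted_tuples_def j_def)
  also have "(\<Sum>i\<in>F. i * Poly_Mapping.lookup \<mu> i) = tuple_weight \<nu>"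
    unfolding tuple_weight_superset[OF F(1) keys] by (rule sum.cong) (use F(2) in \<open>auto simp: l\<close>)
  finally have "k * j \<le> n" "tuple_weight \<nu> = n - k * j" by auto
  then show "\<mu> \<in> (\<Union>j\<in>{j. k * j \<le> n}. (\<lambda>\<nu>. \<nu> + Poly_Mapping.single k j) ` weighted_tuples F (n - k * j))"
    using keys eq by (auto simp: weighted_tuples_def)
next
  fix \<mu> assume "\<mu> \<in> (\<Union>j\<in>{j. k * j \<le> n}. (\<lambda>\<nu>. \<nu> + Poly_Mapping.single k j) ` weighted_tuples F (n - k * j))"
  then obtain j \<nu> where j: "k * j \<le> n" and \<nu>: "Poly_Mapping.keys \<nu> \<subseteq> F" "tuple_weight \<nu> = n - k * j"
    and \<mu>: "\<mu> = \<nu> + Poly_Mapping.single k j" by (auto simp: weighted_tuples_def)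
  have l: "Poly_Mapping.lookup \<mu> i = (if i = k then j else Poly_Mapping.lookup \<nu> i)" for i
    using F(2) \<nu>(1) by (auto simp: \<mu> lookup_add lookup_single when_def in_keys_iff)
  have keys: "Poly_Mapping.keys \<mu> \<subseteq> insert k F"
    using \<nu>(1) by (auto simp: in_keys_iff l subset_iff split: if_splits)
  have "tuple_weight \<mu> = k * j + (\<Sum>i\<in>F. i * Poly_Mapping.lookup \<mu> i)"
    using keys F by (simp add: tuple_weight_superset[of "insert k F"] l)
  also have "(\<Sum>i\<in>F. i * Poly_Mapping.lookup \<mu> i) = tuple_weight \<nu>"
    unfolding tuple_weight_superset[OF F(1) \<nu>(1)] by (rule sum.cong) (use F(2) in \<open>auto simp: l\<close>)
  finally show "\<mu> \<in> weighted_tuples (insert k F) n" using keys \<nu> j by (simp add: weighted_tuples_def)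
qed

lemma weighted_tuples_empty: "weighted_tuples {} n = (if n = 0 then {0} else {})"
  by (auto simp: weighted_tuples_def tuple_weight_def)

lemma finite_mult_le: "k > 0 \<Longrightarrow> finite {j. k * j \<le> (n::nat)}"
  by (rule finite_subset[of _ "{..n}"]) (auto intro: order_trans[rotated])

lemma finite_weighted_tuples:
  assumes "finite F" "0 \<notin> F"
  shows "finite (weighted_tuples F n)"
  using assms
proof (induction F arbitrary: n rule: finite_induct)
  case empty
  then show ?case by (simp add: weighted_tuples_empty)
next
  case (insert k F)
  then show ?case unfolding weighted_tuples_insert[OF insert(1,2)]
    by (intro finite_UN_I finite_mult_le finite_imageI) auto
qed

lemma weighted_tuples_restrict:
  assumes "0 \<notin> S"
  shows "weighted_tuples S n = weighted_tuples (S \<inter> {..n}) n"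
proof -
  have "k \<le> tuple_weight \<nu>" if "k \<in> Poly_Mapping.keys \<nu>" for k and \<nu> :: "nat \<Rightarrow>\<^sub>0 nat"
  proof -
    have "k \<le> k * Poly_Mapping.lookup \<nu> k" using that by (simp add: in_keys_iff)
    also have "\<dots> \<le> tuple_weight \<nu>" unfolding tuple_weight_def
      by (rule member_le_sum) (use that in auto)
    finally show ?thesis .
  qed
  then show ?thesis by (auto simp: weighted_tuples_def)
qed

lemma (in cring) finprod_sign:
  assumes "finite F" "\<And>k. k \<in> F \<Longrightarrow> b k \<in> carrier R"
  shows "[((- 1) ^ (\<Sum>k\<in>F. l k) :: int)] \<cdot> (\<Otimes>k\<in>F. b k) = (\<Otimes>k\<in>F. [((- 1) ^ l k :: int)] \<cdot> b k)"
  using assms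
proof (induction F rule: finite_induct)
  case (insert k F)
  have c: "(\<Otimes>k\<in>F. b k) \<in> carrier R" "b k \<in> carrier R" using insert by (auto intro: finprod_closed)
  have "[((- 1) ^ (\<Sum>k\<in>insert k F. l k) :: int)] \<cdot> (\<Otimes>k\<in>insert k F. b k)
    = [((- 1) ^ (l k + (\<Sum>k\<in>F. l k)) :: int)] \<cdot> (b k \<otimes> (\<Otimes>k\<in>F. b k))"
    using insert by simp
  also have "\<dots> = ([((- 1) ^ l k :: int)] \<cdot> b k) \<otimes> ([((- 1) ^ (\<Sum>k\<in>F. l k) :: int)] \<cdot> (\<Otimes>k\<in>F. b k))"
    using c by (simp only: sign_int_mult m_closed even_add) (auto simp: l_minus r_minus)
  also have "\<dots> = (\<Otimes>k\<in>insert k F. [((- 1) ^ l k :: int)] \<cdot> b k)" using insert by simp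
  finally show ?case .
qed (simp add: add.int_pow_1)

context torsion_free_cring
begin

lemma signed_binom_tuple_superset:
  assumes F: "finite F" "Poly_Mapping.keys \<nu> \<subseteq> F" and y: "\<And>k. k \<in> F \<Longrightarrow> y k \<in> carrier K"
  shows "[((- 1) ^ tuple_size \<nu> :: int)] \<cdot>\<^bsub>K\<^esub> binom_tuple K y \<nu>
    = (\<Otimes>\<^bsub>K\<^esub>k\<in>F. [((- 1) ^ Poly_Mapping.lookup \<nu> k :: int)] \<cdot>\<^bsub>K\<^esub> binom K (y k) (Poly_Mapping.lookup \<nu> k))"
proof -
  interpret K: cring K by (rule rationalization_cring)
  have "binom_tuple K y \<nu> = (\<Otimes>\<^bsub>K\<^esub>k\<in>F. binom K (y k) (Poly_Mapping.lookup \<nu> k))"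
    unfolding binom_tuple_def
    by (rule K.finprod_mono_neutral_cong_left)
      (use F y in \<open>auto simp: binom_closed binom_0 in_keys_iff\<close>)
  then show ?thesis unfolding tuple_size_superset[OF F]
    using K.finprod_sign[OF F(1)] y by (simp add: binom_closed)
qed

text \<open>
  By induction on \<open>F\<close>. The summand of a tuple \<open>\<nu>\<close> is the product over \<open>k \<in> F\<close> of the coefficients of
  \<open>t ^ (k * \<nu>\<^sub>k)\<close> in \<open>(1 - t ^ k) ^ y\<^sub>k\<close>, so multiplication by the term of degree \<open>k * j\<close> of a new factor extends
  the tuple by the entry \<open>j\<close> at \<open>k\<close>.
\<close>
lemma finite_product_expansion:
  assumes "finite F" "0 \<notin> F" "\<And>k. k \<in> F \<Longrightarrow> y k \<in> carrier K"
  shows "(\<Otimes>\<^bsub>power_series K\<^esub>k\<in>F. one_minus_power K k (y k)) n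
    = (\<Oplus>\<^bsub>K\<^esub>\<nu>\<in>weighted_tuples F n. [((- 1) ^ tuple_size \<nu> :: int)] \<cdot>\<^bsub>K\<^esub> binom_tuple K y \<nu>)"
  using assms
proof (induction F arbitrary: n rule: finite_induct)
  case empty
  interpret K: cring K by (rule rationalization_cring)
  interpret P: cring "power_series K" by (rule K.power_series_cring)
  show ?case by (simp add: weighted_tuples_empty tuple_size_def binom_tuple_def K.add.int_pow_1)
next
  case (insert k F)
  interpret K: cring K by (rule rationalization_cring)
  interpret P: cring "power_series K" by (rule K.power_series_cring)
  let ?h = "\<lambda>\<nu>. [((- 1) ^ tuple_size \<nu> :: int)] \<cdot>\<^bsub>K\<^esub> binom_tuple K y \<nu>"
  let ?g = "\<lambda>k. one_minus_power K k (y k)"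
  let ?G = "\<Otimes>\<^bsub>power_series K\<^esub>k\<in>F. ?g k"
  let ?c = "\<lambda>j. [((- 1) ^ j :: int)] \<cdot>\<^bsub>K\<^esub> binom K (y k) j"
  let ?J = "{j. k * j \<le> n}"
  have k: "k > 0" and F0: "0 \<notin> F" using insert by auto
  have yF: "\<And>i. i \<in> F \<Longrightarrow> y i \<in> carrier K" and yk: "y k \<in> carrier K" using insert by auto
  have gc: "?g i \<in> carrier (power_series K)" if "y i \<in> carrier K" for i
    using that by (auto simp: ps_carrier_iff one_minus_power_def binom_closed)
  have Gc: "?G \<in> carrier (power_series K)" using gc yF by (intro P.finprod_closed) auto
  have gi: "?g k i \<in> carrier K" "?G i \<in> carrier K" for i
    using gc[OF yk] Gc by (auto simp: ps_carrier_iff)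
  have cc: "?c j \<in> carrier K" for j using yk by (simp add: binom_closed)
  have J: "finite ?J" using k by (rule finite_mult_le)
  have hc: "?h \<nu> \<in> carrier K" if "\<nu> \<in> weighted_tuples (insert k F) m" for \<nu> m
  proof -
    have keys: "Poly_Mapping.keys \<nu> \<subseteq> insert k F" using that by (simp add: weighted_tuples_def)
    have fin: "finite (insert k F)" using insert(1) by simp
    have eq: "?h \<nu> = (\<Otimes>\<^bsub>K\<^esub>i\<in>insert k F. [((- 1) ^ Poly_Mapping.lookup \<nu> i :: int)] \<cdot>\<^bsub>K\<^esub> binom K (y i) (Poly_Mapping.lookup \<nu> i))"
      by (rule signed_binom_tuple_superset[OF fin keys insert(5)])
    show ?thesis unfolding eq by (intro K.finprod_closed) (use insert(5) in \<open>auto simp: binom_closed\<close>)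
  qed
  have sub: "weighted_tuples F m \<subseteq> weighted_tuples (insert k F) m" for m
    by (auto simp: weighted_tuples_def)
  have add: "?h (\<nu> + Poly_Mapping.single k j) = ?c j \<otimes>\<^bsub>K\<^esub> ?h \<nu>" if "\<nu> \<in> weighted_tuples F m" for \<nu> j m
  proof -
    let ?\<mu> = "\<nu> + Poly_Mapping.single k j"
    have keys: "Poly_Mapping.keys \<nu> \<subseteq> F" using that by (simp add: weighted_tuples_def)
    have l: "Poly_Mapping.lookup ?\<mu> i = (if i = k then j else Poly_Mapping.lookup \<nu> i)" for i
      using insert(2) keys by (auto simp: lookup_add lookup_single when_def in_keys_iff)
    have keys': "Poly_Mapping.keys ?\<mu> \<subseteq> insert k F"
      using keys by (auto simp: in_keys_iff l subset_iff split: if_splits)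
    have "?h ?\<mu> = (\<Otimes>\<^bsub>K\<^esub>i\<in>insert k F. [((- 1) ^ Poly_Mapping.lookup ?\<mu> i :: int)] \<cdot>\<^bsub>K\<^esub> binom K (y i) (Poly_Mapping.lookup ?\<mu> i))"
      by (rule signed_binom_tuple_superset[OF _ keys' insert(5)]) (use insert in auto)
    also have "\<dots> = ?c j \<otimes>\<^bsub>K\<^esub> (\<Otimes>\<^bsub>K\<^esub>i\<in>F. [((- 1) ^ Poly_Mapping.lookup ?\<mu> i :: int)] \<cdot>\<^bsub>K\<^esub> binom K (y i) (Poly_Mapping.lookup ?\<mu> i))"
      using insert yF yk by (subst K.finprod_insert) (auto simp: binom_closed l)
    also have "(\<Otimes>\<^bsub>K\<^esub>i\<in>F. [((- 1) ^ Poly_Mapping.lookup ?\<mu> i :: int)] \<cdot>\<^bsub>K\<^esub> binom K (y i) (Poly_Mapping.lookup ?\<mu> i))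
      = (\<Otimes>\<^bsub>K\<^esub>i\<in>F. [((- 1) ^ Poly_Mapping.lookup \<nu> i :: int)] \<cdot>\<^bsub>K\<^esub> binom K (y i) (Poly_Mapping.lookup \<nu> i))"
      by (rule K.finprod_cong') (use insert(2) yF in \<open>auto simp: l binom_closed\<close>)
    also have "\<dots> = ?h \<nu>" by (rule signed_binom_tuple_superset[symmetric, OF insert(1) keys yF])
    finally show ?thesis .
  qed
  have "(\<Otimes>\<^bsub>power_series K\<^esub>k\<in>insert k F. ?g k) n = (?g k \<otimes>\<^bsub>power_series K\<^esub> ?G) n"
    using insert gc yF yk by (subst P.finprod_insert) auto
  also have "\<dots> = (\<Oplus>\<^bsub>K\<^esub>i\<in>{..n}. ?g k i \<otimes>\<^bsub>K\<^esub> ?G (n - i))" by simp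
  also have "\<dots> = (\<Oplus>\<^bsub>K\<^esub>i\<in>(*) k ` ?J. ?g k i \<otimes>\<^bsub>K\<^esub> ?G (n - i))"
  proof (rule K.add.finprod_mono_neutral_cong_right)
    fix i assume i: "i \<in> {..n} - (*) k ` ?J"
    then have "\<not> k dvd i" by auto
    then show "?g k i \<otimes>\<^bsub>K\<^esub> ?G (n - i) = \<zero>\<^bsub>K\<^esub>" using gi(2) by (simp add: one_minus_power_def)
  qed (use gi in auto)
  also have "\<dots> = (\<Oplus>\<^bsub>K\<^esub>j\<in>?J. ?g k (k * j) \<otimes>\<^bsub>K\<^esub> ?G (n - k * j))"
    by (rule K.finsum_reindex) (use gi k in \<open>auto simp: inj_on_def\<close>)
  also have "\<dots> = (\<Oplus>\<^bsub>K\<^esub>j\<in>?J. \<Oplus>\<^bsub>K\<^esub>\<mu>\<in>(\<lambda>\<nu>. \<nu> + Poly_Mapping.single k j) ` weighted_tuples F (n - k * j). ?h \<mu>)"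
  proof (rule K.finsum_cong')
    fix j assume "j \<in> ?J"
    have "?g k (k * j) \<otimes>\<^bsub>K\<^esub> ?G (n - k * j) = ?c j \<otimes>\<^bsub>K\<^esub> (\<Oplus>\<^bsub>K\<^esub>\<nu>\<in>weighted_tuples F (n - k * j). ?h \<nu>)"
      using k insert(3)[OF F0 yF] by (simp add: one_minus_power_def)
    also have "\<dots> = (\<Oplus>\<^bsub>K\<^esub>\<nu>\<in>weighted_tuples F (n - k * j). ?c j \<otimes>\<^bsub>K\<^esub> ?h \<nu>)"
      by (rule K.finsum_rdistr[OF finite_weighted_tuples[OF insert(1) F0] cc]) (use hc sub in blast)
    also have "\<dots> = (\<Oplus>\<^bsub>K\<^esub>\<nu>\<in>weighted_tuples F (n - k * j). ?h (\<nu> + Poly_Mapping.single k j))"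
    proof (rule K.finsum_cong')
      show "(\<lambda>\<nu>. ?h (\<nu> + Poly_Mapping.single k j)) \<in> weighted_tuples F (n - k * j) \<rightarrow> carrier K"
      proof
        fix \<nu> assume \<nu>: "\<nu> \<in> weighted_tuples F (n - k * j)"
        then show "?h (\<nu> + Poly_Mapping.single k j) \<in> carrier K"
          unfolding add[OF \<nu>] using hc sub cc by (intro K.m_closed) blast+
      qed
      show "?c j \<otimes>\<^bsub>K\<^esub> ?h \<nu> = ?h (\<nu> + Poly_Mapping.single k j)" if "\<nu> \<in> weighted_tuples F (n - k * j)" for \<nu>
        by (rule add[OF that, symmetric])
    qed simp
    also have "\<dots> = (\<Oplus>\<^bsub>K\<^esub>\<mu>\<in>(\<lambda>\<nu>. \<nu> + Poly_Mapping.single k j) ` weighted_tuples F (n - k * j). ?h \<mu>)"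
    proof (rule K.finsum_reindex[symmetric])
      show "?h \<in> (\<lambda>\<nu>. \<nu> + Poly_Mapping.single k j) ` weighted_tuples F (n - k * j) \<rightarrow> carrier K"
      proof
        fix \<mu> assume "\<mu> \<in> (\<lambda>\<nu>. \<nu> + Poly_Mapping.single k j) ` weighted_tuples F (n - k * j)"
        then obtain \<nu> where \<nu>: "\<nu> \<in> weighted_tuples F (n - k * j)" "\<mu> = \<nu> + Poly_Mapping.single k j" by auto
        show "?h \<mu> \<in> carrier K"
          unfolding \<nu>(2) add[OF \<nu>(1)] using hc sub cc \<nu>(1) by (intro K.m_closed) blast+
      qed
    qed (auto simp: inj_on_def)
    finally show "?g k (k * j) \<otimes>\<^bsub>K\<^esub> ?G (n - k * j)
      = (\<Oplus>\<^bsub>K\<^esub>\<mu>\<in>(\<lambda>\<nu>. \<nu> + Poly_Mapping.single k j) ` weighted_tuples F (n - k * j). ?h \<mu>)" .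
  next
    show "(\<lambda>j. \<Oplus>\<^bsub>K\<^esub>\<mu>\<in>(\<lambda>\<nu>. \<nu> + Poly_Mapping.single k j) ` weighted_tuples F (n - k * j). ?h \<mu>) \<in> ?J \<rightarrow> carrier K"
    proof
      fix j assume j: "j \<in> ?J"
      show "(\<Oplus>\<^bsub>K\<^esub>\<mu>\<in>(\<lambda>\<nu>. \<nu> + Poly_Mapping.single k j) ` weighted_tuples F (n - k * j). ?h \<mu>) \<in> carrier K"
        by (intro K.finsum_closed Pi_I hc[of _ n], unfold weighted_tuples_insert[OF insert(1,2)], rule UN_I, rule j)
    qed
  qed simp
  also have "\<dots> = (\<Oplus>\<^bsub>K\<^esub>\<mu>\<in>weighted_tuples (insert k F) n. ?h \<mu>)"
    unfolding weighted_tuples_insert[OF insert(1,2)]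
  proof (rule K.add.finprod_UN_disjoint[symmetric, OF J])
    show "finite ((\<lambda>\<nu>. \<nu> + Poly_Mapping.single k j) ` weighted_tuples F (n - k * j))" for j
      by (intro finite_imageI finite_weighted_tuples insert F0)
    have lk: "Poly_Mapping.lookup \<mu> k = j" if "\<mu> \<in> (\<lambda>\<nu>. \<nu> + Poly_Mapping.single k j) ` weighted_tuples F m" for \<mu> j m
      using that insert(2) by (auto simp: weighted_tuples_def lookup_add in_keys_iff)
    show "pairwise (\<lambda>i j. disjnt ((\<lambda>\<nu>. \<nu> + Poly_Mapping.single k i) ` weighted_tuples F (n - k * i))
        ((\<lambda>\<nu>. \<nu> + Poly_Mapping.single k j) ` weighted_tuples F (n - k * j))) ?J"
    proof (rule pairwiseI)
      fix i j :: nat assume "i \<noteq> j"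
      then have False
        if "\<mu> \<in> (\<lambda>\<nu>. \<nu> + Poly_Mapping.single k i) ` weighted_tuples F (n - k * i)"
          "\<mu> \<in> (\<lambda>\<nu>. \<nu> + Poly_Mapping.single k j) ` weighted_tuples F (n - k * j)" for \<mu>
        using lk[OF that(1)] lk[OF that(2)] by simp
      then show "disjnt ((\<lambda>\<nu>. \<nu> + Poly_Mapping.single k i) ` weighted_tuples F (n - k * i))
        ((\<lambda>\<nu>. \<nu> + Poly_Mapping.single k j) ` weighted_tuples F (n - k * j))"
        unfolding disjnt_iff by (intro allI notI) (elim conjE)
    qed
    show "?h \<mu> \<in> carrier K" if "j \<in> ?J" "\<mu> \<in> (\<lambda>\<nu>. \<nu> + Poly_Mapping.single k j) ` weighted_tuples F (n - k * j)" for j \<mu>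
      by (rule hc[of _ n], unfold weighted_tuples_insert[OF insert(1,2)], rule UN_I, rule that(1), rule that(2))
  qed
  finally show ?case .
qed

end

section \<open>Factorization by the components of a Witt vector\<close>

lemma Z_algebra_nat_mult:
  assumes alg: "algebra (Z_ring S) B" and r: "r \<in> carrier (Z_ring S)" and x: "x \<in> carrier B"
  shows "[(n::nat)] \<cdot>\<^bsub>B\<^esub> (r \<odot>\<^bsub>B\<^esub> x) = (of_nat n * r) \<odot>\<^bsub>B\<^esub> x"
proof -
  interpret algebra "Z_ring S" B by (rule alg)
  have rx: "r \<odot>\<^bsub>B\<^esub> x \<in> carrier B" using r x by simp
  show ?thesis
  proof (induction n)
    case 0
    show ?case using smult_l_null[OF x] by simp
  next
    case (Suc n)
    have nr: "of_nat n * r \<in> carrier (Z_ring S)"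
      using Z_ring_mult[OF Z_ring_of_int[of "int n"] r] by simp
    have "[Suc n] \<cdot>\<^bsub>B\<^esub> (r \<odot>\<^bsub>B\<^esub> x) = (of_nat n * r) \<odot>\<^bsub>B\<^esub> x \<oplus>\<^bsub>B\<^esub> r \<odot>\<^bsub>B\<^esub> x"
      using rx Suc by simp
    also have "\<dots> = (of_nat n * r + r) \<odot>\<^bsub>B\<^esub> x" using smult_l_distr[OF nr r x] by simp
    finally show ?case by (simp add: algebra_simps)
  qed
qed

lemma Z_algebra_of_int:
  assumes alg: "algebra (Z_ring S) B"
  shows "of_int z \<odot>\<^bsub>B\<^esub> \<one>\<^bsub>B\<^esub> = [z] \<cdot>\<^bsub>B\<^esub> \<one>\<^bsub>B\<^esub>"
proof -
  interpret algebra "Z_ring S" B by (rule alg)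
  have one: "1 \<odot>\<^bsub>B\<^esub> \<one>\<^bsub>B\<^esub> = \<one>\<^bsub>B\<^esub>" using smult_one[of "\<one>\<^bsub>B\<^esub>"] by simp
  have nat: "of_nat n \<odot>\<^bsub>B\<^esub> \<one>\<^bsub>B\<^esub> = [n] \<cdot>\<^bsub>B\<^esub> \<one>\<^bsub>B\<^esub>" for n :: nat
    using Z_algebra_nat_mult[OF alg Z_ring_one, of "\<one>\<^bsub>B\<^esub>" n] one by simp
  show ?thesis
  proof (cases "z \<ge> 0")
    case True
    then show ?thesis using nat[of "nat z"] by (simp add: add_pow_int_ge)
  next
    case False
    let ?n = "nat (- z)"
    have z: "of_int z = - (of_nat ?n :: rat)" using False by simp
    have nc: "of_nat ?n \<in> carrier (Z_ring S)" using Z_ring_of_int[of "int ?n" S] by (simp only: of_int_of_nat_eq)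
    have "(- of_nat ?n) \<odot>\<^bsub>B\<^esub> \<one>\<^bsub>B\<^esub> \<oplus>\<^bsub>B\<^esub> of_nat ?n \<odot>\<^bsub>B\<^esub> \<one>\<^bsub>B\<^esub> = \<zero>\<^bsub>B\<^esub>"
      using smult_l_distr[OF Z_ring_uminus[OF nc] nc, of "\<one>\<^bsub>B\<^esub>"] smult_l_null[of "\<one>\<^bsub>B\<^esub>"] by simp
    then have "(- of_nat ?n) \<odot>\<^bsub>B\<^esub> \<one>\<^bsub>B\<^esub> = \<ominus>\<^bsub>B\<^esub> (of_nat ?n \<odot>\<^bsub>B\<^esub> \<one>\<^bsub>B\<^esub>)"
      using nc Z_ring_uminus[OF nc] by (intro minus_equality[symmetric]) auto
    then show ?thesis using False unfolding z nat by (simp add: add_pow_int_lt)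
  qed
qed

text \<open>
  The exponent \<open>q\<close> lies in \<open>\<int>\<^sub>S\<close> and so do its binomial coefficients. So the coefficients of
  \<open>(1 - e t) ^ q\<close> make sense in every \<open>\<int>\<^sub>S\<close>-algebra, without passing to the rationalization.
\<close>
lemma Z_algebra_gbinomial_rec:
  assumes alg: "algebra (Z_ring S) B" and m: "m \<in> coprime_to S"
    and q: "q = of_int z / of_nat m"
  shows "[Suc j] \<cdot>\<^bsub>B\<^esub> ((q gchoose Suc j) \<odot>\<^bsub>B\<^esub> \<one>\<^bsub>B\<^esub>)
    = (q \<odot>\<^bsub>B\<^esub> \<one>\<^bsub>B\<^esub> \<ominus>\<^bsub>B\<^esub> [j] \<cdot>\<^bsub>B\<^esub> \<one>\<^bsub>B\<^esub>) \<otimes>\<^bsub>B\<^esub> ((q gchoose j) \<odot>\<^bsub>B\<^esub> \<one>\<^bsub>B\<^esub>)"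
proof -
  interpret algebra "Z_ring S" B by (rule alg)
  have gc: "(q gchoose i) \<in> carrier (Z_ring S)" for i unfolding q by (rule Z_ring_gbinomial[OF m])
  have qc: "q \<in> carrier (Z_ring S)" using gc[of 1] by simp
  have jc: "of_nat j \<in> carrier (Z_ring S)" using Z_ring_of_int[of "int j" S] by simp
  have dc: "q - of_nat j \<in> carrier (Z_ring S)" using Z_ring_add[OF qc Z_ring_uminus[OF jc]] by simp
  have j1: "[j] \<cdot>\<^bsub>B\<^esub> \<one>\<^bsub>B\<^esub> = of_nat j \<odot>\<^bsub>B\<^esub> \<one>\<^bsub>B\<^esub>"
    using Z_algebra_of_int[OF alg, of "int j"] by (simp add: add_pow_int_ge)
  have "q \<odot>\<^bsub>B\<^esub> \<one>\<^bsub>B\<^esub> = (q - of_nat j) \<odot>\<^bsub>B\<^esub> \<one>\<^bsub>B\<^esub> \<oplus>\<^bsub>B\<^esub> of_nat j \<odot>\<^bsub>B\<^esub> \<one>\<^bsub>B\<^esub>"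
    using smult_l_distr[OF dc jc, of "\<one>\<^bsub>B\<^esub>"] by simp
  then have d: "q \<odot>\<^bsub>B\<^esub> \<one>\<^bsub>B\<^esub> \<ominus>\<^bsub>B\<^esub> [j] \<cdot>\<^bsub>B\<^esub> \<one>\<^bsub>B\<^esub> = (q - of_nat j) \<odot>\<^bsub>B\<^esub> \<one>\<^bsub>B\<^esub>"
    unfolding j1 using smult_closed[OF dc one_closed] smult_closed[OF jc one_closed]
    by (simp add: a_minus_def a_assoc r_neg)
  have "(q - of_nat j) \<odot>\<^bsub>B\<^esub> \<one>\<^bsub>B\<^esub> \<otimes>\<^bsub>B\<^esub> ((q gchoose j) \<odot>\<^bsub>B\<^esub> \<one>\<^bsub>B\<^esub>)
    = ((q - of_nat j) * (q gchoose j)) \<odot>\<^bsub>B\<^esub> \<one>\<^bsub>B\<^esub>"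
    using smult_assoc2[OF dc one_closed smult_closed[OF gc one_closed]] smult_closed[OF gc one_closed]
      smult_assoc1[OF dc gc one_closed] by simp
  also have "(q - of_nat j) * (q gchoose j) = of_nat (Suc j) * (q gchoose Suc j)"
    using gbinomial_mult_1[of q j] by (simp add: algebra_simps)
  also have "\<dots> \<odot>\<^bsub>B\<^esub> \<one>\<^bsub>B\<^esub> = [Suc j] \<cdot>\<^bsub>B\<^esub> ((q gchoose Suc j) \<odot>\<^bsub>B\<^esub> \<one>\<^bsub>B\<^esub>)"
    by (rule Z_algebra_nat_mult[OF alg gc one_closed, symmetric])
  finally show ?thesis unfolding d ..
qed

text \<open>
  The indices of the factors that contribute to the coefficients up to \<open>t ^ n\<close>.
\<close>
definition witt_factor_indices :: "nat set \<Rightarrow> nat \<Rightarrow> (nat \<times> nat \<times> nat) set" where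
  "witt_factor_indices S n = {(d, m, m'). d \<in> S \<and> m \<in> coprime_to S \<and> m' \<in> coprime_to S \<and> d * m * m' \<le> n}"

lemma finite_witt_factor_indices:
  assumes "0 \<notin> S"
  shows "finite (witt_factor_indices S n)"
proof (rule finite_subset)
  show "witt_factor_indices S n \<subseteq> {..n} \<times> {..n} \<times> {..n}"
  proof (rule subsetI)
    fix t assume "t \<in> witt_factor_indices S n"
    then obtain d m m' where t: "t = (d, m, m')" "d \<in> S" "m \<in> coprime_to S" "m' \<in> coprime_to S" "d * m * m' \<le> n"
      by (auto simp: witt_factor_indices_def)
    have pos: "d > 0" "m > 0" "m' > 0" using t assms by (auto simp: coprime_to_def intro: gr0I)
    have "d \<le> n" "m \<le> n" "m' \<le> n" by (rule le_trans[OF _ t(5)], use pos in simp)+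
    then show "t \<in> {..n} \<times> {..n} \<times> {..n}" using t by simp
  qed
qed simp

text \<open>
  The coefficient of \<open>a\<^sub>d ^ j\<close> in the sum of the negative logarithmic derivatives of all factors, in degree
  \<open>i\<close>.
  Here \<open>d\<close>, \<open>j\<close> and \<open>i\<close> determine \<open>m = i / (d * j)\<close>, and summing \<open>\<mu>(m')\<close> over the divisors \<open>m'\<close> of \<open>j\<close>
  that are prime to \<open>S\<close> leaves only the \<open>j\<close> in \<open>S\<close>. Then \<open>d * j\<close> lies in \<open>S\<close> and \<open>m\<close> is prime to \<open>S\<close>, so
  \<open>d * j\<close> is the \<open>S\<close>-part of \<open>i\<close>.
\<close>
lemma sum_moebius_witt_factor:
  assumes S: "divisor_stable S" "mult_closed S" and i: "i = s * m\<^sub>0" "s \<in> S" "m\<^sub>0 \<in> coprime_to S" "i \<le> n"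
    and d: "d \<in> S" and j: "j > 0"
  shows "(\<Sum>(d', m, m')\<in>witt_factor_indices S n.
      if d = d' \<and> d' * m * m' dvd i \<and> j = i div (d' * m) then int d' * moebius m' else 0)
    = (if d * j = s then int d else 0)"
proof -
  let ?T = "witt_factor_indices S n"
  have S0: "0 \<notin> S" using S(1) by (simp add: divisor_stable_def)
  have pos: "d > 0" "s > 0" "m\<^sub>0 > 0" using S0 d i by (auto simp: coprime_to_def intro: gr0I)
  then have i0: "i > 0" using i by simp
  let ?C = "\<lambda>(d', m, m'). d = d' \<and> d' * m * m' dvd i \<and> j = i div (d' * m)"
  have "(\<Sum>(d', m, m')\<in>?T. if d = d' \<and> d' * m * m' dvd i \<and> j = i div (d' * m) then int d' * moebius m' else 0)
    = (\<Sum>t\<in>{t\<in>?T. ?C t}. case t of (d', m, m') \<Rightarrow> int d * moebius m')"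
    by (subst sum.inter_filter[OF finite_witt_factor_indices[OF S0]]) (auto intro!: sum.cong)
  also have "\<dots> = (if d * j = s then int d else 0)"
  proof (cases "d * j dvd i \<and> i div (d * j) \<in> coprime_to S")
    case False
    have "{t\<in>?T. ?C t} = {}"
    proof -
      have "d * j dvd i \<and> i div (d * j) \<in> coprime_to S"
        if "m \<in> coprime_to S" "d * m * m' dvd i" "j = i div (d * m)" for m m'
      proof -
        have "d * m dvd i" using that(2) dvd_mult_left by blast
        then have "i = d * j * m" using that(3) by (simp add: mult_ac) (metis dvd_mult_div_cancel mult.assoc mult.commute)
        then show ?thesis using that(1) pos(1) j by simp
      qed
      then show ?thesis using False by (auto simp: witt_factor_indices_def)
    qed
    moreover have "d * j \<noteq> s" using False i pos by auto
    ultimately show ?thesis by (simp only: sum.empty if_False)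
  next
    case True
    define m where "m = i div (d * j)"
    have m: "i = d * m * j" "m \<in> coprime_to S" using True by (auto simp: m_def)
    have m0: "m > 0" using m(2) by (simp add: coprime_to_def)
    have "{t\<in>?T. ?C t} = (\<lambda>m'. (d, m, m')) ` {m'. m' dvd j \<and> m' \<in> coprime_to S}"
    proof (rule subset_antisym; rule subsetI)
      fix t assume "t \<in> {t\<in>?T. ?C t}"
      then obtain m1 m' where t: "t = (d, m1, m')" "m1 \<in> coprime_to S" "m' \<in> coprime_to S"
        "d * m1 * m' dvd i" "j = i div (d * m1)" by (auto simp: witt_factor_indices_def)
      have "d * m1 dvd i" using t(4) dvd_mult_left by blast
      then have "i = d * m1 * j" using t(5) by simp
      then have "m1 = m" using m(1) pos(1) j by simp
      then have "m' dvd j" using t(4) m(1) pos(1) m0 by simp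
      then show "t \<in> (\<lambda>m'. (d, m, m')) ` {m'. m' dvd j \<and> m' \<in> coprime_to S}"
        using t \<open>m1 = m\<close> by auto
    next
      fix t assume "t \<in> (\<lambda>m'. (d, m, m')) ` {m'. m' dvd j \<and> m' \<in> coprime_to S}"
      then obtain m' where t: "t = (d, m, m')" "m' dvd j" "m' \<in> coprime_to S" by auto
      have "d * m * m' dvd i" using t(2) by (simp add: m(1))
      moreover from this have "d * m * m' \<le> n" using i0 i(4) by (auto dest: dvd_imp_le)
      moreover have "j = i div (d * m)" using m(1) pos(1) m0 by simp
      ultimately show "t \<in> {t\<in>?T. ?C t}" using t d m(2) by (auto simp: witt_factor_indices_def)
    qed
    then have "(\<Sum>t\<in>{t\<in>?T. ?C t}. case t of (d', m, m') \<Rightarrow> int d * moebius m')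
      = int d * (\<Sum>m' | m' dvd j \<and> m' \<in> coprime_to S. moebius m')"
      by (simp add: sum.reindex inj_on_def sum_distrib_left)
    also have "\<dots> = (if j \<in> S then int d else 0)" using moebius_sum_coprime_to[OF S j] by simp
    also have "j \<in> S \<longleftrightarrow> d * j = s"
    proof
      assume "j \<in> S"
      then have "d * j \<in> S" using d S(2) by (auto simp: mult_closed_def)
      then show "d * j = s"
        using coprime_to_part_unique(1)[OF S(1) _ m(2) i(2,3), of "d * j"] m(1) i(1) by (simp add: mult_ac)
    next
      assume "d * j = s"
      then show "j \<in> S" using i(2) S(1) by (auto simp: divisor_stable_def)
    qed
    finally show ?thesis .
  qed
  finally show ?thesis .
qed

text \<open>
  The series \<open>(1 - a\<^sub>d ^ m' * t ^ (d * m * m')) ^ (\<mu>(m') / (m * m'))\<close>. For fixed \<open>d\<close> the product over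
  \<open>m\<close> and \<open>m'\<close> is the exponential of \<open>- \<Sum>\<^sub>n a\<^sub>d ^ n\<^sub>S * t ^ (d * n) / n\<close>, where \<open>n\<^sub>S\<close> is the \<open>S\<close>-part of
  \<open>n\<close>: an analogue of the Artin-Hasse exponential.
\<close>
definition witt_factor :: "(rat, 'b, 'm) module_scheme \<Rightarrow> (nat \<Rightarrow> 'b) \<Rightarrow> nat \<times> nat \<times> nat \<Rightarrow> nat \<Rightarrow> 'b" where
  "witt_factor B a = (\<lambda>(d, m, m'). ps_stretch B (d * m * m')
     (\<lambda>j. ([((- 1) ^ j :: int)] \<cdot>\<^bsub>B\<^esub> (((of_int (moebius m') / of_nat (m * m')) gchoose j) \<odot>\<^bsub>B\<^esub> \<one>\<^bsub>B\<^esub>))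
       \<otimes>\<^bsub>B\<^esub> (a d [^]\<^bsub>B\<^esub> m') [^]\<^bsub>B\<^esub> j))"

lemma neg_log_deriv_witt_factor:
  assumes alg: "algebra (Z_ring S) B" and S0: "0 \<notin> S"
    and d: "d \<in> S" and m: "m \<in> coprime_to S" "m' \<in> coprime_to S" and ad: "a d \<in> carrier B"
  shows "neg_log_deriv B (witt_factor B a (d, m, m'))
    (\<lambda>i. if i > 0 \<and> d * m * m' dvd i then [(int d * moebius m')] \<cdot>\<^bsub>B\<^esub> (a d [^]\<^bsub>B\<^esub> (i div (d * m))) else \<zero>\<^bsub>B\<^esub>)"
    and "witt_factor B a (d, m, m') 0 = \<one>\<^bsub>B\<^esub>"
proof -
  interpret algebra "Z_ring S" B by (rule alg)
  define q where "q = rat_of_int (moebius m') / of_nat (m * m')"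
  let ?y = "q \<odot>\<^bsub>B\<^esub> \<one>\<^bsub>B\<^esub>" and ?e = "a d [^]\<^bsub>B\<^esub> m'" and ?l = "d * m * m'"
  let ?b = "\<lambda>j. (q gchoose j) \<odot>\<^bsub>B\<^esub> \<one>\<^bsub>B\<^esub>"
  have mm: "m * m' \<in> coprime_to S" by (rule coprime_to_mult[OF m])
  have pos: "d > 0" "m > 0" "m' > 0" using S0 d m by (auto simp: coprime_to_def intro: gr0I)
  have gc: "(q gchoose i) \<in> carrier (Z_ring S)" for i unfolding q_def by (rule Z_ring_gbinomial[OF mm])
  have qc: "q \<in> carrier (Z_ring S)" using gc[of 1] by simp
  have y: "?y \<in> carrier B" by (rule smult_closed[OF qc one_closed])
  have e: "?e \<in> carrier B" using ad by simp
  have wf: "witt_factor B a (d, m, m') = ps_stretch B ?l (\<lambda>j. ([((- 1) ^ j :: int)] \<cdot>\<^bsub>B\<^esub> ?b j) \<otimes>\<^bsub>B\<^esub> ?e [^]\<^bsub>B\<^esub> j)"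
    by (simp only: witt_factor_def q_def prod.case)
  have "neg_log_deriv B (\<lambda>j. ([((- 1) ^ j :: int)] \<cdot>\<^bsub>B\<^esub> ?b j) \<otimes>\<^bsub>B\<^esub> ?e [^]\<^bsub>B\<^esub> j)
    (\<lambda>j. if j = 0 then \<zero>\<^bsub>B\<^esub> else ?y \<otimes>\<^bsub>B\<^esub> ?e [^]\<^bsub>B\<^esub> j)"
    by (rule neg_log_deriv_alternating[OF smult_closed[OF gc one_closed] y e
          Z_algebra_gbinomial_rec[OF alg mm q_def]])
  note D = neg_log_deriv_stretch[OF this, of ?l]
  have "[?l] \<cdot>\<^bsub>B\<^esub> ps_stretch B ?l (\<lambda>j. if j = 0 then \<zero>\<^bsub>B\<^esub> else ?y \<otimes>\<^bsub>B\<^esub> ?e [^]\<^bsub>B\<^esub> j) i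
    = (if i > 0 \<and> ?l dvd i then [(int d * moebius m')] \<cdot>\<^bsub>B\<^esub> (a d [^]\<^bsub>B\<^esub> (i div (d * m))) else \<zero>\<^bsub>B\<^esub>)" for i
  proof (cases "i > 0 \<and> ?l dvd i")
    case True
    then obtain k where k: "i = ?l * k" by auto
    have k0: "k > 0" using True k by (auto intro: gr0I)
    have "rat_of_nat ?l * q = of_int (int d * moebius m')"
      using pos by (simp add: q_def)
    then have ly: "[?l] \<cdot>\<^bsub>B\<^esub> ?y = [(int d * moebius m')] \<cdot>\<^bsub>B\<^esub> \<one>\<^bsub>B\<^esub>"
      by (simp only: Z_algebra_nat_mult[OF alg qc one_closed] Z_algebra_of_int[OF alg])
    have ek: "?e [^]\<^bsub>B\<^esub> k = a d [^]\<^bsub>B\<^esub> (i div (d * m))"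
      using pos k ad by (simp add: nat_pow_pow mult.assoc)
    have "[?l] \<cdot>\<^bsub>B\<^esub> ps_stretch B ?l (\<lambda>j. if j = 0 then \<zero>\<^bsub>B\<^esub> else ?y \<otimes>\<^bsub>B\<^esub> ?e [^]\<^bsub>B\<^esub> j) i
      = [?l] \<cdot>\<^bsub>B\<^esub> (?y \<otimes>\<^bsub>B\<^esub> ?e [^]\<^bsub>B\<^esub> k)"
      using k k0 pos by (simp add: ps_stretch_def)
    also have "\<dots> = ([?l] \<cdot>\<^bsub>B\<^esub> ?y) \<otimes>\<^bsub>B\<^esub> ?e [^]\<^bsub>B\<^esub> k"
      by (rule add_pow_ldistr[symmetric]) (use y e in auto)
    also have "\<dots> = [(int d * moebius m')] \<cdot>\<^bsub>B\<^esub> (\<one>\<^bsub>B\<^esub> \<otimes>\<^bsub>B\<^esub> ?e [^]\<^bsub>B\<^esub> k)"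
      unfolding ly by (rule add_pow_ldistr_int) (use e in auto)
    also have "\<dots> = [(int d * moebius m')] \<cdot>\<^bsub>B\<^esub> (a d [^]\<^bsub>B\<^esub> (i div (d * m)))"
      unfolding ek using ad by simp
    finally show ?thesis using True by simp
  next
    case False
    then show ?thesis by (auto simp: ps_stretch_def)
  qed
  then show "neg_log_deriv B (witt_factor B a (d, m, m'))
    (\<lambda>i. if i > 0 \<and> d * m * m' dvd i then [(int d * moebius m')] \<cdot>\<^bsub>B\<^esub> (a d [^]\<^bsub>B\<^esub> (i div (d * m))) else \<zero>\<^bsub>B\<^esub>)"
    using D pos unfolding wf by simp
  have "1 \<odot>\<^bsub>B\<^esub> \<one>\<^bsub>B\<^esub> = \<one>\<^bsub>B\<^esub>" using smult_one[of "\<one>\<^bsub>B\<^esub>"] by simp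
  then show "witt_factor B a (d, m, m') 0 = \<one>\<^bsub>B\<^esub>"
    unfolding wf by (simp add: ps_stretch_def add.int_pow_1)
qed

text \<open>
  In degree \<open>i\<close> the negative logarithmic derivatives of the factors add up to \<open>\<Sum>\<^sub>d d * a\<^sub>d ^ (s / d)\<close> over the
  divisors \<open>d\<close> of the \<open>S\<close>-part \<open>s\<close> of \<open>i\<close>. This is the ghost component of \<open>a\<close> at \<open>s\<close>, hence the coefficient
  of \<open>t ^ i\<close> in the negative logarithmic derivative of \<open>f\<close>.
\<close>
lemma witt_product_formula:
  assumes S: "divisor_stable S" "mult_closed S"
    and alg: "algebra (Z_ring S) B" and tf: "torsion_free B"
    and a: "\<And>d. d \<in> S \<Longrightarrow> a d \<in> carrier B"
    and ghost: "\<And>s. s \<in> S \<Longrightarrow> ghost_map B S a s = g s"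
    and g_part: "\<And>s m. s > 0 \<Longrightarrow> m \<in> coprime_to S \<Longrightarrow> g (s * m) = g s"
    and f: "neg_log_deriv B f (\<lambda>n. if n = 0 then \<zero>\<^bsub>B\<^esub> else g n)" "f 0 = \<one>\<^bsub>B\<^esub>"
  shows "f n = (\<Otimes>\<^bsub>power_series B\<^esub>t\<in>witt_factor_indices S n. witt_factor B a t) n"
proof -
  interpret algebra "Z_ring S" B by (rule alg)
  interpret P: cring "power_series B" by (rule power_series_cring)
  let ?T = "witt_factor_indices S n"
  have S0: "0 \<notin> S" using S(1) by (simp add: divisor_stable_def)
  note T = finite_witt_factor_indices[OF S0, of n]
  define p where "p = (\<lambda>(d, m, m') i. if i > 0 \<and> d * m * m' dvd i
    then [(int d * moebius m')] \<cdot>\<^bsub>B\<^esub> (a d [^]\<^bsub>B\<^esub> (i div (d * m))) else \<zero>\<^bsub>B\<^esub>)"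
  have D: "neg_log_deriv B (witt_factor B a t) (p t)" "witt_factor B a t 0 = \<one>\<^bsub>B\<^esub>" if "t \<in> ?T" for t
  proof -
    obtain d m m' where t: "t = (d, m, m')" "d \<in> S" "m \<in> coprime_to S" "m' \<in> coprime_to S"
      using \<open>t \<in> ?T\<close> by (auto simp: witt_factor_indices_def)
    show "neg_log_deriv B (witt_factor B a t) (p t)" "witt_factor B a t 0 = \<one>\<^bsub>B\<^esub>"
      unfolding t(1) p_def prod.case
      using neg_log_deriv_witt_factor[OF alg S0 t(2-4), of a, OF a[OF t(2)]] by auto
  qed
  have sum: "(\<Oplus>\<^bsub>power_series B\<^esub>t\<in>?T. p t) i = (if i = 0 then \<zero>\<^bsub>B\<^esub> else g i)" if i_le: "i \<le> n" for i
  proof -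
    have 1: "(\<Oplus>\<^bsub>power_series B\<^esub>t\<in>?T. p t) i = (\<Oplus>\<^bsub>B\<^esub>t\<in>?T. p t i)"
      by (rule ps_finsum_coeff[OF T]) (use D in \<open>auto simp: neg_log_deriv_def\<close>)
    show ?thesis
    proof (cases "i = 0")
      case True
      have "(\<Oplus>\<^bsub>B\<^esub>t\<in>?T. p t 0) = \<zero>\<^bsub>B\<^esub>" by (rule add.finprod_one_eqI) (auto simp: p_def)
      then show ?thesis unfolding 1 using True by simp
    next
      case False
      then have i: "i > 0" by simp
      obtain s m\<^sub>0 where sm: "i = s * m\<^sub>0" "s \<in> S" "m\<^sub>0 \<in> coprime_to S" using coprime_to_part[OF S i] .
      have s0: "s > 0" using i sm(1) by (auto intro: gr0I)
      \<comment> \<open>The family \<open>a\<close> is specified only on \<open>S\<close>, which is why the monomials \<open>a\<^sub>d ^ j\<close> are indexed by \<open>d \<in> S\<close>.\<close>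
      let ?E = "{d\<in>S. d \<le> i} \<times> {1..i}"
      define h where "h = (\<lambda>(d, j). a d [^]\<^bsub>B\<^esub> (j :: nat))"
      define c where "c = (\<lambda>(d, m, m') (d', j). if d' = d \<and> d * m * m' dvd i \<and> j = i div (d * m) then int d * moebius m' else 0)"
      have E: "finite ?E" by simp
      have hE: "h e \<in> carrier B" if "e \<in> ?E" for e using that a by (auto simp: h_def)
      have pt: "p t i = (\<Oplus>\<^bsub>B\<^esub>e\<in>?E. [(c t e)] \<cdot>\<^bsub>B\<^esub> h e)" if "t \<in> ?T" for t
      proof -
        obtain d m m' where t: "t = (d, m, m')" "d \<in> S" "m \<in> coprime_to S" "m' \<in> coprime_to S"
          using \<open>t \<in> ?T\<close> by (auto simp: witt_factor_indices_def)
        have pos: "d > 0" "m > 0" using S0 t by (auto simp: coprime_to_def intro: gr0I)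
        show ?thesis
        proof (cases "d * m * m' dvd i")
          case False
          then have "(\<Oplus>\<^bsub>B\<^esub>e\<in>?E. [(c t e)] \<cdot>\<^bsub>B\<^esub> h e) = \<zero>\<^bsub>B\<^esub>"
            by (intro add.finprod_one_eqI) (auto simp: c_def t add_pow_int_ge)
          then show ?thesis using False by (simp add: p_def t)
        next
          case True
          have dm: "d * m dvd i" using True dvd_mult_left by blast
          then have "d * m \<le> i" using i by (rule dvd_imp_le)
          have di: "d \<le> i" by (rule le_trans[OF _ \<open>d * m \<le> i\<close>]) (use pos in simp)
          have idm: "i div (d * m) > 0" using \<open>d * m \<le> i\<close> pos by (simp add: div_greater_zero_iff)
          let ?e = "(d, i div (d * m))"
          have eE: "?e \<in> ?E" using t(2) di idm by auto
          have "(\<Oplus>\<^bsub>B\<^esub>e\<in>?E. [(c t e)] \<cdot>\<^bsub>B\<^esub> h e) = (\<Oplus>\<^bsub>B\<^esub>e\<in>?E. if ?e = e then [(int d * moebius m')] \<cdot>\<^bsub>B\<^esub> h e else \<zero>\<^bsub>B\<^esub>)"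
          proof (rule finsum_cong')
            fix e assume "e \<in> ?E"
            show "[(c t e)] \<cdot>\<^bsub>B\<^esub> h e = (if ?e = e then [(int d * moebius m')] \<cdot>\<^bsub>B\<^esub> h e else \<zero>\<^bsub>B\<^esub>)"
              using True by (cases e) (auto simp: c_def t add_pow_int_ge)
          qed (use hE in auto)
          also have "\<dots> = [(int d * moebius m')] \<cdot>\<^bsub>B\<^esub> h ?e"
            by (rule add.finprod_singleton[OF eE E]) (use hE in auto)
          finally show ?thesis using True i by (simp add: p_def t h_def)
        qed
      qed
      have "(\<Oplus>\<^bsub>B\<^esub>t\<in>?T. p t i) = (\<Oplus>\<^bsub>B\<^esub>t\<in>?T. \<Oplus>\<^bsub>B\<^esub>e\<in>?E. [(c t e)] \<cdot>\<^bsub>B\<^esub> h e)"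
        by (rule finsum_cong') (use pt hE in \<open>auto intro!: finsum_closed\<close>)
      also have "\<dots> = (\<Oplus>\<^bsub>B\<^esub>e\<in>?E. [(\<Sum>t\<in>?T. c t e)] \<cdot>\<^bsub>B\<^esub> h e)"
        by (rule finsum_int_combination[OF T E hE])
      also have "\<dots> = (\<Oplus>\<^bsub>B\<^esub>e\<in>(\<lambda>d. (d, s div d)) ` {d. d dvd s}. [(int (fst e))] \<cdot>\<^bsub>B\<^esub> h e)"
      proof (rule add.finprod_mono_neutral_cong_right[OF E])
        have c_sum: "(\<Sum>t\<in>?T. c t e) = (if fst e * snd e = s then int (fst e) else 0)" if "e \<in> ?E" for e
        proof -
          have "(\<Sum>t\<in>?T. c t e) = (\<Sum>(d', m, m')\<in>?T.
            if fst e = d' \<and> d' * m * m' dvd i \<and> snd e = i div (d' * m) then int d' * moebius m' else 0)"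
            by (rule sum.cong) (auto simp: c_def split_beta)
          also have "\<dots> = (if fst e * snd e = s then int (fst e) else 0)"
            by (rule sum_moebius_witt_factor[OF S sm i_le]) (use that in auto)
          finally show ?thesis .
        qed
        show sub: "(\<lambda>d. (d, s div d)) ` {d. d dvd s} \<subseteq> ?E"
        proof (rule image_subsetI)
          fix d assume "d \<in> {d. d dvd s}"
          then have d: "d dvd s" by simp
          have "d \<in> S" using d sm(2) S(1) by (auto simp: divisor_stable_def)
          moreover have "d \<le> s" using d s0 by (rule dvd_imp_le)
          moreover have "s \<le> i" using sm(1) i by simp
          moreover have "s div d > 0" using d s0 \<open>d \<le> s\<close> by (auto simp: div_greater_zero_iff intro: gr0I)
          moreover have "s div d \<le> i" by (rule le_trans[OF _ \<open>s \<le> i\<close>]) simp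
          ultimately show "(d, s div d) \<in> ?E" by auto
        qed
        show "[(\<Sum>t\<in>?T. c t e)] \<cdot>\<^bsub>B\<^esub> h e = \<zero>\<^bsub>B\<^esub>" if "e \<in> ?E - (\<lambda>d. (d, s div d)) ` {d. d dvd s}" for e
        proof -
          have "fst e * snd e \<noteq> s"
          proof
            assume eq: "fst e * snd e = s"
            then have "fst e > 0" using s0 by (auto intro: gr0I)
            then have "e = (fst e, s div fst e)" using eq by (auto simp: prod_eq_iff)
            moreover have "fst e dvd s" using eq by auto
            ultimately show False using that by blast
          qed
          then show ?thesis using c_sum that by (simp add: add_pow_int_ge)
        qed
        show "[(\<Sum>t\<in>?T. c t e)] \<cdot>\<^bsub>B\<^esub> h e = [(int (fst e))] \<cdot>\<^bsub>B\<^esub> h e"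
          if e: "e \<in> (\<lambda>d. (d, s div d)) ` {d. d dvd s}" for e
        proof -
          have "fst e * snd e = s" using e by auto
          then show ?thesis using c_sum subsetD[OF sub e] by simp
        qed
      qed (use hE in auto)
      also have "\<dots> = (\<Oplus>\<^bsub>B\<^esub>d\<in>{d. d dvd s}. [(int (fst (d, s div d)))] \<cdot>\<^bsub>B\<^esub> h (d, s div d))"
        by (rule finsum_reindex)
          (use a S(1) sm(2) in \<open>auto simp: inj_on_def h_def divisor_stable_def\<close>)
      also have "\<dots> = (\<Oplus>\<^bsub>B\<^esub>d\<in>{d. d dvd s}. [d] \<cdot>\<^bsub>B\<^esub> (a d [^]\<^bsub>B\<^esub> (s div d)))"
        by (simp add: h_def add_pow_int_ge)
      also have "\<dots> = g s" using ghost[OF sm(2)] sm(2) by (simp add: ghost_map_def)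
      finally show ?thesis unfolding 1 using g_part[OF s0 sm(3)] sm(1) False by simp
    qed
  qed
  have 1: "neg_log_deriv B (\<Otimes>\<^bsub>power_series B\<^esub>t\<in>?T. witt_factor B a t) (\<Oplus>\<^bsub>power_series B\<^esub>t\<in>?T. p t)"
    by (rule neg_log_deriv_finprod[OF T D(1)])
  have "(\<Otimes>\<^bsub>power_series B\<^esub>t\<in>?T. witt_factor B a t) 0 = \<one>\<^bsub>B\<^esub>"
    by (rule ps_finprod_const_coeff[OF T]) (use D in \<open>simp_all add: neg_log_deriv_def\<close>)
  then have 3: "(\<Otimes>\<^bsub>power_series B\<^esub>t\<in>?T. witt_factor B a t) 0 = f 0" using f(2) by simp
  have 4: "(\<Oplus>\<^bsub>power_series B\<^esub>t\<in>?T. p t) 0 = \<zero>\<^bsub>B\<^esub>" using sum[of 0] by simp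
  show ?thesis
    by (rule neg_log_deriv_unique[OF tf 1 f(1) 3 4 sum le_refl, symmetric])
qed

section \<open>The kernel\<close>

lemma witt_factor_vanishing:
  assumes alg: "algebra (Z_ring S) B" and S0: "0 \<notin> S" and C: "cring C" and \<pi>: "\<pi> \<in> ring_hom B C"
    and d: "d \<in> S" and m: "m \<in> coprime_to S" "m' \<in> coprime_to S"
    and ad: "a d \<in> carrier B" "\<pi> (a d) = \<zero>\<^bsub>C\<^esub>"
  shows "(\<lambda>i. \<pi> (witt_factor B a (d, m, m') i)) = \<one>\<^bsub>power_series C\<^esub>"
proof
  fix i
  interpret B: algebra "Z_ring S" B by (rule alg)
  interpret C: cring C by (rule C)
  interpret \<pi>: ring_hom_cring B C \<pi> by (intro ring_hom_cringI B.M_cring C \<pi>)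
  have pos: "d > 0" "m > 0" "m' > 0" using S0 d m by (auto simp: coprime_to_def intro: gr0I)
  show "\<pi> (witt_factor B a (d, m, m') i) = \<one>\<^bsub>power_series C\<^esub> i"
  proof (cases "d * m * m' dvd i \<and> i > 0")
    case False
    then consider "i = 0" | "i > 0" "\<not> d * m * m' dvd i" by auto
    then show ?thesis
    proof cases
      case 1
      then show ?thesis using neg_log_deriv_witt_factor(2)[OF alg S0 d m, of a, OF ad(1)] by simp
    next
      case 2
      then show ?thesis by (simp add: witt_factor_def ps_stretch_def)
    qed
  next
    case True
    define j where "j = i div (d * m * m')"
    have j: "j > 0" using True pos unfolding j_def by (auto simp: div_greater_zero_iff dvd_imp_le)
    define u where "u = [((- 1) ^ j :: int)] \<cdot>\<^bsub>B\<^esub> (((of_int (moebius m') / of_nat (m * m')) gchoose j) \<odot>\<^bsub>B\<^esub> \<one>\<^bsub>B\<^esub>)"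
    have u: "u \<in> carrier B" unfolding u_def
      by (intro B.add.int_pow_closed B.smult_closed Z_ring_gbinomial coprime_to_mult m B.one_closed)
    have "witt_factor B a (d, m, m') i = u \<otimes>\<^bsub>B\<^esub> (a d [^]\<^bsub>B\<^esub> m') [^]\<^bsub>B\<^esub> j"
      using True by (simp add: witt_factor_def ps_stretch_def u_def j_def)
    then have "\<pi> (witt_factor B a (d, m, m') i) = \<pi> u \<otimes>\<^bsub>C\<^esub> (\<pi> (a d) [^]\<^bsub>C\<^esub> m') [^]\<^bsub>C\<^esub> j"
      using u ad by simp
    also have "\<dots> = \<zero>\<^bsub>C\<^esub>" using ad(2) pos j u by (simp add: C.nat_pow_zero)
    finally show ?thesis using True by simp
  qed
qed

text \<open>
  Apply \<open>\<pi>\<close> to the factorization of \<open>f\<close>. The factors with \<open>d < n\<close> become \<open>1\<close>. The index set bounds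
  \<open>d * m * m'\<close> by \<open>n\<close>, so the only other possible index is \<open>(n, 1, 1)\<close>, present if \<open>n \<in> S\<close>, and its factor
  is \<open>1 - a\<^sub>n t ^ n\<close>.
\<close>
lemma witt_coefficient_congruence:
  assumes S: "divisor_stable S" "mult_closed S"
    and alg: "algebra (Z_ring S) B" and tf: "torsion_free B"
    and a: "\<And>d. d \<in> S \<Longrightarrow> a d \<in> carrier B"
    and ghost: "\<And>s. s \<in> S \<Longrightarrow> ghost_map B S a s = g s"
    and g_part: "\<And>s m. s > 0 \<Longrightarrow> m \<in> coprime_to S \<Longrightarrow> g (s * m) = g s"
    and f: "neg_log_deriv B f (\<lambda>n. if n = 0 then \<zero>\<^bsub>B\<^esub> else g n)" "f 0 = \<one>\<^bsub>B\<^esub>"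
    and C: "cring C" and \<pi>: "\<pi> \<in> ring_hom B C"
    and n: "n > 0" and van: "\<And>d. d \<in> S \<Longrightarrow> d < n \<Longrightarrow> \<pi> (a d) = \<zero>\<^bsub>C\<^esub>"
  shows "\<pi> (f n) = (if n \<in> S then \<ominus>\<^bsub>C\<^esub> \<pi> (a n) else \<zero>\<^bsub>C\<^esub>)"
proof -
  interpret B: algebra "Z_ring S" B by (rule alg)
  interpret C: cring C by (rule C)
  interpret \<pi>: ring_hom_cring B C \<pi> by (intro ring_hom_cringI B.M_cring C \<pi>)
  interpret PC: cring "power_series C" by (rule C.power_series_cring)
  interpret P: ring_hom_cring "power_series B" "power_series C" "\<lambda>f n. \<pi> (f n)"
    by (intro ring_hom_cringI power_series_map_hom B.M_cring C \<pi> B.power_series_cring C.power_series_cring)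
  let ?T = "witt_factor_indices S n"
  let ?H = "\<lambda>t i. \<pi> (witt_factor B a t i)"
  have S0: "0 \<notin> S" using S(1) by (simp add: divisor_stable_def)
  note T = finite_witt_factor_indices[OF S0, of n]
  have c: "witt_factor B a t \<in> carrier (power_series B)" if "t \<in> ?T" for t
  proof -
    obtain d m m' where t: "t = (d, m, m')" "d \<in> S" "m \<in> coprime_to S" "m' \<in> coprime_to S"
      using \<open>t \<in> ?T\<close> by (auto simp: witt_factor_indices_def)
    show ?thesis using neg_log_deriv_witt_factor(1)[OF alg S0 t(2-4), of a, OF a[OF t(2)]]
      unfolding t(1) neg_log_deriv_def by blast
  qed
  have "\<pi> (f n) = \<pi> ((\<Otimes>\<^bsub>power_series B\<^esub>t\<in>?T. witt_factor B a t) n)"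
    using witt_product_formula[OF S alg tf, of a g f n] a ghost g_part f by simp
  also have "\<dots> = (\<Otimes>\<^bsub>power_series C\<^esub>t\<in>?T. ?H t) n"
    using P.hom_finprod[of "witt_factor B a" ?T] c by (simp add: fun_eq_iff comp_def)
  also have "\<dots> = (if n \<in> S then \<ominus>\<^bsub>C\<^esub> \<pi> (a n) else \<zero>\<^bsub>C\<^esub>)"
  proof -
    have one: "?H t = \<one>\<^bsub>power_series C\<^esub>" if "t \<in> ?T" "t \<noteq> (n, 1, 1)" for t
    proof -
      obtain d m m' where t: "t = (d, m, m')" "d \<in> S" "m \<in> coprime_to S" "m' \<in> coprime_to S" "d * m * m' \<le> n"
        using \<open>t \<in> ?T\<close> by (auto simp: witt_factor_indices_def)
      have pos: "d > 0" "m > 0" "m' > 0" using S0 t by (auto simp: coprime_to_def intro: gr0I)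
      have "d < n"
      proof (rule ccontr)
        assume "\<not> d < n"
        then have "n * (m * m') \<le> d * (m * m')" by (intro mult_le_mono1) simp
        also have "\<dots> \<le> n" using t(5) by (simp only: mult.assoc)
        finally have "n * (m * m') \<le> n * 1" by (simp only: mult_1_right)
        then have "m * m' \<le> 1" using n by (simp only: mult_le_cancel1)
        then have "m = 1" "m' = 1" using pos by (auto simp: le_Suc_eq)
        then show False using that(2) t \<open>\<not> d < n\<close> by simp
      qed
      then show ?thesis unfolding t(1)
        by (intro witt_factor_vanishing[OF alg S0 C \<pi> t(2-4)] a van t)
    qed
    show ?thesis
    proof (cases "n \<in> S")
      case False
      then have "(n, 1, 1) \<notin> ?T" by (auto simp: witt_factor_indices_def)
      then have "(\<Otimes>\<^bsub>power_series C\<^esub>t\<in>?T. ?H t) = \<one>\<^bsub>power_series C\<^esub>"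
        using one by (intro PC.finprod_one_eqI) metis
      then show ?thesis using False n by simp
    next
      case True
      have n1: "(n, 1, 1) \<in> ?T" using True by (auto simp: witt_factor_indices_def coprime_to_def)
      have Hc: "?H t \<in> carrier (power_series C)" if "t \<in> ?T" for t using P.hom_closed[OF c[OF that]] .
      have "(\<Otimes>\<^bsub>power_series C\<^esub>t\<in>?T. ?H t) = (\<Otimes>\<^bsub>power_series C\<^esub>t\<in>{(n, 1, 1)}. ?H t)"
        by (rule PC.finprod_mono_neutral_cong_right[OF T]) (use n1 one Hc in auto)
      also have "\<dots> = ?H (n, 1, 1)" using Hc[OF n1] by simp
      finally have 1: "(\<Otimes>\<^bsub>power_series C\<^esub>t\<in>?T. ?H t) n = \<pi> (witt_factor B a (n, 1, 1) n)" by simp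
      have mu: "moebius (Suc 0) = 1" by (simp add: moebius_def)
      have b1: "1 \<odot>\<^bsub>B\<^esub> \<one>\<^bsub>B\<^esub> = \<one>\<^bsub>B\<^esub>" using B.smult_one[of "\<one>\<^bsub>B\<^esub>"] by simp
      have "[((- 1) ^ 1 :: int)] \<cdot>\<^bsub>B\<^esub> \<one>\<^bsub>B\<^esub> = \<ominus>\<^bsub>B\<^esub> \<one>\<^bsub>B\<^esub>" by (subst B.sign_int_mult) auto
      then have "witt_factor B a (n, 1, 1) n = \<ominus>\<^bsub>B\<^esub> a n"
        using n a[OF True] by (simp add: witt_factor_def ps_stretch_def mu b1 B.l_minus)
      then show ?thesis unfolding 1 using True a[OF True] by simp
    qed
  qed
  finally show ?thesis .
qed

theorem theorem3p1:
  fixes S :: "nat set" and N :: enat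
    and B :: "(rat, 'b) module" and R :: "(rat, 'r) module"
    and \<psi> :: "nat \<Rightarrow> 'b \<Rightarrow> 'b" and lam :: "nat \<Rightarrow> 'b \<Rightarrow> 'b"
    and \<pi> :: "'b \<Rightarrow> 'r" and \<alpha> :: "'b \<Rightarrow> nat \<Rightarrow> 'b"
  assumes "divisor_stable S" and "mult_closed S"
    and "algebra (Z_ring S) B" and "torsion_free B"
    and "\<And>p. p \<in> S \<Longrightarrow> prime p \<Longrightarrow> frobenius_lift B p (\<psi> p)"
    and "\<And>p q x. p \<in> S \<Longrightarrow> prime p \<Longrightarrow> q \<in> S \<Longrightarrow> prime q \<Longrightarrow> x \<in> carrier B \<Longrightarrow>
           \<psi> p (\<psi> q x) = \<psi> q (\<psi> p x)"
    and "special_lambda_ring B lam"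
    and "\<And>n x. n \<ge> 1 \<Longrightarrow> x \<in> carrier B \<Longrightarrow> adams_op B lam n x = psi_S S \<psi> n x"
    and "algebra (Z_ring S) R"
    and "\<pi> \<in> ring_hom B R"
    and "\<And>a x. a \<in> carrier (Z_ring S) \<Longrightarrow> x \<in> carrier B \<Longrightarrow>
           \<pi> (a \<odot>\<^bsub>B\<^esub> x) = a \<odot>\<^bsub>R\<^esub> \<pi> x"
    and "1 \<le> N"
    and "\<alpha> \<in> ring_hom B (witt_ring S B)"
    and "\<And>x. x \<in> carrier B \<Longrightarrow> ghost_map B S (\<alpha> x) = (\<lambda>n\<in>S. psi_S S \<psi> n x)"
  shows "a_kernel B (witt_ring (truncate_set S N) R)
             (\<lambda>x. witt_proj (truncate_set S N) (witt_map S \<pi> (\<alpha> x)))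
           = {x \<in> carrier B. \<forall>n. 1 \<le> n \<and> enat n < N \<longrightarrow> \<pi> (lam n x) = \<zero>\<^bsub>R\<^esub>}
         \<and> (\<forall>x\<in>carrier B. lambda_series B lam x \<in> Lambda B \<and>
           has_tadic_prod (rationalization B) S
             (\<lambda>k. one_minus_power (rationalization B) k (tau B (psi_S S \<psi>) k x))
             (\<lambda>n. to_rat B (lambda_series B lam x n)))
         \<and> (\<forall>x\<in>carrier B. \<forall>n\<ge>1.
           to_rat B ([((- 1 :: int) ^ n)] \<cdot>\<^bsub>B\<^esub> lam n x) =
             (\<Oplus>\<^bsub>rationalization B\<^esub>\<nu>\<in>{\<nu>. Poly_Mapping.keys \<nu> \<subseteq> S \<and> tuple_weight \<nu> = n}.
                [((- 1 :: int) ^ tuple_size \<nu>)] \<cdot>\<^bsub>rationalization B\<^esub>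
                  binom_tuple (rationalization B) (\<lambda>k. tau B (psi_S S \<psi>) k x) \<nu>))"
proof -
  note S = assms(1,2)
  interpret B: algebra "Z_ring S" B by (rule assms(3))
  interpret R: algebra "Z_ring S" R by (rule assms(9))
  interpret T: torsion_free_cring B by unfold_locales (rule assms(4))
  interpret \<pi>: ring_hom_cring B R \<pi> by (intro ring_hom_cringI B.M_cring R.M_cring assms(10))
  have S0: "0 \<notin> S" using S(1) by (simp add: divisor_stable_def)
  let ?g = "psi_S S \<psi>" and ?f = "lambda_series B lam"
  have lam: "lam n x \<in> carrier B" "lam 0 x = \<one>\<^bsub>B\<^esub>" if "x \<in> carrier B" for n x
    using assms(7) that unfolding special_lambda_ring_def by auto
  have f: "neg_log_deriv B (?f x) (\<lambda>n. if n = 0 then \<zero>\<^bsub>B\<^esub> else ?g n x)" if x: "x \<in> carrier B" for x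
  proof -
    have "(\<lambda>n. adams_op B lam n x) = (\<lambda>n. if n = 0 then \<zero>\<^bsub>B\<^esub> else ?g n x)"
      using assms(8)[OF _ x] B.neg_log_deriv_adams(2)[of lam x, OF lam[OF x]] by (auto simp: fun_eq_iff)
    then show ?thesis using B.neg_log_deriv_adams(1)[of lam x, OF lam[OF x]] by simp
  qed
  have f0: "?f x 0 = \<one>\<^bsub>B\<^esub>" if "x \<in> carrier B" for x
    using lam(2)[OF that] by (simp add: lambda_series_def B.add.int_pow_1)
  have g_closed: "?g n x \<in> carrier B" if "x \<in> carrier B" "n > 0" for n x
  proof -
    have "(if n = 0 then \<zero>\<^bsub>B\<^esub> else ?g n x) \<in> carrier B"
      using f[OF that(1)] by (simp only: neg_log_deriv_def ps_carrier_iff)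
    then show ?thesis using that(2) by simp
  qed
  have g_part: "?g (s * m) x = ?g s x" if "s > 0" "m \<in> coprime_to S" for s m x
    by (simp only: psi_S_cong_part[OF that])
  have \<alpha>: "\<alpha> x d \<in> carrier B" if "x \<in> carrier B" "d \<in> S" for x d
    using ring_hom_closed[OF assms(13) that(1)] that(2) by (auto simp: witt_ring_def)
  have coeff: "\<pi> (?f x n) = (if n \<in> S then \<ominus>\<^bsub>R\<^esub> \<pi> (\<alpha> x n) else \<zero>\<^bsub>R\<^esub>)"
    if x: "x \<in> carrier B" and "n > 0" "\<And>d. d \<in> S \<Longrightarrow> d < n \<Longrightarrow> \<pi> (\<alpha> x d) = \<zero>\<^bsub>R\<^esub>" for x n
    by (rule witt_coefficient_congruence[where g = "\<lambda>n. ?g n x", OF S assms(3,4) \<alpha>[OF x] _ g_part f[OF x] f0[OF x] R.M_cring assms(10) that(2,3)])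
      (use assms(14)[OF x] in auto)
  have lam_f: "\<pi> (lam n x) = \<zero>\<^bsub>R\<^esub> \<longleftrightarrow> \<pi> (?f x n) = \<zero>\<^bsub>R\<^esub>" if x: "x \<in> carrier B" for x n
    using lam(1)[OF x] \<pi>.hom_closed[OF lam(1)[OF x]]
    by (simp add: lambda_series_def B.sign_int_mult)
  have kernel: "(\<forall>n\<in>truncate_set S N. \<pi> (\<alpha> x n) = \<zero>\<^bsub>R\<^esub>) \<longleftrightarrow> (\<forall>n. 1 \<le> n \<and> enat n < N \<longrightarrow> \<pi> (lam n x) = \<zero>\<^bsub>R\<^esub>)"
    if x: "x \<in> carrier B" for x
  proof (intro iffI)
    assume *: "\<forall>n\<in>truncate_set S N. \<pi> (\<alpha> x n) = \<zero>\<^bsub>R\<^esub>"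
    have "\<pi> (lam n x) = \<zero>\<^bsub>R\<^esub>" if n: "1 \<le> n" "enat n < N" for n
    proof -
      have van: "\<pi> (\<alpha> x d) = \<zero>\<^bsub>R\<^esub>" if "d \<in> S" "d \<le> n" for d
      proof -
        have "enat d \<le> enat n" using that by simp
        then have "enat d < N" using n(2) by (rule le_less_trans)
        then show ?thesis using * that by (simp add: truncate_set_def)
      qed
      have "\<pi> (?f x n) = (if n \<in> S then \<ominus>\<^bsub>R\<^esub> \<pi> (\<alpha> x n) else \<zero>\<^bsub>R\<^esub>)"
        by (rule coeff[OF x]) (use n van in auto)
      then show ?thesis unfolding lam_f[OF x] using van[of n] by simp
    qed
    then show "\<forall>n. 1 \<le> n \<and> enat n < N \<longrightarrow> \<pi> (lam n x) = \<zero>\<^bsub>R\<^esub>" by blast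
  next
    assume *: "\<forall>n. 1 \<le> n \<and> enat n < N \<longrightarrow> \<pi> (lam n x) = \<zero>\<^bsub>R\<^esub>"
    have "n \<in> S \<Longrightarrow> enat n < N \<Longrightarrow> \<pi> (\<alpha> x n) = \<zero>\<^bsub>R\<^esub>" for n
    proof (induction n rule: less_induct)
      case (less n)
      have n: "n > 0" using less.prems(1) S0 by (auto intro: gr0I)
      have "\<pi> (\<alpha> x d) = \<zero>\<^bsub>R\<^esub>" if "d \<in> S" "d < n" for d
      proof -
        have "enat d < enat n" using that by simp
        then have "enat d < N" using less.prems(2) by (rule less_trans)
        then show ?thesis using less.IH[OF that(2,1)] by simp
      qed
      then have "\<pi> (?f x n) = \<ominus>\<^bsub>R\<^esub> \<pi> (\<alpha> x n)" using coeff[OF x n] less.prems(1) by simp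
      moreover have "\<pi> (?f x n) = \<zero>\<^bsub>R\<^esub>" using * n less.prems(2) lam_f[OF x] by auto
      ultimately show ?case using \<pi>.hom_closed[OF \<alpha>[OF x less.prems(1)]]
        by (metis R.minus_minus R.minus_zero)
    qed
    then show "\<forall>n\<in>truncate_set S N. \<pi> (\<alpha> x n) = \<zero>\<^bsub>R\<^esub>" by (simp add: truncate_set_def)
  qed
  have proj: "witt_proj (truncate_set S N) (witt_map S \<pi> (\<alpha> x)) = \<zero>\<^bsub>witt_ring (truncate_set S N) R\<^esub>
    \<longleftrightarrow> (\<forall>n\<in>truncate_set S N. \<pi> (\<alpha> x n) = \<zero>\<^bsub>R\<^esub>)" for x
    by (auto simp: witt_proj_def witt_map_def witt_ring_def truncate_set_def fun_eq_iff restrict_def)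
  have part1: "a_kernel B (witt_ring (truncate_set S N) R)
             (\<lambda>x. witt_proj (truncate_set S N) (witt_map S \<pi> (\<alpha> x)))
           = {x \<in> carrier B. \<forall>n. 1 \<le> n \<and> enat n < N \<longrightarrow> \<pi> (lam n x) = \<zero>\<^bsub>R\<^esub>}"
    unfolding a_kernel_def' proj using kernel by (intro Collect_cong conj_cong refl) blast
  have product: "(\<Otimes>\<^bsub>power_series T.K\<^esub>k\<in>F. one_minus_power T.K k (tau B ?g k x)) n = to_rat B (?f x n)"
    if x: "x \<in> carrier B" and F: "finite F" "F \<subseteq> S" "S \<inter> {..n} \<subseteq> F" for x F n
    by (rule T.product_formula[OF S F, where \<psi> = ?g and x = x, OF g_closed[OF x] g_part f[OF x] f0[OF x]])
  have part2: "?f x \<in> Lambda B \<and> has_tadic_prod T.K S (\<lambda>k. one_minus_power T.K k (tau B ?g k x)) (\<lambda>n. to_rat B (?f x n))"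
    if x: "x \<in> carrier B" for x
  proof
    show "?f x \<in> Lambda B" using f[OF x] f0[OF x] by (simp add: Lambda_def neg_log_deriv_def)
    show "has_tadic_prod T.K S (\<lambda>k. one_minus_power T.K k (tau B ?g k x)) (\<lambda>n. to_rat B (?f x n))"
      unfolding has_tadic_prod_def eventually_finite_subsets_at_top
    proof
      fix n
      show "\<exists>F. finite F \<and> F \<subseteq> S \<and> (\<forall>G. finite G \<and> F \<subseteq> G \<and> G \<subseteq> S \<longrightarrow>
        (\<Otimes>\<^bsub>power_series T.K\<^esub>k\<in>G. one_minus_power T.K k (tau B ?g k x)) n = to_rat B (?f x n))"
        by (intro exI[of _ "S \<inter> {..n}"] conjI allI impI product[OF x]) auto
    qed
  qed
  have part3: "to_rat B ([((- 1 :: int) ^ n)] \<cdot>\<^bsub>B\<^esub> lam n x) =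
             (\<Oplus>\<^bsub>T.K\<^esub>\<nu>\<in>{\<nu>. Poly_Mapping.keys \<nu> \<subseteq> S \<and> tuple_weight \<nu> = n}.
                [((- 1 :: int) ^ tuple_size \<nu>)] \<cdot>\<^bsub>T.K\<^esub> binom_tuple T.K (\<lambda>k. tau B ?g k x) \<nu>)"
    if x: "x \<in> carrier B" for x n
  proof -
    let ?F = "S \<inter> {..n}"
    have tau: "tau B ?g k x \<in> carrier T.K" if "k \<in> ?F" for k
      by (rule T.tau_closed) (use that S0 g_closed[OF x] in \<open>auto intro: gr0I\<close>)
    have "to_rat B (?f x n) = (\<Otimes>\<^bsub>power_series T.K\<^esub>k\<in>?F. one_minus_power T.K k (tau B ?g k x)) n"
      by (rule product[OF x, symmetric]) auto
    also have "\<dots> = (\<Oplus>\<^bsub>T.K\<^esub>\<nu>\<in>weighted_tuples ?F n.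
                [((- 1 :: int) ^ tuple_size \<nu>)] \<cdot>\<^bsub>T.K\<^esub> binom_tuple T.K (\<lambda>k. tau B ?g k x) \<nu>)"
      by (rule T.finite_product_expansion) (use S0 tau in auto)
    also have "weighted_tuples ?F n = {\<nu>. Poly_Mapping.keys \<nu> \<subseteq> S \<and> tuple_weight \<nu> = n}"
      using weighted_tuples_restrict[OF S0, of n] by (simp add: weighted_tuples_def)
    finally show ?thesis by (simp only: lambda_series_def)
  qed
  show ?thesis using part1 part2 part3 by blast
qed

end
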